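(* Assume that $h$ is non-decreasing and that there is no discounting, i.e. $L_T=\sum_{i=1}^{H_T}f(\eta_i)$ and $K_T=\sum_{i=1}^{H_T}g(\eta_i,\vartheta_i)$. Then $$\mathbb E[K_Th(L_T)]\ge\mu\sum_{n=1}^{+\infty}m_\Phi(\Delta^n)\sum_{p=0}^{+\infty}e^{-T\mu}\frac{(T\mu)^p}{p!}\,\mathbb E\left[g(\bar\eta_1,\bar\vartheta_1)\,\mathbb E\left[h\left(\sum_{k=1}^nf(\bar\eta_k)+\sum_{i=1}^pf(\eta_i)\right)\Big|\,\bar\eta_1\right]\right],$$ where $m_\Phi(\Delta^1):=T$ and, for $n\ge2$, $$m_\Phi(\Delta^n):=\int_0^T\int_0^{v_1}\cdots\int_0^{v_{n-1}}\prod_{i=2}^n\Phi(v_{i-1}-v_i)\,dv_n\cdots dv_1 .$$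
   Context: Fix $T>0$, $\mu>0$ and a bounded (measurable) function $\Phi:[0,T]\to\mathbb R_+$ with $\|\Phi\|_1=\int_0^T\Phi(s)ds<1$. Let $N$ be a Poisson random measure on $[0,T]\times\mathbb R_+$ with intensity $dt\otimes d\theta$, with natural filtration $\mathbb F^N$. $(H,\Lambda)$ is the unique $\mathbb F^N$-adapted solution of $$H_t=\int_{(0,t]}\int_{\mathbb R_+}\mathbf 1_{\{\theta\le\Lambda_s\}}N(ds,d\theta),\qquad\Lambda_t=\mu+\int_{(0,t)}\Phi(t-u)\,dH_u,\quad t\in[0,T],$$ a standard Hawkes process. Claims: $(\eta_1,\vartheta_1)$ is an $\mathbb R_+^2$-valued random variable, and $(\eta_i,\vartheta_i)_{i\ge2}$ and $(\bar\eta_i,\bar\vartheta_i)_{i\ge1}$ are independent copies of it (all these pairs are mutually independent), all independent of $N$ (hence of $H$). $f:\mathbb R_+\to\mathbb R_+$, $g:\mathbb R_+^2\to\mathbb R_+$, $h:\mathbb R_+\to\mathbb R_+$ are bounded (measurable) deterministic functions. Empty sums are $0$. *)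

theory Defs
  imports "HOL-Probability.Probability"
begin

definition poisson_random_measure ::
  "'w measure \<Rightarrow> 'e measure \<Rightarrow> ('w \<Rightarrow> 'e measure) \<Rightarrow> bool" where
  "poisson_random_measure M \<nu> N \<longleftrightarrow>
     (\<forall>\<omega>\<in>space M. sets (N \<omega>) = sets \<nu>) \<and>
     (\<forall>\<omega>\<in>space M. \<forall>A\<in>sets \<nu>. emeasure (N \<omega>) A \<in> range of_nat \<union> {\<infinity>}) \<and>
     (\<forall>A\<in>sets \<nu>. (\<lambda>\<omega>. emeasure (N \<omega>) A) \<in> borel_measurable M) \<and>
     (\<forall>A\<in>sets \<nu>. emeasure \<nu> A < \<infinity> \<longrightarrow>
        (\<forall>k. measure M {\<omega>\<in>space M. emeasure (N \<omega>) A = of_nat k} =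
             exp (- measure \<nu> A) * measure \<nu> A ^ k / fact k)) \<and>
     (\<forall>A :: nat \<Rightarrow> 'e set. range A \<subseteq> sets \<nu> \<longrightarrow> disjoint_family A \<longrightarrow>
        prob_space.indep_vars M (\<lambda>_. borel) (\<lambda>i \<omega>. emeasure (N \<omega>) (A i)) UNIV)"

definition strip_intensity :: "real \<Rightarrow> (real \<times> real) measure" where
  "strip_intensity T = restrict_space lborel ({0..T} \<times> {0..})"

definition noise_filtration ::
  "'w measure \<Rightarrow> ('w \<Rightarrow> (real \<times> real) measure) \<Rightarrow> real \<Rightarrow> 'w measure" where
  "noise_filtration M N t = sigma (space M)
     {(\<lambda>\<omega>. emeasure (N \<omega>) A) -` B \<inter> space M | A B.
        A \<in> sets borel \<and> A \<subseteq> {0..t} \<times> {0..} \<and> B \<in> sets borel}"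

text \<open>
  The integral against \<open>dH\<close> is the Lebesgue-Stieltjes integral; to use the library's
  measure for distribution functions on the whole line, the path is extended
  constantly outside the time interval, which adds no mass. The first of the path conditions is
  what makes the integrand of the thinning integral measurable.
\<close>

definition hawkes_process ::
  "'w measure \<Rightarrow> ('w \<Rightarrow> (real \<times> real) measure) \<Rightarrow> real \<Rightarrow> real \<Rightarrow> (real \<Rightarrow> real) \<Rightarrow>
   (real \<Rightarrow> 'w \<Rightarrow> nat) \<Rightarrow> (real \<Rightarrow> 'w \<Rightarrow> real) \<Rightarrow> bool" where
  "hawkes_process M N T \<mu> \<Phi> H \<Lambda> \<longleftrightarrow>
     (\<forall>t\<in>{0..T}. H t \<in> measurable (noise_filtration M N t) (count_space UNIV)) \<and>
     (\<forall>t\<in>{0..T}. \<Lambda> t \<in> borel_measurable (noise_filtration M N t)) \<and>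
     (AE \<omega> in M.
        (\<lambda>s. \<Lambda> s \<omega>) \<in> borel_measurable (restrict_space borel {0..T}) \<and>
        (\<forall>t\<in>{0..T}.
           of_nat (H t \<omega>) =
             (\<integral>\<^sup>+ z. indicator {(s, \<theta>). s \<in> {0<..t} \<and> 0 \<le> \<theta> \<and> \<theta> \<le> \<Lambda> s \<omega>} z \<partial>N \<omega>) \<and>
           \<Lambda> t \<omega> = \<mu> +
             (LINT u:{0<..<t}|interval_measure (\<lambda>u. real (H (max 0 (min T u)) \<omega>)). \<Phi> (t - u))))"

datatype source = Noise | Claim nat | Claim_bar nat

fun source_events ::
  "'w measure \<Rightarrow> ('w \<Rightarrow> (real \<times> real) measure) \<Rightarrow> real \<Rightarrow>
   (nat \<Rightarrow> 'w \<Rightarrow> real) \<Rightarrow> (nat \<Rightarrow> 'w \<Rightarrow> real) \<Rightarrow>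
   (nat \<Rightarrow> 'w \<Rightarrow> real) \<Rightarrow> (nat \<Rightarrow> 'w \<Rightarrow> real) \<Rightarrow> source \<Rightarrow> 'w set set" where
  "source_events M N T \<eta> \<theta> \<eta>' \<theta>' Noise = sets (noise_filtration M N T)"
| "source_events M N T \<eta> \<theta> \<eta>' \<theta>' (Claim i) =
     sets (vimage_algebra (space M) (\<lambda>\<omega>. (\<eta> i \<omega>, \<theta> i \<omega>)) borel)"
| "source_events M N T \<eta> \<theta> \<eta>' \<theta>' (Claim_bar i) =
     sets (vimage_algebra (space M) (\<lambda>\<omega>. (\<eta>' i \<omega>, \<theta>' i \<omega>)) borel)"

text \<open>Claims are numbered from 1; index 0 of the sequences is unconstrained and unused.\<close>

definition claim_sequences ::
  "'w measure \<Rightarrow> ('w \<Rightarrow> (real \<times> real) measure) \<Rightarrow> real \<Rightarrow>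
   (nat \<Rightarrow> 'w \<Rightarrow> real) \<Rightarrow> (nat \<Rightarrow> 'w \<Rightarrow> real) \<Rightarrow>
   (nat \<Rightarrow> 'w \<Rightarrow> real) \<Rightarrow> (nat \<Rightarrow> 'w \<Rightarrow> real) \<Rightarrow> bool" where
  "claim_sequences M N T \<eta> \<theta> \<eta>' \<theta>' \<longleftrightarrow>
     (\<forall>i\<ge>1. \<eta> i \<in> borel_measurable M \<and> \<theta> i \<in> borel_measurable M \<and>
            \<eta>' i \<in> borel_measurable M \<and> \<theta>' i \<in> borel_measurable M) \<and>
     (\<forall>i\<ge>1. \<forall>\<omega>\<in>space M. 0 \<le> \<eta> i \<omega> \<and> 0 \<le> \<theta> i \<omega> \<and> 0 \<le> \<eta>' i \<omega> \<and> 0 \<le> \<theta>' i \<omega>) \<and>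
     (\<forall>i\<ge>1. distr M borel (\<lambda>\<omega>. (\<eta> i \<omega>, \<theta> i \<omega>)) = distr M borel (\<lambda>\<omega>. (\<eta> 1 \<omega>, \<theta> 1 \<omega>)) \<and>
            distr M borel (\<lambda>\<omega>. (\<eta>' i \<omega>, \<theta>' i \<omega>)) = distr M borel (\<lambda>\<omega>. (\<eta> 1 \<omega>, \<theta> 1 \<omega>))) \<and>
     prob_space.indep_sets M (source_events M N T \<eta> \<theta> \<eta>' \<theta>')
       ({Noise} \<union> Claim ` {1..} \<union> Claim_bar ` {1..})"

text \<open>
  Iterated integral of \<open>F [v\<^sub>1, \<dots>, v\<^sub>n]\<close> over \<open>b \<ge> v\<^sub>1 \<ge> \<dots> \<ge> v\<^sub>n \<ge> 0\<close>,
  with the variable of largest index integrated innermost.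
\<close>

fun simplex_integral :: "nat \<Rightarrow> real \<Rightarrow> (real list \<Rightarrow> real) \<Rightarrow> real" where
  "simplex_integral 0 b F = F []"
| "simplex_integral (Suc n) b F = (LBINT v:{0..b}. simplex_integral n v (\<lambda>vs. F (v # vs)))"

text \<open>Since lists are indexed from 0, \<open>v\<^sub>i\<close> is \<open>vs ! (i - 1)\<close>.\<close>

definition m_Phi :: "(real \<Rightarrow> real) \<Rightarrow> real \<Rightarrow> nat \<Rightarrow> real" where
  "m_Phi \<Phi> T n =
     (if n = 1 then T
      else simplex_integral n T (\<lambda>vs. \<Prod>i=2..n. \<Phi> (vs ! (i - 2) - vs ! (i - 1))))"

end

theory Submission
  imports Defs
begin

text \<open>
  Write \<open>a m\<close> for the expectation of \<open>g\<close> at the first of \<open>m\<close> claims times \<open>h\<close> of the sum of the \<open>m\<close>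
  values of \<open>f\<close>; it is nondecreasing in \<open>m\<close>. By independence and exchangeability of the claims the
  left-hand side is the expectation of \<open>H\<^sub>T a(H\<^sub>T)\<close>, that is, of the integral of the constant \<open>a(H\<^sub>T)\<close>
  against \<open>dH\<close>, and the conditional expectations on the right are the numbers \<open>a(n + p)\<close>.

  Let \<open>R\<^sub>u\<close> be the number of noise points after time \<open>u\<close> below height \<open>\<mu>\<close>, all of which will be
  counted by \<open>H\<close>. At a jump time \<open>u\<close> of \<open>H\<close> we have \<open>H\<^sub>T \<ge> H\<^sub>u\<^sub>- + 1 + R\<^sub>u\<close>, and
  \<open>H\<^sub>t\<^sub>- + R\<^sub>t \<ge> H\<^sub>u\<^sub>- + 1 + R\<^sub>u\<close> for \<open>u < t\<close>. The integrand \<open>a(H\<^sub>u\<^sub>- + R\<^sub>u + 1)\<close> is independent of the noise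
  at time \<open>u\<close>, so \<open>dH\<^sub>u\<close> may be replaced by \<open>\<Lambda>\<^sub>u du\<close>. The summand \<open>\<mu>\<close> of the intensity contributes at
  least \<open>\<mu>\<close> times the expectation of \<open>a\<close> at one plus a Poisson variable; the other summand is again an
  integral against \<open>dH\<close>, with one more point counted in the argument of \<open>a\<close> and the weight convolved
  with \<open>\<Phi>\<close>. Iterating produces the simplex integrals term by term.
\<close>

text \<open>The obstacle is that R_u looks into the future, so compensation of predictable
  integrands does not apply to a(H_(u-) + R_u + 1). What survives is that the integrand ignores the
  noise at the instant u itself. For a set of points inside a time strip, weighted by an event
  decided by the noise outside the strip, compensation is just independence and the Poisson mean;
  such rectangles generate the sigma-algebra \<open>bipred\<close>, and the formula extends to it.
  To use it, the thinned integrand must be measurable jointly in path and point, while \<Lambda> is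
  only given as adapted at each time with measurable paths. A \<open>bipred\<close>-measurable
  version is rebuilt from H at rational times through the convolution equation. All bounds are
  proved in \<open>ennreal\<close>, where integrals may be exchanged freely and the nonnegative
  remainder of the recursion is simply dropped. The way back to real integrals and series needs a
  finite mean of H_T: the Bochner integral of a non-integrable function is 0 by convention.
  Finiteness follows from \<Phi> having integral below 1, after a truncation.\<close>

lemma nn_integral_nat_valued:
  fixes Y :: "'a \<Rightarrow> ennreal" and F :: "ennreal \<Rightarrow> ennreal"
  assumes Y: "Y \<in> borel_measurable M" and range: "AE \<omega> in M. Y \<omega> \<in> range of_nat"
    and X: "X \<in> sets M"
  shows "(\<integral>\<^sup>+\<omega>. F (Y \<omega>) * indicator X \<omega> \<partial>M) =
    (\<Sum>k. F (of_nat k) * emeasure M (X \<inter> {\<omega>\<in>space M. Y \<omega> = of_nat k}))"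
proof -
  have meas: "X \<inter> {\<omega>\<in>space M. Y \<omega> = of_nat k} \<in> sets M" for k
    using X Y by auto
  have "(\<integral>\<^sup>+\<omega>. F (Y \<omega>) * indicator X \<omega> \<partial>M) =
    (\<integral>\<^sup>+\<omega>. (\<Sum>k. F (of_nat k) * indicator (X \<inter> {\<omega>\<in>space M. Y \<omega> = of_nat k}) \<omega>) \<partial>M)"
  proof (rule nn_integral_cong_AE, use range in eventually_elim, clarify)
    fix \<omega> m assume Ym: "Y \<omega> = of_nat m"
    have "(\<Sum>k. F (of_nat k) * indicator (X \<inter> {\<omega>\<in>space M. Y \<omega> = of_nat k}) \<omega>) =
      (\<Sum>k\<in>{m}. F (of_nat k) * indicator (X \<inter> {\<omega>\<in>space M. Y \<omega> = of_nat k}) \<omega>)"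
      using Ym by (intro suminf_finite) (auto simp: indicator_def)
    then show "F (Y \<omega>) * indicator X \<omega> =
        (\<Sum>k. F (of_nat k) * indicator (X \<inter> {\<omega>\<in>space M. Y \<omega> = of_nat k}) \<omega>)"
      using Ym sets.sets_into_space[OF X] by (auto simp: indicator_def)
  qed
  also have "\<dots> = (\<Sum>k. (\<integral>\<^sup>+\<omega>. F (of_nat k) * indicator (X \<inter> {\<omega>\<in>space M. Y \<omega> = of_nat k}) \<omega> \<partial>M))"
    using meas by (intro nn_integral_suminf) simp
  also have "\<dots> = (\<Sum>k. F (of_nat k) * emeasure M (X \<inter> {\<omega>\<in>space M. Y \<omega> = of_nat k}))"
    using meas by (simp add: nn_integral_cmult_indicator)
  finally show ?thesis .
qed

section \<open>Poisson random measures\<close>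

locale poisson_noise = prob_space M for M :: "'w measure" +
  fixes \<nu> :: "'e measure" and N :: "'w \<Rightarrow> 'e measure"
  assumes prm: "poisson_random_measure M \<nu> N"
begin

lemma sets_N: "\<omega> \<in> space M \<Longrightarrow> sets (N \<omega>) = sets \<nu>"
  using prm by (auto simp: poisson_random_measure_def)

lemma space_N: "\<omega> \<in> space M \<Longrightarrow> space (N \<omega>) = space \<nu>"
  using sets_N sets_eq_imp_space_eq by blast

lemma N_integer: "\<omega> \<in> space M \<Longrightarrow> A \<in> sets \<nu> \<Longrightarrow> emeasure (N \<omega>) A \<in> range of_nat \<union> {\<infinity>}"
  using prm by (auto simp: poisson_random_measure_def)

lemma measurable_N[measurable (raw)]: "A \<in> sets \<nu> \<Longrightarrow> (\<lambda>\<omega>. emeasure (N \<omega>) A) \<in> borel_measurable M"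
  using prm by (auto simp: poisson_random_measure_def)

lemma prob_N:
  "A \<in> sets \<nu> \<Longrightarrow> emeasure \<nu> A < \<infinity> \<Longrightarrow>
   prob {\<omega>\<in>space M. emeasure (N \<omega>) A = of_nat k} = exp (- measure \<nu> A) * measure \<nu> A ^ k / fact k"
  using prm by (auto simp: poisson_random_measure_def)

lemma indep_N:
  "range A \<subseteq> sets \<nu> \<Longrightarrow> disjoint_family A \<Longrightarrow>
   indep_vars (\<lambda>_. borel) (\<lambda>i \<omega>. emeasure (N \<omega>) (A i)) (UNIV :: nat set)"
  using prm by (auto simp: poisson_random_measure_def)

lemma poisson_sums: "(\<lambda>k. exp (- x) * x ^ k / fact k :: real) sums 1"
proof -
  have "(\<lambda>k. exp (- x) * (x ^ k / fact k)) sums (exp (- x) * exp x)"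
    using exp_converges[of x] by (intro sums_mult) (simp add: divide_inverse mult.commute scaleR_conv_of_real)
  then show ?thesis by (simp add: exp_minus)
qed

lemma poisson_mean_sums: "(\<lambda>k. real k * (exp (- x) * x ^ k / fact k)) sums x"
proof -
  have "(\<lambda>k. x * (exp (- x) * x ^ k / fact k)) sums (x * 1)"
    by (intro sums_mult poisson_sums)
  moreover have eq: "x * (exp (- x) * x ^ k / fact k) = real (Suc k) * (exp (- x) * x ^ Suc k / fact (Suc k))" for k
    by (simp add: field_simps del: of_nat_Suc)
  ultimately have "(\<lambda>k. real (Suc k) * (exp (- x) * x ^ Suc k / fact (Suc k))) sums x"
    unfolding eq by simp
  then have "(\<lambda>k. real k * (exp (- x) * x ^ k / fact k)) sums (x + real 0 * (exp (- x) * x ^ 0 / fact 0))"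
    by (subst (asm) sums_Suc_iff)
  then show ?thesis by simp
qed

text \<open>The Poisson weights already sum to 1, so no probability is left for the value
  infinity.\<close>

lemma AE_N_nat:
  assumes A: "A \<in> sets \<nu>" "emeasure \<nu> A < \<infinity>"
  shows "AE \<omega> in M. emeasure (N \<omega>) A \<in> range of_nat"
proof -
  let ?E = "\<lambda>k. {\<omega>\<in>space M. emeasure (N \<omega>) A = of_nat k}"
  have "(\<lambda>k. prob (?E k)) sums prob (\<Union>k. ?E k)"
    using A by (intro finite_measure_UNION) (auto simp: disjoint_family_on_def)
  moreover have "(\<lambda>k. prob (?E k)) sums 1"
    using poisson_sums[of "measure \<nu> A"] by (simp add: prob_N[OF A])
  ultimately have "prob (\<Union>k. ?E k) = 1" by (rule sums_unique2)
  moreover have "(\<Union>k. ?E k) \<in> events" using A by auto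
  ultimately have "AE \<omega> in M. \<omega> \<in> (\<Union>k. ?E k)" by (subst (asm) prob_eq_1) auto
  then show ?thesis by eventually_elim auto
qed

lemma AE_N_finite:
  assumes A: "A \<in> sets \<nu>" "emeasure \<nu> A < \<infinity>"
  shows "AE \<omega> in M. emeasure (N \<omega>) A < \<infinity>"
  using AE_N_nat[OF A] by eventually_elim (auto simp: of_nat_less_top)

text \<open>\<open>D\<close> is an arbitrary region and not only a past, so that what is known
  before and after a time strip can be expressed together.\<close>

definition noise_in :: "'e set \<Rightarrow> 'w set set" where
  "noise_in D = sigma_sets (space M)
     {(\<lambda>\<omega>. emeasure (N \<omega>) A) -` B \<inter> space M | A B. A \<in> sets \<nu> \<and> A \<subseteq> D \<and> B \<in> sets borel}"

lemma noise_in_gen: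
  "A \<in> sets \<nu> \<Longrightarrow> A \<subseteq> D \<Longrightarrow> B \<in> sets borel \<Longrightarrow> (\<lambda>\<omega>. emeasure (N \<omega>) A) -` B \<inter> space M \<in> noise_in D"
  unfolding noise_in_def by (rule sigma_sets.Basic) blast

lemma noise_in_mono: "D \<subseteq> D' \<Longrightarrow> noise_in D \<subseteq> noise_in D'"
  unfolding noise_in_def by (rule sigma_sets_mono') blast

lemma noise_in_events: "noise_in D \<subseteq> events"
  unfolding noise_in_def
  by (intro sets.sigma_sets_subset) (auto intro!: measurable_sets)

lemma sigma_algebra_noise_in: "sigma_algebra (space M) (noise_in D)"
  unfolding noise_in_def by (rule sigma_algebra_sigma_sets) auto

text \<open>A Poisson random measure is only assumed independent on sequences of disjoint sets,
  whereas the sets in \<open>ps\<close> may overlap. They are cut into the atoms of the finite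
  algebra they generate: each count is a sum of atom counts, and \<open>C\<close> is one more
  disjoint set.\<close>

lemma indep_counts:
  assumes C: "C \<in> sets \<nu>" and B: "B \<in> sets borel"
    and ps: "\<And>A B. (A, B) \<in> set ps \<Longrightarrow> A \<in> sets \<nu> \<and> A \<inter> C = {} \<and> B \<in> sets borel"
  shows "prob ({\<omega>\<in>space M. \<forall>(A, B)\<in>set ps. emeasure (N \<omega>) A \<in> B} \<inter>
      ((\<lambda>\<omega>. emeasure (N \<omega>) C) -` B \<inter> space M)) =
    prob {\<omega>\<in>space M. \<forall>(A, B)\<in>set ps. emeasure (N \<omega>) A \<in> B} *
    prob ((\<lambda>\<omega>. emeasure (N \<omega>) C) -` B \<inter> space M)"
proof -
  \<comment> \<open>The membership pattern of a point is encoded as a natural number, so that the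
    atoms form a sequence as the definition requires. Numbers that encode no pattern give empty
    atoms.\<close>
  define code where "code z = to_nat (map (\<lambda>(A, B :: ennreal set). z \<in> A) ps)" for z :: 'e
  \<comment> \<open>Index 0 is reserved for \<open>C\<close>; the atoms outside \<open>C\<close> are
    shifted by one.\<close>
  define Q where "Q k = (case k of 0 \<Rightarrow> C | Suc j \<Rightarrow> {z\<in>space \<nu>. z \<notin> C \<and> code z = j})" for k
  have Csp: "C \<subseteq> space \<nu>" using C by (rule sets.sets_into_space)
  have fin: "{z\<in>space \<nu>. code z = j} \<in> sets \<nu>" for j
  proof (cases "\<exists>bs::bool list. to_nat bs = j")
    case False
    then have "{z\<in>space \<nu>. code z = j} = {}" by (auto simp: code_def)
    then show ?thesis by (metis sets.empty_sets)
  next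
    case True
    then obtain bs :: "bool list" where j: "j = to_nat bs" by blast
    have "{z\<in>space \<nu>. code z = j} = {z\<in>space \<nu>. map (\<lambda>(A, B :: ennreal set). z \<in> A) ps = bs}"
      by (auto simp: code_def j)
    also have "\<dots> = {z\<in>space \<nu>. length ps = length bs \<and> (\<forall>i\<in>{..<length ps}. (z \<in> fst (ps ! i)) = bs ! i)}"
      by (auto simp: list_eq_iff_nth_eq split_beta)
    also have "\<dots> \<in> sets \<nu>"
    proof -
      have "Measurable.pred \<nu> (\<lambda>z. \<forall>i\<in>{..<length ps}. (z \<in> fst (ps ! i)) = bs ! i)"
      proof (rule pred_intros_finite)
        fix i assume "i \<in> {..<length ps}"
        then have "fst (ps ! i) \<in> sets \<nu>"
          using ps[of "fst (ps ! i)" "snd (ps ! i)"] by simp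
        then show "Measurable.pred \<nu> (\<lambda>z. (z \<in> fst (ps ! i)) = bs ! i)" by measurable
      qed simp
      then have "Measurable.pred \<nu> (\<lambda>z. length ps = length bs \<and> (\<forall>i\<in>{..<length ps}. (z \<in> fst (ps ! i)) = bs ! i))"
        by (intro pred_intros_logic) auto
      then show ?thesis unfolding pred_def .
    qed
    finally show ?thesis .
  qed
  have Qsets: "Q k \<in> sets \<nu>" for k
  proof (cases k)
    case (Suc j)
    have "Q k = {z\<in>space \<nu>. code z = j} - C" by (auto simp: Q_def Suc)
    then show ?thesis using fin C by auto
  qed (simp add: Q_def C)
  have disj: "disjoint_family Q"
    unfolding disjoint_family_on_def Q_def by (auto split: nat.splits)
  have split: "emeasure (N \<omega>) A = (\<Sum>k. emeasure (N \<omega>) (Q (Suc k)) * of_bool ((from_nat k :: bool list) ! i))"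
    if i: "i < length ps" "ps ! i = (A, B')" and \<omega>: "\<omega> \<in> space M" for A B' i \<omega>
  proof -
    have A: "A \<in> sets \<nu>" "A \<inter> C = {}"
      using ps[of A B'] i nth_mem by force+
    have bit: "(from_nat (code z) :: bool list) ! i = (z \<in> A)" for z
      using i by (simp add: code_def)
    have "A = (\<Union>k. if (from_nat k :: bool list) ! i then Q (Suc k) else {})"
      using A sets.sets_into_space[OF A(1)] by (auto simp: Q_def bit split: if_splits)
    also have "emeasure (N \<omega>) \<dots> = (\<Sum>k. emeasure (N \<omega>) (if (from_nat k :: bool list) ! i then Q (Suc k) else {}))"
    proof (intro suminf_emeasure[symmetric])
      show "range (\<lambda>k. if (from_nat k :: bool list) ! i then Q (Suc k) else {}) \<subseteq> sets (N \<omega>)"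
        using Qsets by (auto simp: sets_N \<omega>)
    qed (auto simp: disjoint_family_on_def Q_def)
    also have "\<dots> = (\<Sum>k. emeasure (N \<omega>) (Q (Suc k)) * of_bool ((from_nat k :: bool list) ! i))"
      by (intro suminf_cong) auto
    finally show ?thesis .
  qed
  have ind: "indep_vars (\<lambda>_. borel) (\<lambda>i \<omega>. emeasure (N \<omega>) (Q i)) UNIV"
    using Qsets disj by (intro indep_N) auto
  \<comment> \<open>The event about \<open>ps\<close>, written as a condition on the atom counts of
    index at least 1 only; it is therefore independent of coordinate 0.\<close>
  define G where "G w \<longleftrightarrow> (\<forall>i\<in>{..<length ps}. (\<Sum>k. w (Suc k) * of_bool ((from_nat k :: bool list) ! i)) \<in> snd (ps ! i))"
    for w :: "nat \<Rightarrow> ennreal"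
  have Gm: "{w\<in>space (Pi\<^sub>M {1..} (\<lambda>_. borel)). G w} \<in> sets (Pi\<^sub>M {1..} (\<lambda>_. borel))"
  proof -
    have "Measurable.pred (Pi\<^sub>M {1..} (\<lambda>_. borel)) (\<lambda>w. \<forall>i\<in>{..<length ps}. (\<Sum>k. w (Suc k) * of_bool ((from_nat k :: bool list) ! i)) \<in> snd (ps ! i))"
    proof (rule pred_intros_finite)
      fix i assume "i \<in> {..<length ps}"
      then have [measurable]: "snd (ps ! i) \<in> sets borel"
        using ps[of "fst (ps ! i)" "snd (ps ! i)"] by simp
      show "Measurable.pred (Pi\<^sub>M {1..} (\<lambda>_. borel)) (\<lambda>w. (\<Sum>k. w (Suc k) * of_bool ((from_nat k :: bool list) ! i)) \<in> snd (ps ! i))"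
        by measurable
    qed simp
    then show ?thesis unfolding pred_def G_def .
  qed
  have iv: "indep_var (Pi\<^sub>M {1..} (\<lambda>_. borel)) (\<lambda>\<omega>. \<lambda>i\<in>{1..}. emeasure (N \<omega>) (Q i))
      (Pi\<^sub>M {0} (\<lambda>_. borel)) (\<lambda>\<omega>. \<lambda>i\<in>{0}. emeasure (N \<omega>) (Q i))"
    by (rule indep_var_restrict[OF ind]) auto
  have "prob ((\<lambda>\<omega>. \<lambda>i\<in>{1..}. emeasure (N \<omega>) (Q i)) -` {w\<in>space (Pi\<^sub>M {1..} (\<lambda>_. borel)). G w} \<inter> space M \<inter>
      ((\<lambda>\<omega>. \<lambda>i\<in>{0}. emeasure (N \<omega>) (Q i)) -` {w\<in>space (Pi\<^sub>M {0} (\<lambda>_. borel)). w 0 \<in> B} \<inter> space M)) =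
    prob ((\<lambda>\<omega>. \<lambda>i\<in>{1..}. emeasure (N \<omega>) (Q i)) -` {w\<in>space (Pi\<^sub>M {1..} (\<lambda>_. borel)). G w} \<inter> space M) *
    prob ((\<lambda>\<omega>. \<lambda>i\<in>{0}. emeasure (N \<omega>) (Q i)) -` {w\<in>space (Pi\<^sub>M {0} (\<lambda>_. borel)). w 0 \<in> B} \<inter> space M)"
  proof (rule indep_setD)
    show "indep_set (sigma_sets (space M) {(\<lambda>\<omega>. \<lambda>i\<in>{1..}. emeasure (N \<omega>) (Q i)) -` A \<inter> space M |A. A \<in> sets (Pi\<^sub>M {1..} (\<lambda>_. borel))})
      (sigma_sets (space M) {(\<lambda>\<omega>. \<lambda>i\<in>{0}. emeasure (N \<omega>) (Q i)) -` A \<inter> space M |A. A \<in> sets (Pi\<^sub>M {0} (\<lambda>_. borel))})"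
      using iv unfolding indep_var_eq by simp
    have "{w\<in>space (Pi\<^sub>M {0::nat} (\<lambda>_. borel)). w 0 \<in> B} \<in> sets (Pi\<^sub>M {0} (\<lambda>_. borel))"
      using B by measurable
    then show "(\<lambda>\<omega>. \<lambda>i\<in>{0}. emeasure (N \<omega>) (Q i)) -` {w\<in>space (Pi\<^sub>M {0} (\<lambda>_. borel)). w 0 \<in> B} \<inter> space M \<in>
      sigma_sets (space M) {(\<lambda>\<omega>. \<lambda>i\<in>{0}. emeasure (N \<omega>) (Q i)) -` A \<inter> space M |A. A \<in> sets (Pi\<^sub>M {0} (\<lambda>_. borel))}"
      by (intro sigma_sets.Basic) blast
    show "(\<lambda>\<omega>. \<lambda>i\<in>{1..}. emeasure (N \<omega>) (Q i)) -` {w\<in>space (Pi\<^sub>M {1..} (\<lambda>_. borel)). G w} \<inter> space M \<in>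
      sigma_sets (space M) {(\<lambda>\<omega>. \<lambda>i\<in>{1..}. emeasure (N \<omega>) (Q i)) -` A \<inter> space M |A. A \<in> sets (Pi\<^sub>M {1..} (\<lambda>_. borel))}"
      using Gm by (intro sigma_sets.Basic) blast
  qed
  moreover have "(\<lambda>\<omega>. \<lambda>i\<in>{1..}. emeasure (N \<omega>) (Q i)) -` {w\<in>space (Pi\<^sub>M {1..} (\<lambda>_. borel)). G w} \<inter> space M =
     {\<omega>\<in>space M. \<forall>(A, B)\<in>set ps. emeasure (N \<omega>) A \<in> B}"
  proof -
    have "G (\<lambda>i\<in>{1..}. emeasure (N \<omega>) (Q i)) \<longleftrightarrow> (\<forall>(A, B)\<in>set ps. emeasure (N \<omega>) A \<in> B)"
      if "\<omega> \<in> space M" for \<omega>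
    proof -
      have "G (\<lambda>i\<in>{1..}. emeasure (N \<omega>) (Q i)) \<longleftrightarrow> (\<forall>i<length ps. emeasure (N \<omega>) (fst (ps ! i)) \<in> snd (ps ! i))"
        unfolding G_def using split[OF _ _ that, of _ "fst (ps ! i)" "snd (ps ! i)" for i] by (auto simp: Ball_def)
      also have "\<dots> \<longleftrightarrow> (\<forall>p\<in>set ps. emeasure (N \<omega>) (fst p) \<in> snd p)"
        by (auto simp: all_set_conv_all_nth)
      finally show ?thesis by (simp add: split_beta)
    qed
    then show ?thesis by (auto simp: space_PiM)
  qed
  moreover have "(\<lambda>\<omega>. \<lambda>i\<in>{0}. emeasure (N \<omega>) (Q i)) -` {w\<in>space (Pi\<^sub>M {0} (\<lambda>_. borel)). w 0 \<in> B} \<inter> space M =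
      (\<lambda>\<omega>. emeasure (N \<omega>) C) -` B \<inter> space M"
    by (auto simp: space_PiM Q_def)
  ultimately show ?thesis by simp
qed

text \<open>Finite conjunctions of count conditions form a generator of \<open>noise_in D\<close>
  closed under intersection (concatenate the lists), so the independence of
  \<open>indep_counts\<close> passes to the generated sigma-algebra.\<close>

lemma indep_noise_in:
  assumes C: "C \<in> sets \<nu>" "C \<inter> D = {}" and B: "B \<in> sets borel" and X: "X \<in> noise_in D"
  shows "prob (X \<inter> ((\<lambda>\<omega>. emeasure (N \<omega>) C) -` B \<inter> space M)) =
    prob X * prob ((\<lambda>\<omega>. emeasure (N \<omega>) C) -` B \<inter> space M)"
proof -
  let ?P = "{{\<omega>\<in>space M. \<forall>(A, B)\<in>set ps. emeasure (N \<omega>) A \<in> B} |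
      ps. \<forall>(A, B)\<in>set ps. A \<in> sets \<nu> \<and> A \<subseteq> D \<and> B \<in> sets borel}"
  let ?C = "(\<lambda>\<omega>. emeasure (N \<omega>) C) -` B \<inter> space M"
  have Cev: "?C \<in> events" using C B by measurable
  have Pev: "?P \<subseteq> events"
  proof safe
    fix ps assume ps: "\<forall>(A, B)\<in>set ps. A \<in> sets \<nu> \<and> A \<subseteq> D \<and> B \<in> sets (borel :: ennreal measure)"
    have "Measurable.pred M (\<lambda>\<omega>. \<forall>p\<in>set ps. emeasure (N \<omega>) (fst p) \<in> snd p)"
    proof (rule pred_intros_finite)
      fix p assume "p \<in> set ps"
      then have "fst p \<in> sets \<nu>" "snd p \<in> sets borel" using ps by auto
      then show "Measurable.pred M (\<lambda>\<omega>. emeasure (N \<omega>) (fst p) \<in> snd p)" by measurable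
    qed simp
    then show "{\<omega>\<in>space M. \<forall>(A, B)\<in>set ps. emeasure (N \<omega>) A \<in> B} \<in> events"
      by (simp add: pred_def split_beta)
  qed
  have "indep_set ?P {?C}"
  proof (rule indep_setI)
    fix a b assume "a \<in> ?P" and b: "b \<in> {?C}"
    then obtain ps where a: "a = {\<omega>\<in>space M. \<forall>(A, B)\<in>set ps. emeasure (N \<omega>) A \<in> B}"
      and ps: "\<forall>(A, B)\<in>set ps. A \<in> sets \<nu> \<and> A \<subseteq> D \<and> B \<in> sets borel" by blast
    show "prob (a \<inter> b) = prob a * prob b"
      unfolding a using b C ps by (simp, intro indep_counts) (fastforce simp: B)+
  qed (use Pev Cev in auto)
  then have "indep_set (sigma_sets (space M) ?P) (sigma_sets (space M) {?C})"
  proof (rule indep_set_sigma_sets)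
    show "Int_stable ?P"
    proof (rule Int_stableI, safe)
      fix ps qs :: "('e set \<times> ennreal set) list"
      assume "\<forall>(A, B)\<in>set ps. A \<in> sets \<nu> \<and> A \<subseteq> D \<and> B \<in> sets borel"
         "\<forall>(A, B)\<in>set qs. A \<in> sets \<nu> \<and> A \<subseteq> D \<and> B \<in> sets borel"
      then show "\<exists>rs. {\<omega> \<in> space M. \<forall>(A, B)\<in>set ps. emeasure (N \<omega>) A \<in> B} \<inter>
            {\<omega> \<in> space M. \<forall>(A, B)\<in>set qs. emeasure (N \<omega>) A \<in> B} =
            {\<omega> \<in> space M. \<forall>(A, B)\<in>set rs. emeasure (N \<omega>) A \<in> B} \<and>
            (\<forall>(A, B)\<in>set rs. A \<in> sets \<nu> \<and> A \<subseteq> D \<and> B \<in> sets borel)"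
        by (intro exI[of _ "ps @ qs"]) auto
    qed
  qed (simp add: Int_stable_def)
  moreover have "X \<in> sigma_sets (space M) ?P"
  proof -
    have "noise_in D \<subseteq> sigma_sets (space M) ?P"
      unfolding noise_in_def
    proof (rule sigma_sets_mono', safe)
      fix A B assume "A \<in> sets \<nu>" "A \<subseteq> D" "B \<in> sets (borel :: ennreal measure)"
      then show "\<exists>ps. (\<lambda>\<omega>. emeasure (N \<omega>) A) -` B \<inter> space M =
         {\<omega> \<in> space M. \<forall>(A, B)\<in>set ps. emeasure (N \<omega>) A \<in> B} \<and>
         (\<forall>(A, B)\<in>set ps. A \<in> sets \<nu> \<and> A \<subseteq> D \<and> B \<in> sets borel)"
        by (intro exI[of _ "[(A, B)]"]) auto
    qed
    then show ?thesis using X by auto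
  qed
  ultimately show ?thesis by (intro indep_setD) auto
qed

lemma of_nat_mult_ennreal: "of_nat k * (x * ennreal p) = x * ennreal (real k * p)"
  by (simp add: ennreal_mult' mult.left_commute ennreal_of_nat_eq_real_of_nat)

text \<open>Independence factorises each event that the count equals \<open>k\<close>, and what
  remains is the Poisson mean. This is the compensation formula for a single rectangle
  \<open>X \<times> C\<close>.\<close>

lemma nn_integral_noise_in:
  assumes C: "C \<in> sets \<nu>" "C \<inter> D = {}" "emeasure \<nu> C < \<infinity>" and X: "X \<in> noise_in D"
  shows "(\<integral>\<^sup>+\<omega>. emeasure (N \<omega>) C * indicator X \<omega> \<partial>M) = emeasure M X * emeasure \<nu> C"
proof -
  have Xe: "X \<in> events" using X noise_in_events by auto
  have pk: "emeasure M (X \<inter> {\<omega>\<in>space M. emeasure (N \<omega>) C = of_nat k}) =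
      emeasure M X * ennreal (exp (- measure \<nu> C) * measure \<nu> C ^ k / fact k)" for k
  proof -
    have "(\<lambda>\<omega>. emeasure (N \<omega>) C) -` {of_nat k} \<inter> space M = {\<omega>\<in>space M. emeasure (N \<omega>) C = of_nat k}"
      by auto
    with indep_noise_in[OF C(1,2) _ X, of "{of_nat k}"] prob_N[OF C(1,3), of k]
    show ?thesis by (simp add: emeasure_eq_measure ennreal_mult'' [symmetric])
  qed
  have "(\<integral>\<^sup>+\<omega>. emeasure (N \<omega>) C * indicator X \<omega> \<partial>M) =
    (\<Sum>k. of_nat k * emeasure M (X \<inter> {\<omega>\<in>space M. emeasure (N \<omega>) C = of_nat k}))"
    using nn_integral_nat_valued[OF measurable_N[OF C(1)] AE_N_nat[OF C(1,3)] Xe, of "\<lambda>x. x"] by simp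
  also have "\<dots> = (\<Sum>k. emeasure M X * ennreal (real k * (exp (- measure \<nu> C) * measure \<nu> C ^ k / fact k)))"
    unfolding pk by (simp only: of_nat_mult_ennreal)
  also have "\<dots> = emeasure M X * (\<Sum>k. ennreal (real k * (exp (- measure \<nu> C) * measure \<nu> C ^ k / fact k)))"
    by (rule ennreal_suminf_cmult)
  also have "(\<Sum>k. ennreal (real k * (exp (- measure \<nu> C) * measure \<nu> C ^ k / fact k))) = ennreal (measure \<nu> C)"
    by (intro suminf_ennreal_eq poisson_mean_sums) simp
  also have "\<dots> = emeasure \<nu> C"
    using C by (simp add: emeasure_eq_ennreal_measure)
  finally show ?thesis .
qed

end

section \<open>Compensation of two-sided predictable integrands\<close>

locale strip_noise = poisson_noise M "strip_intensity T" N
  for M :: "'w measure" and T :: real and N :: "'w \<Rightarrow> (real \<times> real) measure"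
begin

section \<open>The strip and its exhaustion by bounded boxes\<close>

abbreviation \<nu> :: "(real \<times> real) measure" where "\<nu> \<equiv> strip_intensity T"

lemma space_strip: "space \<nu> = {0..T} \<times> {0..}"
  by (simp add: strip_intensity_def space_restrict_space)

lemma strip_borel: "{0..T} \<times> {0..} \<in> sets (borel :: (real \<times> real) measure)"
  by (intro borel_closed closed_Times) auto

lemma sets_strip: "sets \<nu> = {A. A \<in> sets borel \<and> A \<subseteq> {0..T} \<times> {0..}}"
  unfolding strip_intensity_def using strip_borel
  by (simp add: set_eq_iff sets_restrict_space_iff) blast

lemma sets_stripI: "A \<in> sets borel \<Longrightarrow> A \<subseteq> {0..T} \<times> {0..} \<Longrightarrow> A \<in> sets \<nu>"
  by (simp add: sets_strip)

lemma emeasure_strip: "A \<in> sets \<nu> \<Longrightarrow> emeasure \<nu> A = emeasure lborel A"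
  using strip_borel unfolding strip_intensity_def
  by (subst emeasure_restrict_space) (auto simp: sets_restrict_space_iff)

lemma sigma_finite_strip: "sigma_finite_measure \<nu>"
  unfolding strip_intensity_def
  by (rule sigma_finite_measure_restrict_space) (use strip_borel in \<open>auto simp: lborel.sigma_finite_measure_axioms\<close>)

lemma fst_strip[measurable]: "fst \<in> borel_measurable \<nu>" and snd_strip[measurable]: "snd \<in> borel_measurable \<nu>"
  unfolding strip_intensity_def by (auto intro!: measurable_restrict_space1 borel_measurable_continuous_onI continuous_intros)

text \<open>The heights are unbounded, so the strip has infinite intensity. These boxes exhaust it
  with finite intensity, which the subtraction for complements in \<open>compensation_set\<close>
  needs.\<close>

definition slab :: "nat \<Rightarrow> (real \<times> real) set" where "slab k = {0..T} \<times> {0..real k}"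

lemma slab_sets[measurable]: "slab k \<in> sets \<nu>"
  by (auto simp: slab_def intro!: sets_stripI borel_closed closed_Times)

lemma slab_finite: "A \<in> sets \<nu> \<Longrightarrow> emeasure \<nu> (A \<inter> slab k) < \<infinity>"
proof -
  assume A: "A \<in> sets \<nu>"
  have "bounded (A \<inter> slab k)"
    unfolding slab_def by (intro bounded_Int disjI2 bounded_Times) auto
  then show ?thesis using A
    by (subst emeasure_strip) (simp, rule emeasure_bounded_finite)
qed

lemma incseq_slab: "incseq slab"
  by (auto simp: incseq_def slab_def)

lemma UN_slab: "A \<in> sets \<nu> \<Longrightarrow> (\<Union>k. A \<inter> slab k) = A"
proof -
  assume "A \<in> sets \<nu>"
  then have "A \<subseteq> {0..T} \<times> {0..}" by (simp add: sets_strip)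
  moreover have "\<exists>k. x \<le> real k" for x by (rule real_arch_simple)
  ultimately show ?thesis unfolding slab_def by fastforce
qed

definition regular :: "'w \<Rightarrow> bool" where
  "regular \<omega> \<longleftrightarrow> (\<forall>k. emeasure (N \<omega>) (slab k) < \<infinity>)"

lemma measurable_regular[measurable]: "Measurable.pred M regular"
  unfolding regular_def by measurable

lemma AE_regular: "AE \<omega> in M. regular \<omega>"
  unfolding regular_def AE_all_countable
proof
  show "AE \<omega> in M. emeasure (N \<omega>) (slab k) < \<infinity>" for k
    using AE_N_finite[OF slab_sets] slab_finite[OF slab_sets, of k k] by simp
qed

text \<open>Infinitely many points in a bounded box occur with probability 0 only; removing the noise on this
  event makes all the integrals below measurable.\<close>

definition noise :: "'w \<Rightarrow> (real \<times> real) measure" where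
  "noise \<omega> = (if regular \<omega> then N \<omega> else null_measure \<nu>)"

lemma AE_noise: "AE \<omega> in M. noise \<omega> = N \<omega>"
  using AE_regular by eventually_elim (simp add: noise_def)

lemma sets_noise: "\<omega> \<in> space M \<Longrightarrow> sets (noise \<omega>) = sets \<nu>"
  by (simp add: noise_def sets_N)

lemma space_noise: "\<omega> \<in> space M \<Longrightarrow> space (noise \<omega>) = space \<nu>"
  using sets_noise sets_eq_imp_space_eq by blast

lemma noise_integer: "\<omega> \<in> space M \<Longrightarrow> A \<in> sets \<nu> \<Longrightarrow> emeasure (noise \<omega>) A \<in> range of_nat \<union> {\<infinity>}"
  using N_integer[of \<omega> A] by (auto simp: noise_def image_iff intro: exI[of _ 0])

lemma noise_slab: "\<omega> \<in> space M \<Longrightarrow> A \<in> sets \<nu> \<Longrightarrow> emeasure (noise \<omega>) (A \<inter> slab k) < \<infinity>"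
proof -
  assume "\<omega> \<in> space M" and A: "A \<in> sets \<nu>"
  then have "emeasure (noise \<omega>) (A \<inter> slab k) \<le> emeasure (noise \<omega>) (slab k)"
    by (intro emeasure_mono) (auto simp: sets_noise)
  also have "\<dots> < \<infinity>" by (simp add: noise_def regular_def)
  finally show ?thesis .
qed

lemma measurable_noise[measurable (raw)]:
  "A \<in> sets \<nu> \<Longrightarrow> (\<lambda>\<omega>. emeasure (noise \<omega>) A) \<in> borel_measurable M"
proof -
  assume [measurable]: "A \<in> sets \<nu>"
  have "(\<lambda>\<omega>. emeasure (noise \<omega>) A) = (\<lambda>\<omega>. if regular \<omega> then emeasure (N \<omega>) A else 0)"
    by (auto simp: noise_def)
  then show ?thesis by simp
qed

text \<open>An integrand that at time \<open>t\<close> depends on the noise before and after \<open>t\<close>, but not on the noise at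
  \<open>t\<close>: this generalises predictability so that the remaining Poisson points may enter the integrand.\<close>

definition bipred_gen :: "('w \<times> real \<times> real) set set" where
  "bipred_gen = {X \<times> C | X C s r. X \<in> noise_in (space \<nu> - {s<..r} \<times> UNIV) \<and> C \<in> sets \<nu> \<and> C \<subseteq> {s<..r} \<times> UNIV}"

definition bipred :: "('w \<times> real \<times> real) measure" where
  "bipred = sigma (space M \<times> space \<nu>) bipred_gen"

lemma bipred_genI:
  "X \<in> noise_in (space \<nu> - {s<..r} \<times> UNIV) \<Longrightarrow> C \<in> sets \<nu> \<Longrightarrow> C \<subseteq> {s<..r} \<times> UNIV \<Longrightarrow> X \<times> C \<in> bipred_gen"
  unfolding bipred_gen_def by blast

lemma bipred_gen_Pow: "bipred_gen \<subseteq> Pow (space M \<times> space \<nu>)"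
proof -
  have "X \<subseteq> space M" if "X \<in> noise_in D" for X D
    using that noise_in_events sets.sets_into_space by blast
  then show ?thesis
    unfolding bipred_gen_def using sets.sets_into_space[of _ \<nu>] by fast
qed

lemma space_bipred: "space bipred = space M \<times> space \<nu>"
  unfolding bipred_def using bipred_gen_Pow by (rule space_measure_of)

lemma sets_bipred: "sets bipred = sigma_sets (space M \<times> space \<nu>) bipred_gen"
  unfolding bipred_def using bipred_gen_Pow by (rule sets_measure_of)

text \<open>Intersecting two rectangles shrinks the excluded time strip, so the information allowed
  to the event factor only grows and contains both original events.\<close>

lemma Int_stable_bipred_gen: "Int_stable bipred_gen"
proof (rule Int_stableI)
  fix a b assume "a \<in> bipred_gen" "b \<in> bipred_gen"
  then obtain X C s r X' C' s' r' where
    a: "a = X \<times> C" "X \<in> noise_in (space \<nu> - {s<..r} \<times> UNIV)" "C \<in> sets \<nu>" "C \<subseteq> {s<..r} \<times> UNIV" and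
    b: "b = X' \<times> C'" "X' \<in> noise_in (space \<nu> - {s'<..r'} \<times> UNIV)" "C' \<in> sets \<nu>" "C' \<subseteq> {s'<..r'} \<times> UNIV"
    unfolding bipred_gen_def by blast
  let ?D = "space \<nu> - {max s s'<..min r r'} \<times> UNIV"
  interpret D: sigma_algebra "space M" "noise_in ?D" by (rule sigma_algebra_noise_in)
  have "noise_in (space \<nu> - {s<..r} \<times> UNIV) \<subseteq> noise_in ?D" "noise_in (space \<nu> - {s'<..r'} \<times> UNIV) \<subseteq> noise_in ?D"
    by (intro noise_in_mono; auto)+
  then have "X \<inter> X' \<in> noise_in ?D" using a b by auto
  moreover have "C \<inter> C' \<in> sets \<nu>" "C \<inter> C' \<subseteq> {max s s'<..min r r'} \<times> UNIV"
    using a b by auto fastforce+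
  ultimately have "(X \<inter> X') \<times> (C \<inter> C') \<in> bipred_gen" by (rule bipred_genI)
  then show "a \<inter> b \<in> bipred_gen" by (simp add: a b Times_Int_Times)
qed

lemma bipred_sub: "sets bipred \<subseteq> sets (M \<Otimes>\<^sub>M \<nu>)"
proof -
  have "bipred_gen \<subseteq> sets (M \<Otimes>\<^sub>M \<nu>)"
    unfolding bipred_gen_def using noise_in_events by auto
  then show ?thesis
    unfolding sets_bipred by (metis sets.sigma_sets_subset space_pair_measure)
qed

lemma bipred_section: "X \<in> sets bipred \<Longrightarrow> \<omega> \<in> space M \<Longrightarrow> Pair \<omega> -` X \<in> sets \<nu>"
  using bipred_sub by (auto intro: sets_Pair1)

lemma measurable_bipred_section:
  "Z \<in> measurable bipred L \<Longrightarrow> \<omega> \<in> space M \<Longrightarrow> (\<lambda>z. Z (\<omega>, z)) \<in> measurable \<nu> L"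
proof -
  assume Z: "Z \<in> measurable bipred L" and \<omega>: "\<omega> \<in> space M"
  have "Z \<in> measurable (M \<Otimes>\<^sub>M \<nu>) L"
    using Z bipred_sub by (auto simp: measurable_def space_bipred space_pair_measure)
  then show ?thesis using \<omega> by measurable
qed

lemma emeasure_section_meas:
  "A \<in> sets bipred \<Longrightarrow> (\<lambda>\<omega>. emeasure \<nu> (Pair \<omega> -` A \<inter> slab k)) \<in> borel_measurable M"
proof -
  interpret sigma_finite_measure \<nu> by (rule sigma_finite_strip)
  assume "A \<in> sets bipred"
  then have "A \<inter> (space M \<times> slab k) \<in> sets (M \<Otimes>\<^sub>M \<nu>)" using bipred_sub by auto
  then have "(\<lambda>\<omega>. emeasure \<nu> (Pair \<omega> -` (A \<inter> (space M \<times> slab k)))) \<in> borel_measurable M"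
    by (rule measurable_emeasure_Pair)
  also have "?this \<longleftrightarrow> ?thesis"
    by (intro measurable_cong arg_cong[where f="emeasure \<nu>"]) auto
  finally show ?thesis .
qed

text \<open>Dynkin argument: rectangles are covered by \<open>nn_integral_noise_in\<close>, and the
  class is closed under complements and disjoint unions. Cutting with \<open>slab k\<close> keeps
  both sides finite, so that differences make sense. Measurability in the path is carried along
  because it is only known for deterministic sets at the outset.\<close>

lemma compensation_set:
  assumes "X \<in> sets bipred"
  shows "(\<lambda>\<omega>. emeasure (noise \<omega>) (Pair \<omega> -` X \<inter> slab k)) \<in> borel_measurable M \<and>
    (\<integral>\<^sup>+\<omega>. emeasure (noise \<omega>) (Pair \<omega> -` X \<inter> slab k) \<partial>M) = (\<integral>\<^sup>+\<omega>. emeasure \<nu> (Pair \<omega> -` X \<inter> slab k) \<partial>M)"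
proof -
  have "X \<in> sigma_sets (space M \<times> space \<nu>) bipred_gen" using assms by (simp add: sets_bipred)
  note \<open>X \<in> sigma_sets (space M \<times> space \<nu>) bipred_gen\<close>
  with Int_stable_bipred_gen bipred_gen_Pow show ?thesis
  proof (induction rule: sigma_sets_induct_disjoint)
    case (basic A)
    then obtain X C s r where A: "A = X \<times> C" "X \<in> noise_in (space \<nu> - {s<..r} \<times> UNIV)" "C \<in> sets \<nu>" "C \<subseteq> {s<..r} \<times> UNIV"
      unfolding bipred_gen_def by blast
    have [measurable]: "X \<in> events" "C \<in> sets \<nu>" using A noise_in_events by auto
    have eq: "emeasure K (Pair \<omega> -` A \<inter> slab k) = emeasure K (C \<inter> slab k) * indicator X \<omega>" for \<omega> and K :: "(real \<times> real) measure"
      by (auto simp: A indicator_def)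
    have "(\<integral>\<^sup>+\<omega>. emeasure (noise \<omega>) (C \<inter> slab k) * indicator X \<omega> \<partial>M) =
        (\<integral>\<^sup>+\<omega>. emeasure (N \<omega>) (C \<inter> slab k) * indicator X \<omega> \<partial>M)"
      by (intro nn_integral_cong_AE) (use AE_noise in eventually_elim, simp)
    also have "\<dots> = emeasure M X * emeasure \<nu> (C \<inter> slab k)"
      using A slab_finite[OF A(3)] by (intro nn_integral_noise_in[OF _ _ _ A(2)]) auto
    also have "\<dots> = (\<integral>\<^sup>+\<omega>. emeasure \<nu> (C \<inter> slab k) * indicator X \<omega> \<partial>M)"
      by (simp add: nn_integral_cmult_indicator) (simp add: mult.commute)
    finally show ?case unfolding eq by simp
  next
    case empty
    then show ?case by simp
  next
    case (compl A)
    then have A: "A \<in> sets bipred" by (simp add: sets_bipred)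
    have slice: "Pair \<omega> -` ((space M \<times> space \<nu>) - A) \<inter> slab k = slab k - (Pair \<omega> -` A \<inter> slab k)" if "\<omega> \<in> space M" for \<omega>
      using that sets.sets_into_space[OF slab_sets] by auto
    have n: "emeasure (noise \<omega>) (Pair \<omega> -` ((space M \<times> space \<nu>) - A) \<inter> slab k) =
        emeasure (noise \<omega>) (slab k) - emeasure (noise \<omega>) (Pair \<omega> -` A \<inter> slab k)" if "\<omega> \<in> space M" for \<omega>
      unfolding slice[OF that] using noise_slab[OF that bipred_section[OF A that], of k] bipred_section[OF A that]
      by (intro emeasure_Diff) (auto simp: sets_noise that)
    have v: "emeasure \<nu> (Pair \<omega> -` ((space M \<times> space \<nu>) - A) \<inter> slab k) =
        emeasure \<nu> (slab k) - emeasure \<nu> (Pair \<omega> -` A \<inter> slab k)" if "\<omega> \<in> space M" for \<omega>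
      unfolding slice[OF that] using slab_finite[OF bipred_section[OF A that], of k] bipred_section[OF A that]
      by (intro emeasure_Diff) auto
    have le: "emeasure K (Pair \<omega> -` A \<inter> slab k) \<le> emeasure K (slab k)" if "sets K = sets \<nu>" for K :: "(real \<times> real) measure" and \<omega>
      by (intro emeasure_mono) (auto simp: that)
    have tot: "(\<integral>\<^sup>+\<omega>. emeasure (noise \<omega>) (slab k) \<partial>M) = emeasure \<nu> (slab k)"
    proof -
      interpret top: sigma_algebra "space M" "noise_in {}" by (rule sigma_algebra_noise_in)
      have "(\<integral>\<^sup>+\<omega>. emeasure (noise \<omega>) (slab k) \<partial>M) = (\<integral>\<^sup>+\<omega>. emeasure (N \<omega>) (slab k) * indicator (space M) \<omega> \<partial>M)"
        by (intro nn_integral_cong_AE) (use AE_noise AE_space in eventually_elim, simp)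
      \<comment> \<open>The deterministic slab is treated as a rectangle whose event is the whole
        space, which lies in the trivial \<open>noise_in {}\<close>.\<close>
      also have "\<dots> = emeasure M (space M) * emeasure \<nu> (slab k)"
        using slab_finite[OF slab_sets, of k k] top.top
        by (intro nn_integral_noise_in[where D="{}"]) auto
      finally show ?thesis by (simp add: emeasure_space_1)
    qed
    have fin: "(\<integral>\<^sup>+\<omega>. emeasure \<nu> (Pair \<omega> -` A \<inter> slab k) \<partial>M) < \<infinity>"
    proof -
      have "(\<integral>\<^sup>+\<omega>. emeasure \<nu> (Pair \<omega> -` A \<inter> slab k) \<partial>M) \<le> (\<integral>\<^sup>+\<omega>. emeasure \<nu> (slab k) \<partial>M)"
        by (intro nn_integral_mono le) simp
      also have "\<dots> < \<infinity>" using slab_finite[OF slab_sets, of k k] by (simp add: emeasure_space_1)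
      finally show ?thesis .
    qed
    have "(\<integral>\<^sup>+\<omega>. emeasure (noise \<omega>) (slab k) - emeasure (noise \<omega>) (Pair \<omega> -` A \<inter> slab k) \<partial>M) =
      (\<integral>\<^sup>+\<omega>. emeasure (noise \<omega>) (slab k) \<partial>M) - (\<integral>\<^sup>+\<omega>. emeasure (noise \<omega>) (Pair \<omega> -` A \<inter> slab k) \<partial>M)"
      using compl fin by (intro nn_integral_diff) (auto intro!: AE_I2 le sets_noise)
    also have "\<dots> = (\<integral>\<^sup>+\<omega>. emeasure \<nu> (slab k) \<partial>M) - (\<integral>\<^sup>+\<omega>. emeasure \<nu> (Pair \<omega> -` A \<inter> slab k) \<partial>M)"
      using compl tot by (simp add: emeasure_space_1)
    also have "\<dots> = (\<integral>\<^sup>+\<omega>. emeasure \<nu> (slab k) - emeasure \<nu> (Pair \<omega> -` A \<inter> slab k) \<partial>M)"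
      using fin emeasure_section_meas[OF A] by (intro nn_integral_diff[symmetric]) (auto intro!: AE_I2 le)
    finally have "(\<integral>\<^sup>+\<omega>. emeasure (noise \<omega>) (Pair \<omega> -` ((space M \<times> space \<nu>) - A) \<inter> slab k) \<partial>M) =
      (\<integral>\<^sup>+\<omega>. emeasure \<nu> (Pair \<omega> -` ((space M \<times> space \<nu>) - A) \<inter> slab k) \<partial>M)"
      by (simp add: n v cong: nn_integral_cong)
    moreover have "(\<lambda>\<omega>. emeasure (noise \<omega>) (Pair \<omega> -` ((space M \<times> space \<nu>) - A) \<inter> slab k)) \<in> borel_measurable M"
      using compl by (subst measurable_cong[OF n]) auto
    ultimately show ?case by simp
  next
    case (union A)
    then have A: "A i \<in> sets bipred" for i by (auto simp: sets_bipred)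
    have slice: "emeasure K (Pair \<omega> -` (\<Union>i. A i) \<inter> slab k) = (\<Sum>i. emeasure K (Pair \<omega> -` A i \<inter> slab k))"
      if "\<omega> \<in> space M" "sets K = sets \<nu>" for K :: "(real \<times> real) measure" and \<omega>
    proof -
      have "Pair \<omega> -` (\<Union>i. A i) \<inter> slab k = (\<Union>i. Pair \<omega> -` A i \<inter> slab k)" by auto
      also have "emeasure K \<dots> = (\<Sum>i. emeasure K (Pair \<omega> -` A i \<inter> slab k))"
      proof (intro suminf_emeasure[symmetric])
        show "range (\<lambda>i. Pair \<omega> -` A i \<inter> slab k) \<subseteq> sets K"
          using bipred_section[OF A that(1)] that by auto
        show "disjoint_family (\<lambda>i. Pair \<omega> -` A i \<inter> slab k)"
          using union(1) by (rule disjoint_family_on_bisimulation) auto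
      qed
      finally show ?thesis .
    qed
    have um: "(\<lambda>\<omega>. emeasure (noise \<omega>) (Pair \<omega> -` A i \<inter> slab k)) \<in> borel_measurable M" for i
      using union(3) by blast
    have n: "emeasure (noise \<omega>) (Pair \<omega> -` (\<Union>i. A i) \<inter> slab k) = (\<Sum>i. emeasure (noise \<omega>) (Pair \<omega> -` A i \<inter> slab k))"
      if "\<omega> \<in> space M" for \<omega> by (rule slice[OF that sets_noise[OF that]])
    have m: "(\<lambda>\<omega>. emeasure (noise \<omega>) (Pair \<omega> -` (\<Union>i. A i) \<inter> slab k)) \<in> borel_measurable M"
      using um by (subst measurable_cong[OF n]) auto
    have "(\<integral>\<^sup>+\<omega>. emeasure (noise \<omega>) (Pair \<omega> -` (\<Union>i. A i) \<inter> slab k) \<partial>M) =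
       (\<Sum>i. \<integral>\<^sup>+\<omega>. emeasure (noise \<omega>) (Pair \<omega> -` A i \<inter> slab k) \<partial>M)"
      using um by (simp add: n nn_integral_suminf cong: nn_integral_cong)
    also have "\<dots> = (\<Sum>i. \<integral>\<^sup>+\<omega>. emeasure \<nu> (Pair \<omega> -` A i \<inter> slab k) \<partial>M)"
      using union by simp
    also have "\<dots> = (\<integral>\<^sup>+\<omega>. emeasure \<nu> (Pair \<omega> -` (\<Union>i. A i) \<inter> slab k) \<partial>M)"
      using emeasure_section_meas[OF A] by (simp add: slice nn_integral_suminf cong: nn_integral_cong)
    finally show ?case using m by simp
  qed
qed

text \<open>Monotone class extension of \<open>compensation_set\<close> to nonnegative integrands.
  The boxes disappear by monotone convergence in the case of an indicator.\<close>

lemma compensation: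
  assumes "Z \<in> borel_measurable bipred"
  shows "(\<lambda>\<omega>. \<integral>\<^sup>+z. Z (\<omega>, z) \<partial>noise \<omega>) \<in> borel_measurable M \<and>
    (\<integral>\<^sup>+\<omega>. \<integral>\<^sup>+z. Z (\<omega>, z) \<partial>noise \<omega> \<partial>M) = (\<integral>\<^sup>+\<omega>. \<integral>\<^sup>+z. Z (\<omega>, z) \<partial>\<nu> \<partial>M)"
proof -
  interpret sigma_finite_measure \<nu> by (rule sigma_finite_strip)
  have \<nu>meas: "(\<lambda>\<omega>. \<integral>\<^sup>+z. W (\<omega>, z) \<partial>\<nu>) \<in> borel_measurable M" if "W \<in> borel_measurable bipred" for W :: "_ \<Rightarrow> ennreal"
  proof -
    have "W \<in> borel_measurable (M \<Otimes>\<^sub>M \<nu>)"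
      using that bipred_sub by (auto simp: measurable_def space_bipred space_pair_measure)
    then show ?thesis by measurable
  qed
  have sec: "(\<lambda>z. W (\<omega>, z)) \<in> borel_measurable (noise \<omega>)" if "W \<in> borel_measurable bipred" "\<omega> \<in> space M"
    for W :: "_ \<Rightarrow> ennreal" and \<omega>
    using measurable_bipred_section[OF that] by (simp add: measurable_cong_sets[OF sets_noise[OF that(2)] refl])
  show ?thesis
    using assms
  proof (induction rule: borel_measurable_induct)
    case (cong f g)
    have eq: "(\<integral>\<^sup>+z. f (\<omega>, z) \<partial>noise \<omega>) = (\<integral>\<^sup>+z. g (\<omega>, z) \<partial>noise \<omega>)"
      "(\<integral>\<^sup>+z. f (\<omega>, z) \<partial>\<nu>) = (\<integral>\<^sup>+z. g (\<omega>, z) \<partial>\<nu>)" if "\<omega> \<in> space M" for \<omega>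
      using cong(3) that by (auto intro!: nn_integral_cong simp: space_noise space_bipred)
    show ?case using cong(4) by (simp add: eq cong: measurable_cong nn_integral_cong)
  next
    case (set A)
    have ind: "(\<integral>\<^sup>+z. indicator A (\<omega>, z) \<partial>K) = (SUP k. emeasure K (Pair \<omega> -` A \<inter> slab k))"
      if "\<omega> \<in> space M" "sets K = sets \<nu>" for \<omega> and K :: "(real \<times> real) measure"
    proof -
      have A: "Pair \<omega> -` A \<in> sets \<nu>" using bipred_section[OF set that(1)] .
      have "(\<integral>\<^sup>+z. indicator A (\<omega>, z) \<partial>K) = (\<integral>\<^sup>+z. indicator (Pair \<omega> -` A) z \<partial>K)"
        by (intro nn_integral_cong) (simp add: indicator_def)
      also have "\<dots> = emeasure K (\<Union>k. Pair \<omega> -` A \<inter> slab k)" using A that UN_slab[OF A] by simp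
      also have "\<dots> = (SUP k. emeasure K (Pair \<omega> -` A \<inter> slab k))"
        using A that incseq_slab by (intro SUP_emeasure_incseq[symmetric]) (auto simp: incseq_def)
      finally show ?thesis .
    qed
    \<comment> \<open>Monotonicity in \<open>k\<close> is required at every argument, but the
      measures are only controlled on \<open>space M\<close>; the indicator makes the sequence
      trivially increasing elsewhere.\<close>
    have inc: "incseq (\<lambda>k \<omega>. emeasure (K \<omega>) (Pair \<omega> -` A \<inter> slab k) * indicator (space M) \<omega>)"
      if K: "\<And>\<omega>. \<omega> \<in> space M \<Longrightarrow> sets (K \<omega>) = sets \<nu>" for K :: "'w \<Rightarrow> (real \<times> real) measure"
      using bipred_section[OF set] incseq_slab K
      by (auto simp: incseq_def le_fun_def indicator_def intro!: emeasure_mono)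
    have m: "(\<lambda>\<omega>. emeasure (noise \<omega>) (Pair \<omega> -` A \<inter> slab k)) \<in> borel_measurable M" for k
      using compensation_set[OF set] by simp
    note m' = emeasure_section_meas[OF set]
    have "(\<integral>\<^sup>+\<omega>. (SUP k. emeasure (noise \<omega>) (Pair \<omega> -` A \<inter> slab k)) \<partial>M) =
       (\<integral>\<^sup>+\<omega>. (SUP k. emeasure (noise \<omega>) (Pair \<omega> -` A \<inter> slab k) * indicator (space M) \<omega>) \<partial>M)"
      by (intro nn_integral_cong) simp
    also have "\<dots> = (SUP k. \<integral>\<^sup>+\<omega>. emeasure (noise \<omega>) (Pair \<omega> -` A \<inter> slab k) * indicator (space M) \<omega> \<partial>M)"
      using m inc[OF sets_noise] by (intro nn_integral_monotone_convergence_SUP) auto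
    also have "\<dots> = (SUP k. \<integral>\<^sup>+\<omega>. emeasure (noise \<omega>) (Pair \<omega> -` A \<inter> slab k) \<partial>M)"
      by (intro SUP_cong nn_integral_cong) auto
    also have "\<dots> = (SUP k. \<integral>\<^sup>+\<omega>. emeasure \<nu> (Pair \<omega> -` A \<inter> slab k) \<partial>M)"
      using compensation_set[OF set] by simp
    also have "\<dots> = (SUP k. \<integral>\<^sup>+\<omega>. emeasure \<nu> (Pair \<omega> -` A \<inter> slab k) * indicator (space M) \<omega> \<partial>M)"
      by (intro SUP_cong nn_integral_cong) auto
    also have "\<dots> = (\<integral>\<^sup>+\<omega>. (SUP k. emeasure \<nu> (Pair \<omega> -` A \<inter> slab k) * indicator (space M) \<omega>) \<partial>M)"
      using m' inc[of "\<lambda>_. \<nu>"] by (intro nn_integral_monotone_convergence_SUP[symmetric]) auto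
    also have "\<dots> = (\<integral>\<^sup>+\<omega>. (SUP k. emeasure \<nu> (Pair \<omega> -` A \<inter> slab k)) \<partial>M)"
      by (intro nn_integral_cong) simp
    finally have e: "(\<integral>\<^sup>+\<omega>. (SUP k. emeasure (noise \<omega>) (Pair \<omega> -` A \<inter> slab k)) \<partial>M) =
      (\<integral>\<^sup>+\<omega>. (SUP k. emeasure \<nu> (Pair \<omega> -` A \<inter> slab k)) \<partial>M)" .
    have "(\<lambda>\<omega>. \<integral>\<^sup>+z. indicator A (\<omega>, z) \<partial>noise \<omega>) \<in> borel_measurable M"
      using m by (subst measurable_cong[OF ind[OF _ sets_noise]]) auto
    moreover have "(\<integral>\<^sup>+\<omega>. \<integral>\<^sup>+z. indicator A (\<omega>, z) \<partial>noise \<omega> \<partial>M) = (\<integral>\<^sup>+\<omega>. \<integral>\<^sup>+z. indicator A (\<omega>, z) \<partial>\<nu> \<partial>M)"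
      using e by (simp add: ind[OF _ sets_noise] ind[OF _ refl] cong: nn_integral_cong)
    ultimately show ?case by simp
  next
    case (mult u c)
    have "(\<lambda>\<omega>. c * \<integral>\<^sup>+z. u (\<omega>, z) \<partial>noise \<omega>) \<in> borel_measurable M"
      using mult(4) by (intro borel_measurable_times_ennreal) auto
    then show ?case using mult
      using sec[OF mult(2)] measurable_bipred_section[OF mult(2)] \<nu>meas[OF mult(2)]
      by (simp add: nn_integral_cmult cong: measurable_cong nn_integral_cong)
  next
    case (add u v)
    have "(\<lambda>\<omega>. (\<integral>\<^sup>+z. v (\<omega>, z) \<partial>noise \<omega>) + (\<integral>\<^sup>+z. u (\<omega>, z) \<partial>noise \<omega>)) \<in> borel_measurable M"
      using add(6,7) by (intro borel_measurable_add) auto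
    then show ?case using add
      using sec[OF add(1)] measurable_bipred_section[OF add(1)] \<nu>meas[OF add(1)]
        sec[OF add(3)] measurable_bipred_section[OF add(3)] \<nu>meas[OF add(3)]
      by (simp add: nn_integral_add cong: measurable_cong nn_integral_cong)
  next
    case (seq U)
    have um: "(\<lambda>\<omega>. \<integral>\<^sup>+z. U i (\<omega>, z) \<partial>noise \<omega>) \<in> borel_measurable M" for i
      using seq.IH by blast
    have inc: "incseq (\<lambda>i z. U i (\<omega>, z))" for \<omega> using seq(3) by (auto simp: incseq_def le_fun_def)
    have n: "(\<integral>\<^sup>+z. (SUP i. U i) (\<omega>, z) \<partial>noise \<omega>) = (SUP i. \<integral>\<^sup>+z. U i (\<omega>, z) \<partial>noise \<omega>)" if "\<omega> \<in> space M" for \<omega>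
      using sec[OF seq(1) that] inc
      by (simp add: image_comp nn_integral_monotone_convergence_SUP)
    have v: "(\<integral>\<^sup>+z. (SUP i. U i) (\<omega>, z) \<partial>\<nu>) = (SUP i. \<integral>\<^sup>+z. U i (\<omega>, z) \<partial>\<nu>)" if "\<omega> \<in> space M" for \<omega>
      using measurable_bipred_section[OF seq(1) that] inc
      by (simp add: image_comp nn_integral_monotone_convergence_SUP)
    have inc2: "incseq (\<lambda>i \<omega>. \<integral>\<^sup>+z. U i (\<omega>, z) \<partial>K \<omega>)" for K :: "'w \<Rightarrow> (real \<times> real) measure"
      using seq(3) by (auto simp: incseq_def le_fun_def intro!: nn_integral_mono)
    have "(\<integral>\<^sup>+\<omega>. (SUP i. \<integral>\<^sup>+z. U i (\<omega>, z) \<partial>noise \<omega>) \<partial>M) = (SUP i. \<integral>\<^sup>+\<omega>. \<integral>\<^sup>+z. U i (\<omega>, z) \<partial>noise \<omega> \<partial>M)"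
      using um inc2 by (intro nn_integral_monotone_convergence_SUP) auto
    also have "\<dots> = (SUP i. \<integral>\<^sup>+\<omega>. \<integral>\<^sup>+z. U i (\<omega>, z) \<partial>\<nu> \<partial>M)" using seq.IH by simp
    also have "\<dots> = (\<integral>\<^sup>+\<omega>. (SUP i. \<integral>\<^sup>+z. U i (\<omega>, z) \<partial>\<nu>) \<partial>M)"
      using \<nu>meas[OF seq(1)] inc2[of "\<lambda>_. \<nu>"] by (intro nn_integral_monotone_convergence_SUP[symmetric]) auto
    also have "\<dots> = (\<integral>\<^sup>+\<omega>. \<integral>\<^sup>+z. (SUP i. U i) (\<omega>, z) \<partial>\<nu> \<partial>M)"
      by (intro nn_integral_cong v[symmetric])
    also have "(\<integral>\<^sup>+\<omega>. (SUP i. \<integral>\<^sup>+z. U i (\<omega>, z) \<partial>noise \<omega>) \<partial>M) =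
        (\<integral>\<^sup>+\<omega>. \<integral>\<^sup>+z. (SUP i. U i) (\<omega>, z) \<partial>noise \<omega> \<partial>M)"
      by (intro nn_integral_cong n[symmetric])
    finally have "(\<integral>\<^sup>+\<omega>. \<integral>\<^sup>+z. (SUP i. U i) (\<omega>, z) \<partial>noise \<omega> \<partial>M) =
        (\<integral>\<^sup>+\<omega>. \<integral>\<^sup>+z. (SUP i. U i) (\<omega>, z) \<partial>\<nu> \<partial>M)" .
    moreover have "(\<lambda>\<omega>. \<integral>\<^sup>+z. (SUP i. U i) (\<omega>, z) \<partial>noise \<omega>) \<in> borel_measurable M"
      using um by (subst measurable_cong[OF n]) auto
    ultimately show ?case by blast
  qed
qed

end

section \<open>Pathwise properties of the Hawkes process\<close>

text \<open>Half-open intervals determine a finite measure on the line. This identifies the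
  Stieltjes measure in the definition of \<Lambda> with the jump measure constructed from the
  noise.\<close>

lemma (in finite_borel_measure) interval_measure_cdf: "interval_measure (cdf M) = M"
proof (rule measure_eqI_generator_eq[where \<Omega>=UNIV])
  fix X assume "X \<in> range (\<lambda>(a, b). {a<..b::real})"
  then obtain a b where X: "X = {a<..b}" by auto
  show "emeasure (interval_measure (cdf M)) X = emeasure M X"
    using emeasure_Ioc[of a b] unfolding X
    by (cases "a \<le> b") (simp_all add: emeasure_interval_measure_Ioc cdf_nondecreasing cdf_is_right_cont)
next
  show "(\<Union>i. {- real (i::nat)<..real i}) = UNIV"
    by (rule UN_Ioc_eq_UNIV)
qed (auto simp: M_is_borel borel_sigma_sets_Ioc Int_stable_def
   emeasure_interval_measure_Ioc_eq cdf_nondecreasing cdf_is_right_cont)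

text \<open>A point of mass below 1 has mass 0 by integrality, hence by continuity from above a
  neighbourhood of mass below 1, thus again of mass 0. That neighbourhood contains a rational
  interval around the point, and the countably many null rational intervals together form a null
  set.\<close>

lemma AE_integer_valued_atom:
  fixes K :: "real measure"
  assumes K: "finite_borel_measure K" and int: "\<And>A. A \<in> sets borel \<Longrightarrow> emeasure K A \<in> range of_nat"
  shows "AE u in K. 1 \<le> emeasure K {u}"
proof -
  interpret finite_borel_measure K by fact
  have "AE u in K. \<forall>p\<in>\<rat>. \<forall>q\<in>\<rat>. emeasure K {p<..<q} = 0 \<longrightarrow> u \<notin> {p<..<q}"
    unfolding AE_ball_countable[OF countable_rat]
  proof (intro ballI)
    fix p q :: real
    show "AE u in K. emeasure K {p<..<q} = 0 \<longrightarrow> u \<notin> {p<..<q}"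
    proof (cases "emeasure K {p<..<q} = 0")
      case True
      then have "{p<..<q} \<in> null_sets K" by (simp add: M_is_borel null_sets_def)
      from AE_not_in[OF this] show ?thesis by eventually_elim simp
    qed simp
  qed
  then show ?thesis
  proof eventually_elim
    case (elim u)
    show "1 \<le> emeasure K {u}"
    proof (rule ccontr)
      assume "\<not> 1 \<le> emeasure K {u}"
      moreover obtain k where "emeasure K {u} = of_nat k" using int[of "{u}"] by auto
      ultimately have "k = 0" by (cases k) auto
      with \<open>emeasure K {u} = of_nat k\<close> have "emeasure K {u} = 0" by simp
      define V where "V n = {u - 1 / real (Suc n)<..<u + 1 / real (Suc n)}" for n
      have "(\<lambda>n. emeasure K (V n)) \<longlonglongrightarrow> emeasure K (\<Inter>n. V n)"
      proof (rule Lim_emeasure_decseq)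
        have "1 / real (Suc (Suc n)) \<le> 1 / real (Suc n)" for n
          by (intro divide_left_mono) auto
        then have "V (Suc n) \<subseteq> V n" for n unfolding V_def by (smt (verit) greaterThanLessThan_iff subsetI)
        then show "decseq V" by (simp add: decseq_Suc_iff)
      qed (auto simp: V_def M_is_borel emeasure_eq_measure)
      also have "(\<Inter>n. V n) = {u}"
      proof -
        have "x = u" if "\<forall>n. x \<in> V n" for x
        proof (rule ccontr)
          assume "x \<noteq> u"
          then obtain n where "1 / real (Suc n) < \<bar>x - u\<bar>"
            by (metis nat_approx_posE zero_less_abs_iff right_minus_eq)
          with that show False by (auto simp: V_def dest!: spec[of _ n])
        qed
        then show ?thesis by (auto simp: V_def)
      qed
      finally have "(\<lambda>n. emeasure K (V n)) \<longlonglongrightarrow> 0" using \<open>emeasure K {u} = 0\<close> by simp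
      then have "eventually (\<lambda>n. emeasure K (V n) < 1) sequentially"
        by (rule order_tendstoD) simp
      then obtain n where n: "emeasure K (V n) < 1" by (auto simp: eventually_sequentially)
      obtain j where j: "emeasure K (V n) = of_nat j" using int[of "V n"] by (auto simp: V_def)
      with n have "j = 0" by (cases j) auto
      with j have 0: "emeasure K (V n) = 0" by simp
      obtain p where p: "p \<in> \<rat>" "u - 1 / real (Suc n) < p" "p < u"
        using Rats_dense_in_real[of "u - 1 / real (Suc n)" u] by auto
      obtain q where q: "q \<in> \<rat>" "u < q" "q < u + 1 / real (Suc n)"
        using Rats_dense_in_real[of u "u + 1 / real (Suc n)"] by auto
      have "emeasure K {p<..<q} \<le> emeasure K (V n)"
        using p q by (intro emeasure_mono) (auto simp: V_def M_is_borel)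
      with 0 have "emeasure K {p<..<q} = 0" by simp
      with elim p q show False by auto
    qed
  qed
qed

section \<open>The jump measure and the intensity of a single path\<close>

locale hawkes_model = strip_noise M T N
  for M :: "'w measure" and T :: real and N :: "'w \<Rightarrow> (real \<times> real) measure" +
  fixes \<mu> :: real and \<Phi> :: "real \<Rightarrow> real" and H :: "real \<Rightarrow> 'w \<Rightarrow> nat" and \<Lambda> :: "real \<Rightarrow> 'w \<Rightarrow> real"
  assumes T: "0 < T" and \<mu>: "0 < \<mu>"
    and \<Phi>_meas: "\<Phi> \<in> borel_measurable (restrict_space borel {0..T})"
    and \<Phi>_nonneg: "\<And>t. t \<in> {0..T} \<Longrightarrow> 0 \<le> \<Phi> t" and \<Phi>_bounded: "bounded (\<Phi> ` {0..T})"
    and \<Phi>_subcritical: "(LBINT s:{0..T}. \<Phi> s) < 1"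
    and hawkes: "hawkes_process M N T \<mu> \<Phi> H \<Lambda>"
begin

text \<open>\<Phi> is only measurable, nonnegative and bounded on \<open>{0..T}\<close>; its
  extension by 0 is a Borel kernel on the whole line and can be used in convolutions without side
  conditions.\<close>

definition ker :: "real \<Rightarrow> ennreal" where
  "ker t = ennreal (indicator {0..T} t * \<Phi> t)"

lemma ker_real_meas: "(\<lambda>t. indicator {0..T} t * \<Phi> t) \<in> borel_measurable borel"
  using \<Phi>_meas by (subst (asm) borel_measurable_restrict_space_iff) auto

lemma ker_meas[measurable]: "ker \<in> borel_measurable borel"
  unfolding ker_def using ker_real_meas by measurable

lemma ker_bounded: "\<exists>B\<ge>0. (\<forall>t. ker t \<le> ennreal B) \<and> (\<forall>t\<in>{0..T}. \<Phi> t \<le> B)"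
proof -
  obtain B where B: "\<And>t. t \<in> {0..T} \<Longrightarrow> norm (\<Phi> t) \<le> B"
    using \<Phi>_bounded unfolding bounded_iff by (metis imageI)
  have "0 \<le> B" using B[of 0] T by auto
  moreover have "ker t \<le> ennreal B" for t
    using B[of t] \<open>0 \<le> B\<close> by (auto simp: ker_def indicator_def intro: ennreal_leI)
  moreover have "\<Phi> t \<le> B" if "t \<in> {0..T}" for t using B[OF that] by simp
  ultimately show ?thesis by blast
qed

text \<open>Collects everything that holds for almost every path, so that the following lemmas are
  deterministic statements about one fixed path.\<close>

definition good :: "'w \<Rightarrow> bool" where
  "good \<omega> \<longleftrightarrow> \<omega> \<in> space M \<and> regular \<omega> \<and>
     (\<lambda>s. \<Lambda> s \<omega>) \<in> borel_measurable (restrict_space borel {0..T}) \<and>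
     (\<forall>t\<in>{0..T}.
        of_nat (H t \<omega>) = (\<integral>\<^sup>+ z. indicator {(s, \<theta>). s \<in> {0<..t} \<and> 0 \<le> \<theta> \<and> \<theta> \<le> \<Lambda> s \<omega>} z \<partial>N \<omega>) \<and>
        \<Lambda> t \<omega> = \<mu> +
          (LINT u:{0<..<t}|interval_measure (\<lambda>u. real (H (max 0 (min T u)) \<omega>)). \<Phi> (t - u)))"

lemma AE_good: "AE \<omega> in M. good \<omega>"
proof -
  have "AE \<omega> in M. (\<lambda>s. \<Lambda> s \<omega>) \<in> borel_measurable (restrict_space borel {0..T}) \<and>
     (\<forall>t\<in>{0..T}.
        of_nat (H t \<omega>) = (\<integral>\<^sup>+ z. indicator {(s, \<theta>). s \<in> {0<..t} \<and> 0 \<le> \<theta> \<and> \<theta> \<le> \<Lambda> s \<omega>} z \<partial>N \<omega>) \<and>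
        \<Lambda> t \<omega> = \<mu> +
          (LINT u:{0<..<t}|interval_measure (\<lambda>u. real (H (max 0 (min T u)) \<omega>)). \<Phi> (t - u)))"
    using hawkes unfolding hawkes_process_def by blast
  with AE_regular AE_space show ?thesis
    by eventually_elim (simp add: good_def)
qed

lemma good_noise: "good \<omega> \<Longrightarrow> noise \<omega> = N \<omega>" "good \<omega> \<Longrightarrow> \<omega> \<in> space M"
  by (simp_all add: good_def noise_def)

definition region :: "'w \<Rightarrow> (real \<times> real) set" where
  "region \<omega> = {z \<in> space \<nu>. 0 < fst z \<and> snd z \<le> \<Lambda> (fst z) \<omega>}"

text \<open>Built as the time projection of the accepted noise points and not from the function H:
  integrality and the comparison with points below \<mu> are then inherited from the noise, and
  integrals against \<open>dH\<close> become noise integrals to which compensation applies.\<close>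

definition dH :: "'w \<Rightarrow> real measure" where
  "dH \<omega> = distr (density (noise \<omega>) (indicator (region \<omega>))) borel fst"

lemma base_sets: "A \<in> sets borel \<Longrightarrow> A \<subseteq> {0..T} \<Longrightarrow> A \<times> {0..\<mu>} \<in> sets \<nu>"
proof (rule sets_stripI)
  assume "A \<in> sets borel"
  then have "A \<times> {0..\<mu>} \<in> sets (borel \<Otimes>\<^sub>M borel)"
    by (rule pair_measureI) (rule borel_closed, rule closed_atLeastAtMost)
  then show "A \<times> {0..\<mu>} \<in> sets borel" by (simp only: borel_prod)
qed auto

context
  fixes \<omega> assumes good: "good \<omega>"
begin

lemma noise_sets[measurable_cong]: "sets (noise \<omega>) = sets \<nu>"
  using good by (intro sets_noise) (simp add: good_def)

lemma region_sets[measurable]: "region \<omega> \<in> sets \<nu>"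
proof -
  have "(\<lambda>s. \<Lambda> s \<omega>) \<in> borel_measurable (restrict_space borel {0..T})"
    using good by (simp add: good_def)
  moreover have "fst \<in> measurable \<nu> (restrict_space borel {0..T})"
    by (intro measurable_restrict_space2) (auto simp: space_strip)
  ultimately have [measurable]: "(\<lambda>z. \<Lambda> (fst z) \<omega>) \<in> borel_measurable \<nu>"
    by (rule measurable_compose[rotated])
  show ?thesis unfolding region_def by measurable
qed

lemma sets_dH[measurable_cong, simp]: "sets (dH \<omega>) = sets borel"
  by (simp add: dH_def)

lemma space_dH[simp]: "space (dH \<omega>) = UNIV"
  by (simp add: dH_def)

lemma region_slice: "A \<in> sets borel \<Longrightarrow> {z\<in>region \<omega>. fst z \<in> A} \<in> sets \<nu>"
proof -
  assume [measurable]: "A \<in> sets borel"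
  have "{z\<in>region \<omega>. fst z \<in> A} = region \<omega> \<inter> (fst -` A \<inter> space \<nu>)"
    using sets.sets_into_space[OF region_sets] by auto
  also have "\<dots> \<in> sets \<nu>" by measurable
  finally show ?thesis .
qed

lemma emeasure_dH: "A \<in> sets borel \<Longrightarrow> emeasure (dH \<omega>) A = emeasure (noise \<omega>) {z\<in>region \<omega>. fst z \<in> A}"
proof -
  assume [measurable]: "A \<in> sets borel"
  have [measurable]: "fst \<in> borel_measurable (noise \<omega>)" by measurable
  have m: "fst -` A \<inter> space (noise \<omega>) \<in> sets (noise \<omega>)" by measurable
  have "emeasure (dH \<omega>) A = emeasure (density (noise \<omega>) (indicator (region \<omega>))) (fst -` A \<inter> space (noise \<omega>))"
    unfolding dH_def by (subst emeasure_distr) auto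
  also have "\<dots> = (\<integral>\<^sup>+z. indicator (region \<omega>) z * indicator (fst -` A \<inter> space (noise \<omega>)) z \<partial>noise \<omega>)"
    using m by (subst emeasure_density) (auto intro!: borel_measurable_indicator simp: noise_sets)
  also have "\<dots> = (\<integral>\<^sup>+z. indicator {z\<in>region \<omega>. fst z \<in> A} z \<partial>noise \<omega>)"
    using sets.sets_into_space[OF region_sets] good
    by (intro nn_integral_cong) (auto simp: indicator_def)
  also have "\<dots> = emeasure (noise \<omega>) {z\<in>region \<omega>. fst z \<in> A}"
    by (rule nn_integral_indicator) (simp add: noise_sets region_slice)
  finally show ?thesis .
qed

lemma nn_integral_dH:
  assumes [measurable]: "F \<in> borel_measurable borel"
  shows "(\<integral>\<^sup>+u. F u \<partial>dH \<omega>) = (\<integral>\<^sup>+z. indicator (region \<omega>) z * F (fst z) \<partial>noise \<omega>)"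
  unfolding dH_def by (subst nn_integral_distr; (subst nn_integral_density)?) auto

lemma dH_Ioc: "t \<in> {0..T} \<Longrightarrow> emeasure (dH \<omega>) {0<..t} = of_nat (H t \<omega>)"
proof -
  assume t: "t \<in> {0..T}"
  have m: "{z\<in>region \<omega>. fst z \<in> {0<..t}} \<in> sets \<nu>" by (rule region_slice) simp
  have "of_nat (H t \<omega>) = (\<integral>\<^sup>+ z. indicator {(s, \<theta>). s \<in> {0<..t} \<and> 0 \<le> \<theta> \<and> \<theta> \<le> \<Lambda> s \<omega>} z \<partial>N \<omega>)"
    using good t unfolding good_def by blast
  also have "\<dots> = (\<integral>\<^sup>+ z. indicator {z\<in>region \<omega>. fst z \<in> {0<..t}} z \<partial>noise \<omega>)"
    using good t by (auto simp: good_noise space_N region_def space_strip indicator_def good_def intro!: nn_integral_cong)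
  also have "\<dots> = emeasure (dH \<omega>) {0<..t}"
    using m by (subst emeasure_dH) (auto simp: noise_sets intro!: nn_integral_indicator)
  finally show ?thesis by simp
qed

lemma dH_outside: "A \<in> sets borel \<Longrightarrow> A \<inter> {0<..T} = {} \<Longrightarrow> emeasure (dH \<omega>) A = 0"
proof -
  assume A: "A \<in> sets borel" "A \<inter> {0<..T} = {}"
  have "{z\<in>region \<omega>. fst z \<in> A} = {}" using A(2) by (auto simp: region_def space_strip)
  then show ?thesis unfolding emeasure_dH[OF A(1)] by (simp only: emeasure_empty)
qed

lemma dH_restrict: "A \<in> sets borel \<Longrightarrow> emeasure (dH \<omega>) A = emeasure (dH \<omega>) (A \<inter> {0<..T})"
proof -
  assume A: "A \<in> sets borel"
  have "emeasure (dH \<omega>) A = emeasure (dH \<omega>) (A \<inter> {0<..T}) + emeasure (dH \<omega>) (A - {0<..T})"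
    using A by (subst plus_emeasure) (auto intro: arg_cong[where f="emeasure (dH \<omega>)"])
  also have "emeasure (dH \<omega>) (A - {0<..T}) = 0" using A by (intro dH_outside) auto
  finally show ?thesis by simp
qed

lemma dH_UNIV: "emeasure (dH \<omega>) UNIV = of_nat (H T \<omega>)"
proof -
  have "emeasure (dH \<omega>) UNIV = emeasure (dH \<omega>) (UNIV \<inter> {0<..T})" by (rule dH_restrict) simp
  also have "\<dots> = of_nat (H T \<omega>)" using T by (simp add: dH_Ioc)
  finally show ?thesis .
qed

lemma finite_borel_dH: "finite_borel_measure (dH \<omega>)"
proof (intro finite_borel_measure.intro finite_measureI finite_borel_measure_axioms.intro)
  show "emeasure (dH \<omega>) (space (dH \<omega>)) \<noteq> \<infinity>" unfolding space_dH dH_UNIV by simp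
qed simp

lemma dH_le: "A \<in> sets borel \<Longrightarrow> emeasure (dH \<omega>) A \<le> of_nat (H T \<omega>)"
  unfolding dH_UNIV[symmetric] by (rule emeasure_mono) auto

lemma dH_finite: "A \<in> sets borel \<Longrightarrow> emeasure (dH \<omega>) A < \<top>"
  using dH_le[of A] of_nat_less_top by (rule le_less_trans)

lemma dH_integer: "A \<in> sets borel \<Longrightarrow> emeasure (dH \<omega>) A \<in> range of_nat"
proof -
  assume A: "A \<in> sets borel"
  show ?thesis
    using noise_integer[OF _ region_slice[OF A], of \<omega>] good A dH_finite[OF A]
    by (auto simp: emeasure_dH good_def)
qed

lemma AE_dH_atom: "AE u in dH \<omega>. 1 \<le> emeasure (dH \<omega>) {u}"
  using finite_borel_dH dH_integer by (rule AE_integer_valued_atom)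

lemma AE_dH_range: "AE u in dH \<omega>. u \<in> {0<..T}"
proof -
  have "emeasure (dH \<omega>) (- {0<..T}) = 0" by (rule dH_outside) auto
  then have "- {0<..T} \<in> null_sets (dH \<omega>)" by (simp add: null_sets_def)
  then have "AE u in dH \<omega>. u \<notin> - {0<..T}" by (rule AE_not_in)
  then show ?thesis by simp
qed

text \<open>\<open>dH\<close> lives on \<open>{0<..T}\<close>, so its distribution function is H
  with the time clamped to \<open>{0..T}\<close>, exactly the extended path in
  \<open>hawkes_process\<close>.\<close>

lemma interval_measure_dH: "interval_measure (\<lambda>u. real (H (max 0 (min T u)) \<omega>)) = dH \<omega>"
proof -
  interpret finite_borel_measure "dH \<omega>" by (rule finite_borel_dH)
  have "real (H (max 0 (min T u)) \<omega>) = cdf (dH \<omega>) u" for u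
  proof -
    have "{..u} \<inter> {0<..T} = {0<..max 0 (min T u)}" by (auto simp: max_def min_def)
    then have "emeasure (dH \<omega>) {..u} = emeasure (dH \<omega>) {0<..max 0 (min T u)}"
      using dH_restrict[of "{..u}"] by simp
    also have "\<dots> = of_nat (H (max 0 (min T u)) \<omega>)"
      using T by (intro dH_Ioc) auto
    finally show ?thesis by (simp add: cdf_def measure_def)
  qed
  then show ?thesis using interval_measure_cdf by presburger
qed

text \<open>Boundedness of \<Phi> and finiteness of \<open>dH\<close> make the Bochner integral in
  the intensity equation a genuine one, so that it can be rewritten as a nonnegative integral, which
  also gives the lower bound \<mu>.\<close>

lemma intensity:
  assumes t: "t \<in> {0..T}"
  shows "ennreal (\<Lambda> t \<omega>) = ennreal \<mu> + (\<integral>\<^sup>+u. indicator {0<..<t} u * ker (t - u) \<partial>dH \<omega>)" and "\<mu> \<le> \<Lambda> t \<omega>"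
proof -
  interpret finite_borel_measure "dH \<omega>" by (rule finite_borel_dH)
  from ker_bounded obtain B where "0 \<le> B \<and> (\<forall>t. ker t \<le> ennreal B) \<and> (\<forall>t\<in>{0..T}. \<Phi> t \<le> B)" ..
  then have B: "0 \<le> B" "\<And>t. t \<in> {0..T} \<Longrightarrow> \<Phi> t \<le> B" by auto
  let ?F = "\<lambda>u. indicator {0<..<t} u * (indicator {0..T} (t - u) * \<Phi> (t - u)) :: real"
  have eq: "indicator {0<..<t} u *\<^sub>R \<Phi> (t - u) = ?F u" for u
    using t by (auto simp: indicator_def)
  have nn: "0 \<le> ?F u" for u using \<Phi>_nonneg by (auto simp: indicator_def)
  have [measurable]: "(\<lambda>u. indicator {0..T} (t - u) * \<Phi> (t - u)) \<in> borel_measurable borel"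
    using measurable_compose[OF _ ker_real_meas, of "\<lambda>u. t - u" borel] by simp
  have "integrable (dH \<omega>) ?F"
  proof (rule integrable_const_bound[where B=B])
    have "?F u \<le> B" for u
      using B by (cases "u \<in> {0<..<t} \<and> t - u \<in> {0..T}") (auto simp del: atLeastAtMost_iff)
    then show "AE u in dH \<omega>. norm (?F u) \<le> B"
      using nn by (intro AE_I2) (simp only: real_norm_def abs_of_nonneg)
    show "?F \<in> borel_measurable (dH \<omega>)" by measurable
  qed
  then have "(\<integral>\<^sup>+u. ennreal (?F u) \<partial>dH \<omega>) = ennreal (\<integral>u. ?F u \<partial>dH \<omega>)"
    using nn by (intro nn_integral_eq_integral) auto
  moreover have "ennreal (?F u) = indicator {0<..<t} u * ker (t - u)" for u
    by (auto simp: ker_def indicator_def)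
  moreover have L: "\<Lambda> t \<omega> = \<mu> + (\<integral>u. ?F u \<partial>dH \<omega>)"
  proof -
    have "\<Lambda> t \<omega> = \<mu> + (\<integral>u. indicator {0<..<t} u *\<^sub>R \<Phi> (t - u) \<partial>dH \<omega>)"
      using good t unfolding good_def interval_measure_dH set_lebesgue_integral_def by blast
    then show ?thesis unfolding eq .
  qed
  moreover have I0: "0 \<le> (\<integral>u. ?F u \<partial>dH \<omega>)" by (rule integral_nonneg_AE) (use nn in auto)
  ultimately show "ennreal (\<Lambda> t \<omega>) = ennreal \<mu> + (\<integral>\<^sup>+u. indicator {0<..<t} u * ker (t - u) \<partial>dH \<omega>)" "\<mu> \<le> \<Lambda> t \<omega>"
    using \<mu> by simp_all
qed

text \<open>The intensity never falls below \<mu>, so every noise point below that height survives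
  the thinning.\<close>

lemma base_le_dH:
  assumes A: "A \<in> sets borel" "A \<subseteq> {0<..T}"
  shows "emeasure (noise \<omega>) (A \<times> {0..\<mu>}) \<le> emeasure (dH \<omega>) A"
proof -
  have "{z\<in>region \<omega>. fst z \<in> A} \<in> sets (noise \<omega>)"
    using region_slice[OF A(1)] by (simp add: noise_sets)
  moreover have "A \<times> {0..\<mu>} \<subseteq> {z\<in>region \<omega>. fst z \<in> A}"
  proof safe
    fix s \<theta> assume s: "s \<in> A" and \<theta>: "\<theta> \<in> {0..\<mu>}"
    have "s \<in> {0<..T}" using A s by blast
    moreover from this have "\<mu> \<le> \<Lambda> s \<omega>" by (intro intensity(2)) simp
    ultimately show "(s, \<theta>) \<in> region \<omega>" using \<theta> by (simp add: region_def space_strip)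
  qed simp
  ultimately show ?thesis
    using A by (subst emeasure_dH) (auto intro!: emeasure_mono)
qed

end

end

section \<open>Predictable versions of the processes\<close>

context strip_noise
begin

lemma bipredI:
  "X \<in> noise_in (space \<nu> - {s<..r} \<times> UNIV) \<Longrightarrow> C \<in> sets \<nu> \<Longrightarrow> C \<subseteq> {s<..r} \<times> UNIV \<Longrightarrow> X \<times> C \<in> sets bipred"
  unfolding sets_bipred by (intro sigma_sets.Basic bipred_genI)

lemma space_noise_in: "space M \<in> noise_in D"
proof -
  interpret sigma_algebra "space M" "noise_in D" by (rule sigma_algebra_noise_in)
  show ?thesis by (rule top)
qed

lemma snd_bipred[measurable]: "snd \<in> measurable bipred \<nu>"
proof (rule measurableI)
  fix C assume C: "C \<in> sets \<nu>"
  have "snd -` C \<inter> space bipred = space M \<times> C"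
    using sets.sets_into_space[OF C] by (auto simp: space_bipred)
  also have "\<dots> \<in> sets bipred"
    \<comment> \<open>The strip from -1 to \<open>T\<close> contains all times, including 0 despite
      being open on the left; a deterministic event is known even without any noise.\<close>
    using C by (intro bipredI[where s="-1" and r=T] space_noise_in) (auto simp: sets_strip)
  finally show "snd -` C \<inter> space bipred \<in> sets bipred" .
qed (auto simp: space_bipred)

text \<open>The building block of all measurability proofs: a variable decided by the noise outside
  a strip, switched on only at times in that strip. Its superlevel sets are generating
  rectangles.\<close>

lemma bipred_frozen:
  assumes Y: "\<And>c. {\<omega>\<in>space M. c < Y \<omega>} \<in> noise_in (space \<nu> - {s<..r} \<times> UNIV)"
  shows "(\<lambda>(\<omega>, z). Y \<omega> * indicator {s<..r} (fst z) :: ennreal) \<in> borel_measurable bipred"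
proof (rule borel_measurableI_greater)
  fix c :: ennreal
  let ?C = "{z\<in>space \<nu>. fst z \<in> {s<..r}}"
  have "{p\<in>space bipred. c < (\<lambda>(\<omega>, z). Y \<omega> * indicator {s<..r} (fst z)) p} = {\<omega>\<in>space M. c < Y \<omega>} \<times> ?C"
  proof -
    \<comment> \<open>No \<open>ennreal\<close> lies below 0, so the zero value off the strip never
      exceeds \<open>c\<close>.\<close>
    have "c < Y \<omega> * indicator {s<..r} x \<longleftrightarrow> c < Y \<omega> \<and> x \<in> {s<..r}" for \<omega> x
      by (cases "x \<in> {s<..r}") auto
    then show ?thesis by (auto simp: space_bipred)
  qed
  also have "\<dots> \<in> sets bipred"
  proof (rule bipredI[OF Y])
    show "?C \<in> sets \<nu>" by measurable
  qed auto
  finally show "{p\<in>space bipred. c < (\<lambda>(\<omega>, z). Y \<omega> * indicator {s<..r} (fst z)) p} \<in> sets bipred" .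
qed

end

context hawkes_model
begin

lemma H_noise_in:
  assumes t: "t \<in> {0..T}"
  shows "{\<omega>\<in>space M. P (H t \<omega>)} \<in> noise_in ({0..t} \<times> {0..})"
proof -
  have "H t \<in> measurable (noise_filtration M N t) (count_space UNIV)"
    using hawkes t by (simp add: hawkes_process_def)
  then have "H t -` {k. P k} \<inter> space (noise_filtration M N t) \<in> sets (noise_filtration M N t)"
    by (rule measurable_sets) simp
  moreover have "H t -` {k. P k} \<inter> space (noise_filtration M N t) = {\<omega>\<in>space M. P (H t \<omega>)}"
    by (auto simp: noise_filtration_def space_measure_of_conv)
  moreover have "sets (noise_filtration M N t) \<subseteq> noise_in ({0..t} \<times> {0..})"
  proof -
    have sub: "A \<in> sets \<nu>" if "A \<in> sets borel" "A \<subseteq> {0..t} \<times> {0..}" for A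
      using that t by (intro sets_stripI) force+
    show ?thesis
      unfolding noise_filtration_def noise_in_def
    proof (subst sets_measure_of)
      show "sigma_sets (space M) {(\<lambda>\<omega>. emeasure (N \<omega>) A) -` B \<inter> space M | A B.
          A \<in> sets borel \<and> A \<subseteq> {0..t} \<times> {0..} \<and> B \<in> sets borel}
        \<subseteq> sigma_sets (space M) {(\<lambda>\<omega>. emeasure (N \<omega>) A) -` B \<inter> space M | A B.
          A \<in> sets \<nu> \<and> A \<subseteq> {0..t} \<times> {0..} \<and> B \<in> sets borel}"
        using sub by (intro sigma_sets_mono') blast
    qed auto
  qed
  ultimately show ?thesis by auto
qed

text \<open>On good paths this is the left limit of H at \<open>t - a\<close>. Written as a
  countable supremum over rational times \<open>q\<close> with \<open>q + a < t\<close>, it consists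
  of frozen variables \<open>H q\<close>, each known before the strip on which it is used.\<close>

definition lagged :: "real \<Rightarrow> 'w \<Rightarrow> real \<Rightarrow> ennreal" where
  "lagged a \<omega> t = (SUP q\<in>\<rat> \<inter> {0..T}. of_nat (H q \<omega>) * indicator {q + a<..T} t)"

lemma lagged_measurable:
  assumes a: "0 \<le> a"
  shows "(\<lambda>(\<omega>, z). lagged a \<omega> (fst z)) \<in> borel_measurable bipred"
proof -
  have "(\<lambda>(\<omega>, z). of_nat (H q \<omega>) * indicator {q + a<..T} (fst z) :: ennreal) \<in> borel_measurable bipred"
    if q: "q \<in> \<rat> \<inter> {0..T}" for q
  proof (rule bipred_frozen)
    fix c :: ennreal
    have "{\<omega>\<in>space M. c < of_nat (H q \<omega>)} \<in> noise_in ({0..q} \<times> {0..})"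
      using H_noise_in[of q "\<lambda>k. c < of_nat k"] q by simp
    \<comment> \<open>This is where \<open>0 \<le> a\<close> enters: the noise up to
      \<open>q\<close> must lie outside the strip that starts after \<open>q + a\<close>.\<close>
    also have "noise_in ({0..q} \<times> {0..}) \<subseteq> noise_in (space \<nu> - {q + a<..T} \<times> UNIV)"
      using a q by (intro noise_in_mono) (auto simp: space_strip)
    finally show "{\<omega>\<in>space M. c < of_nat (H q \<omega>)} \<in> noise_in (space \<nu> - {q + a<..T} \<times> UNIV)" .
  qed
  then have "(\<lambda>p. SUP q\<in>\<rat> \<inter> {0..T}. (\<lambda>(\<omega>, z). of_nat (H q \<omega>) * indicator {q + a<..T} (fst z) :: ennreal) p) \<in> borel_measurable bipred"
    by (intro borel_measurable_SUP) (auto intro: countable_Int1 countable_rat)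
  then show ?thesis by (simp add: lagged_def case_prod_unfold)
qed

lemma lagged_eq:
  assumes good: "good \<omega>" and a: "0 \<le> a" and t: "t \<in> {0..T}"
  shows "lagged a \<omega> t = emeasure (dH \<omega>) {0<..<t - a}"
proof (rule antisym)
  show "lagged a \<omega> t \<le> emeasure (dH \<omega>) {0<..<t - a}"
    unfolding lagged_def
  proof (rule SUP_least)
    fix q assume q: "q \<in> \<rat> \<inter> {0..T}"
    show "of_nat (H q \<omega>) * indicator {q + a<..T} t \<le> emeasure (dH \<omega>) {0<..<t - a}"
    proof (cases "t \<in> {q + a<..T}")
      case True
      have "of_nat (H q \<omega>) = emeasure (dH \<omega>) {0<..q}" using q good by (simp add: dH_Ioc)
      also have "\<dots> \<le> emeasure (dH \<omega>) {0<..<t - a}"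
        using True good by (intro emeasure_mono) auto
      finally show ?thesis using True by simp
    qed simp
  qed
  \<comment> \<open>The half-open intervals increase to the open one and leave room for a rational
    \<open>q\<close> between their right end and \<open>t - a\<close>.\<close>
  define V where "V n = {0<..t - a - 1 / real (Suc n)}" for n
  have "incseq V"
  proof (rule incseq_SucI)
    have "1 / real (Suc (Suc n)) \<le> 1 / real (Suc n)" for n by (intro divide_left_mono) auto
    then show "V n \<le> V (Suc n)" for n unfolding V_def by (smt (verit) greaterThanAtMost_iff subsetI)
  qed
  have "{0<..<t - a} = (\<Union>n. V n)"
  proof safe
    fix x assume x: "x \<in> {0<..<t - a}"
    then obtain n where "1 / real (Suc n) < t - a - x"
      by (metis diff_gt_0_iff_gt greaterThanLessThan_iff nat_approx_posE)
    with x show "x \<in> (\<Union>n. V n)" by (auto simp: V_def intro!: exI[of _ n])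
  next
    fix x n assume "x \<in> V n"
    moreover have "0 < 1 / real (Suc n)" by simp
    ultimately show "x \<in> {0<..<t - a}" unfolding V_def greaterThanAtMost_iff greaterThanLessThan_iff by linarith
  qed
  then have "emeasure (dH \<omega>) {0<..<t - a} = (SUP n. emeasure (dH \<omega>) (V n))"
  proof (simp only:, intro SUP_emeasure_incseq[symmetric])
    show "range V \<subseteq> sets (dH \<omega>)" using good by (auto simp: V_def)
  qed (rule \<open>incseq V\<close>)
  also have "\<dots> \<le> lagged a \<omega> t"
  proof (rule SUP_least)
    fix n
    show "emeasure (dH \<omega>) (V n) \<le> lagged a \<omega> t"
    proof (cases "0 < t - a - 1 / real (Suc n)")
      case True
      have "0 < 1 / real (Suc n)" by simp
      then obtain q where q: "q \<in> \<rat>" "t - a - 1 / real (Suc n) < q" "q < t - a"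
        using Rats_dense_in_real[of "t - a - 1 / real (Suc n)" "t - a"] by auto
      with True a t have q': "q \<in> \<rat> \<inter> {0..T}" "t \<in> {q + a<..T}" by auto
      have "emeasure (dH \<omega>) (V n) \<le> emeasure (dH \<omega>) {0<..q}"
        using q good by (intro emeasure_mono) (auto simp: V_def)
      also have "\<dots> = of_nat (H q \<omega>) * indicator {q + a<..T} t"
        using q' good by (simp add: dH_Ioc)
      also have "\<dots> \<le> lagged a \<omega> t"
        unfolding lagged_def by (rule SUP_upper[OF q'(1)])
      finally show ?thesis .
    next
      case False
      then have "V n = {}" by (auto simp: V_def)
      then show ?thesis by simp
    qed
  qed
  finally show "emeasure (dH \<omega>) {0<..<t - a} \<le> lagged a \<omega> t" .
qed

text \<open>For a half-line \<open>A\<close> the mass counts the jumps before a shifted time, which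
  is \<open>lagged\<close>. Half-lines are closed under intersection and generate the Borel sets, so
  a Dynkin argument yields a two-sided measurable version for every \<open>A\<close>.\<close>

lemma convolution_version_set:
  assumes "A \<in> sets borel"
  shows "\<exists>W\<in>borel_measurable bipred. \<forall>\<omega> z. good \<omega> \<longrightarrow> z \<in> space \<nu> \<longrightarrow>
    W (\<omega>, z) = emeasure (dH \<omega>) {u\<in>{0<..<fst z}. fst z - u \<in> A}"
proof -
  have A: "A \<in> sigma_sets UNIV (range greaterThan)"
    using assms by (metis borel_Ioi sets_measure_of top_greatest Pow_UNIV)
  have "Int_stable (range (greaterThan :: real \<Rightarrow> _))"
  proof (rule Int_stableI, safe)
    fix a b :: real
    show "{a<..} \<inter> {b<..} \<in> range greaterThan" by (rule range_eqI[of _ _ "max a b"]) auto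
  qed
  moreover have "range (greaterThan :: real \<Rightarrow> _) \<subseteq> Pow UNIV" by simp
  ultimately show ?thesis
    using A
  proof (induction rule: sigma_sets_induct_disjoint)
    case (basic A)
    then obtain a where A: "A = {a<..}" by auto
    \<comment> \<open>A negative \<open>a\<close> adds nothing to \<open>u < t\<close>, hence the
      truncation at 0.\<close>
    have "{u\<in>{0<..<t}. t - u \<in> A} = {0<..<t - max 0 a}" for t
      by (auto simp: A)
    then show ?case
      by (intro bexI[OF _ lagged_measurable[of "max 0 a"]]) (auto simp: lagged_eq space_strip)
  next
    case empty
    show ?case by (intro bexI[of _ "\<lambda>_. 0"]) auto
  next
    case (compl A)
    then obtain W where W[measurable]: "W \<in> borel_measurable bipred"
      and eq: "\<And>\<omega> z. good \<omega> \<Longrightarrow> z \<in> space \<nu> \<Longrightarrow> W (\<omega>, z) = emeasure (dH \<omega>) {u\<in>{0<..<fst z}. fst z - u \<in> A}"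
      by blast
    have A[measurable]: "A \<in> sets borel"
      using compl(1) by (metis borel_Ioi sets_measure_of top_greatest Pow_UNIV)
    have "(\<lambda>p. (\<lambda>(\<omega>, z). lagged 0 \<omega> (fst z)) p - W p) \<in> borel_measurable bipred"
      using lagged_measurable[of 0] by measurable
    moreover have "lagged 0 \<omega> (fst z) - W (\<omega>, z) = emeasure (dH \<omega>) {u\<in>{0<..<fst z}. fst z - u \<in> UNIV - A}"
      if good: "good \<omega>" and z: "z \<in> space \<nu>" for \<omega> z
    proof -
      have m: "{u\<in>{0<..<fst z}. fst z - u \<in> A} \<in> sets borel" by measurable
      have "{u\<in>{0<..<fst z}. fst z - u \<in> UNIV - A} = {0<..<fst z} - {u\<in>{0<..<fst z}. fst z - u \<in> A}" by auto
      also have "emeasure (dH \<omega>) \<dots> =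
          emeasure (dH \<omega>) {0<..<fst z} - emeasure (dH \<omega>) {u\<in>{0<..<fst z}. fst z - u \<in> A}"
      proof (rule emeasure_Diff)
        show "emeasure (dH \<omega>) {u\<in>{0<..<fst z}. fst z - u \<in> A} \<noteq> \<infinity>"
          using dH_finite[OF good m] by simp
        show "{u\<in>{0<..<fst z}. fst z - u \<in> A} \<in> sets (dH \<omega>)" using m by (simp only: sets_dH[OF good])
      qed (auto simp: sets_dH[OF good])
      also have "emeasure (dH \<omega>) {0<..<fst z} = lagged 0 \<omega> (fst z)"
        using z by (simp add: lagged_eq[OF good] space_strip mem_Times_iff)
      finally show ?thesis by (simp only: eq[OF good z])
    qed
    ultimately show ?case by (intro bexI[where x="\<lambda>p. (\<lambda>(\<omega>, z). lagged 0 \<omega> (fst z)) p - W p"]) simp_all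
  next
    case (union A)
    then have "\<forall>i. \<exists>W\<in>borel_measurable bipred. \<forall>\<omega> z. good \<omega> \<longrightarrow> z \<in> space \<nu> \<longrightarrow>
        W (\<omega>, z) = emeasure (dH \<omega>) {u\<in>{0<..<fst z}. fst z - u \<in> A i}" by blast
    then obtain W where W: "\<And>i. W i \<in> borel_measurable bipred"
      and eq: "\<And>i \<omega> z. good \<omega> \<Longrightarrow> z \<in> space \<nu> \<Longrightarrow> W i (\<omega>, z) = emeasure (dH \<omega>) {u\<in>{0<..<fst z}. fst z - u \<in> A i}"
      by metis
    have A[measurable]: "A i \<in> sets borel" for i
    proof -
      have "A i \<in> sigma_sets UNIV (range greaterThan)" using union(2) by auto
      then show ?thesis by (metis borel_Ioi sets_measure_of top_greatest Pow_UNIV)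
    qed
    have "(\<lambda>p. \<Sum>i. W i p) \<in> borel_measurable bipred" using W by measurable
    moreover have "(\<Sum>i. W i (\<omega>, z)) = emeasure (dH \<omega>) {u\<in>{0<..<fst z}. fst z - u \<in> (\<Union>i. A i)}"
      if good: "good \<omega>" and z: "z \<in> space \<nu>" for \<omega> z
    proof -
      have eqU: "{u\<in>{0<..<fst z}. fst z - u \<in> (\<Union>i. A i)} = (\<Union>i. {u\<in>{0<..<fst z}. fst z - u \<in> A i})" by auto
      have m: "{u\<in>{0<..<fst z}. fst z - u \<in> A i} \<in> sets borel" for i by measurable
      have "disjoint_family (\<lambda>i. {u\<in>{0<..<fst z}. fst z - u \<in> A i})"
        using union(1) by (auto simp: disjoint_family_on_def)
      then show ?thesis
        unfolding eqU eq[OF good z] using m by (intro suminf_emeasure) (simp only: sets_dH[OF good] image_subset_iff, blast)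
    qed
    ultimately show ?case by (intro bexI[where x="\<lambda>p. \<Sum>i. W i p"]) simp_all
  qed
qed

text \<open>Monotone class extension from indicators to all nonnegative kernels; it is applied to
  \<open>ker\<close>.\<close>

lemma convolution_version:
  assumes "F \<in> borel_measurable borel"
  shows "\<exists>W\<in>borel_measurable bipred. \<forall>\<omega> z. good \<omega> \<longrightarrow> z \<in> space \<nu> \<longrightarrow>
    W (\<omega>, z) = (\<integral>\<^sup>+u. indicator {0<..<fst z} u * F (fst z - u) \<partial>dH \<omega>)"
  using assms
proof (induction rule: borel_measurable_induct)
  case (cong f g)
  then have "f = g" by auto
  with cong show ?case by simp
next
  case (set A)
  have "(\<integral>\<^sup>+u. indicator {0<..<t} u * indicator A (t - u) \<partial>dH \<omega>) = emeasure (dH \<omega>) {u\<in>{0<..<t}. t - u \<in> A}"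
    if good: "good \<omega>" for \<omega> t
  proof -
    have "(\<integral>\<^sup>+u. indicator {0<..<t} u * indicator A (t - u) \<partial>dH \<omega>) =
      (\<integral>\<^sup>+u. indicator {u\<in>{0<..<t}. t - u \<in> A} u \<partial>dH \<omega>)"
      by (intro nn_integral_cong) (simp add: indicator_def)
    also have "\<dots> = emeasure (dH \<omega>) {u\<in>{0<..<t}. t - u \<in> A}"
    proof (rule nn_integral_indicator)
      have [measurable]: "A \<in> sets borel" using set .
      have "{u\<in>{0<..<t}. t - u \<in> A} \<in> sets borel" by measurable
      then show "{u\<in>{0<..<t}. t - u \<in> A} \<in> sets (dH \<omega>)" using good by simp
    qed
    finally show ?thesis .
  qed
  then show ?case using convolution_version_set[OF set] by simp
next
  case (mult F c)
  then obtain W where W: "W \<in> borel_measurable bipred"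
    and eq: "\<And>\<omega> z. good \<omega> \<Longrightarrow> z \<in> space \<nu> \<Longrightarrow> W (\<omega>, z) = (\<integral>\<^sup>+u. indicator {0<..<fst z} u * F (fst z - u) \<partial>dH \<omega>)"
    by blast
  have [measurable]: "F \<in> borel_measurable borel" by (rule mult)
  have "(\<lambda>p. c * W p) \<in> borel_measurable bipred" using W by measurable
  moreover have "c * W (\<omega>, z) = (\<integral>\<^sup>+u. indicator {0<..<fst z} u * (c * F (fst z - u)) \<partial>dH \<omega>)"
    if good: "good \<omega>" and z: "z \<in> space \<nu>" for \<omega> z
  proof -
    have "(\<lambda>u. indicator {0<..<fst z} u * F (fst z - u)) \<in> borel_measurable (dH \<omega>)"
      by (simp add: measurable_cong_sets[OF sets_dH[OF good] refl])
    from nn_integral_cmult[OF this, of c] show ?thesis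
      by (simp add: eq[OF good z] mult.left_commute)
  qed
  ultimately show ?case by (intro bexI[where x="\<lambda>p. c * W p"]) simp_all
next
  case (add F G)
  obtain W where W1: "W \<in> borel_measurable bipred"
    and eq1: "\<And>\<omega> z. good \<omega> \<Longrightarrow> z \<in> space \<nu> \<Longrightarrow> W (\<omega>, z) = (\<integral>\<^sup>+u. indicator {0<..<fst z} u * F (fst z - u) \<partial>dH \<omega>)"
    using add.IH(1) by blast
  obtain V where W2: "V \<in> borel_measurable bipred"
    and eq2: "\<And>\<omega> z. good \<omega> \<Longrightarrow> z \<in> space \<nu> \<Longrightarrow> V (\<omega>, z) = (\<integral>\<^sup>+u. indicator {0<..<fst z} u * G (fst z - u) \<partial>dH \<omega>)"
    using add.IH(2) by blast
  note W = W1 W2 and eq = eq1 eq2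
  have [measurable]: "F \<in> borel_measurable borel" "G \<in> borel_measurable borel" by (rule add)+
  have "(\<lambda>p. V p + W p) \<in> borel_measurable bipred" using W by measurable
  moreover have "V (\<omega>, z) + W (\<omega>, z) = (\<integral>\<^sup>+u. indicator {0<..<fst z} u * (G (fst z - u) + F (fst z - u)) \<partial>dH \<omega>)"
    if good: "good \<omega>" and z: "z \<in> space \<nu>" for \<omega> z
  proof -
    have "(\<lambda>u. indicator {0<..<fst z} u * F (fst z - u)) \<in> borel_measurable (dH \<omega>)"
      "(\<lambda>u. indicator {0<..<fst z} u * G (fst z - u)) \<in> borel_measurable (dH \<omega>)"
      by (simp_all add: measurable_cong_sets[OF sets_dH[OF good] refl])
    from nn_integral_add[OF this(2,1)] show ?thesis
      by (simp add: eq[OF good z] distrib_left)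
  qed
  ultimately show ?case by (intro bexI[where x="\<lambda>p. V p + W p"]) simp_all
next
  case (seq F)
  then obtain W where W: "\<And>i. W i \<in> borel_measurable bipred"
    and eq: "\<And>i \<omega> z. good \<omega> \<Longrightarrow> z \<in> space \<nu> \<Longrightarrow> W i (\<omega>, z) = (\<integral>\<^sup>+u. indicator {0<..<fst z} u * F i (fst z - u) \<partial>dH \<omega>)"
    by metis
  have [measurable]: "F i \<in> borel_measurable borel" for i by (rule seq)
  have "(\<lambda>p. SUP i. W i p) \<in> borel_measurable bipred" using W by measurable
  moreover have "(SUP i. W i (\<omega>, z)) = (\<integral>\<^sup>+u. indicator {0<..<fst z} u * (SUP i. F i) (fst z - u) \<partial>dH \<omega>)"
    if good: "good \<omega>" and z: "z \<in> space \<nu>" for \<omega> z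
  proof -
    have m: "(\<lambda>u. indicator {0<..<fst z} u * F i (fst z - u)) \<in> borel_measurable (dH \<omega>)" for i
      by (simp add: measurable_cong_sets[OF sets_dH[OF good] refl])
    have inc: "incseq (\<lambda>i u. indicator {0<..<fst z} u * F i (fst z - u))"
      using \<open>incseq F\<close> by (auto simp: incseq_def le_fun_def indicator_def)
    have "(SUP i. W i (\<omega>, z)) = (\<integral>\<^sup>+u. (SUP i. indicator {0<..<fst z} u * F i (fst z - u)) \<partial>dH \<omega>)"
      unfolding eq[OF good z] by (rule nn_integral_monotone_convergence_SUP[OF inc m, symmetric])
    also have "\<dots> = (\<integral>\<^sup>+u. indicator {0<..<fst z} u * (SUP i. F i) (fst z - u) \<partial>dH \<omega>)"
      unfolding SUP_apply SUP_mult_left_ennreal ..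
    finally show ?thesis .
  qed
  ultimately show ?case by (intro bexI[where x="\<lambda>p. SUP i. W i p"]) simp_all
qed

text \<open>Adaptedness at each time says nothing about joint measurability of \<Lambda>. The
  convolution equation provides it, up to paths that are not good.\<close>

lemma intensity_version_ex:
  "\<exists>L\<in>borel_measurable bipred. \<forall>\<omega> z. good \<omega> \<longrightarrow> z \<in> space \<nu> \<longrightarrow> L (\<omega>, z) = ennreal (\<Lambda> (fst z) \<omega>)"
proof -
  obtain W where W: "W \<in> borel_measurable bipred"
    and eq: "\<And>\<omega> z. good \<omega> \<Longrightarrow> z \<in> space \<nu> \<Longrightarrow> W (\<omega>, z) = (\<integral>\<^sup>+u. indicator {0<..<fst z} u * ker (fst z - u) \<partial>dH \<omega>)"
    using convolution_version[OF ker_meas] by metis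
  have "(\<lambda>p. ennreal \<mu> + W p) \<in> borel_measurable bipred" using W by measurable
  moreover have "ennreal \<mu> + W (\<omega>, z) = ennreal (\<Lambda> (fst z) \<omega>)" if "good \<omega>" "z \<in> space \<nu>" for \<omega> z
    using intensity(1)[OF that(1), of "fst z"] that by (simp add: eq space_strip mem_Times_iff)
  ultimately show ?thesis by (intro bexI[where x="\<lambda>p. ennreal \<mu> + W p"]) simp_all
qed

section \<open>Compensation of the jump measure by the intensity\<close>

lemma intensity_meas: "good \<omega> \<Longrightarrow> (\<lambda>s. indicator {0..T} s * ennreal (\<Lambda> s \<omega>)) \<in> borel_measurable borel"
proof -
  assume "good \<omega>"
  then have "(\<lambda>s. \<Lambda> s \<omega>) \<in> borel_measurable (restrict_space borel {0..T})" by (simp add: good_def)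
  then have "(\<lambda>s. ennreal (\<Lambda> s \<omega>)) \<in> borel_measurable (restrict_space borel {0..T})" by measurable
  then show ?thesis by (subst (asm) borel_measurable_restrict_space_iff_ennreal) (auto simp: mult.commute)
qed

text \<open>Integrating out the height below the graph of \<Lambda> leaves the factor
  \<Lambda>.\<close>

lemma nn_integral_strip_below:
  assumes good: "good \<omega>" and Y[measurable]: "Y \<in> borel_measurable borel"
  shows "(\<integral>\<^sup>+z. indicator (region \<omega>) z * Y (fst z) \<partial>\<nu>) =
    (\<integral>\<^sup>+s. indicator {0..T} s * (Y s * ennreal (\<Lambda> s \<omega>)) \<partial>lborel)"
proof -
  define L where "L s = indicator {0..T} s * ennreal (\<Lambda> s \<omega>)" for s
  have [measurable]: "L \<in> borel_measurable borel" unfolding L_def by (rule intensity_meas[OF good])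
  have "(\<integral>\<^sup>+z. indicator (region \<omega>) z * Y (fst z) \<partial>\<nu>) =
      (\<integral>\<^sup>+z. indicator (region \<omega>) z * Y (fst z) * indicator ({0..T} \<times> {0..}) z \<partial>lborel)"
    unfolding strip_intensity_def using strip_borel by (subst nn_integral_restrict_space) auto
  also have "\<dots> = (\<integral>\<^sup>+(s, \<theta>). indicator {0<..T} s * Y s * indicator {\<theta>. 0 \<le> \<theta> \<and> ennreal \<theta> \<le> L s} \<theta> \<partial>lborel)"
  proof (intro nn_integral_cong, safe)
    fix s \<theta> :: real
    have "\<theta> \<le> \<Lambda> s \<omega> \<longleftrightarrow> ennreal \<theta> \<le> ennreal (\<Lambda> s \<omega>)" if "s \<in> {0..T}" "0 \<le> \<theta>"
      using intensity(2)[OF good that(1)] \<mu> by (subst ennreal_le_iff) auto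
    then show "indicator (region \<omega>) (s, \<theta>) * Y (fst (s, \<theta>)) * indicator ({0..T} \<times> {0..}) (s, \<theta>) =
        indicator {0<..T} s * Y s * indicator {\<theta>. 0 \<le> \<theta> \<and> ennreal \<theta> \<le> L s} \<theta>"
      by (auto simp: indicator_def region_def space_strip L_def)
  qed
  also have "\<dots> = (\<integral>\<^sup>+s. \<integral>\<^sup>+\<theta>. indicator {0<..T} s * Y s * indicator {\<theta>. 0 \<le> \<theta> \<and> ennreal \<theta> \<le> L s} \<theta> \<partial>lborel \<partial>lborel)"
    unfolding lborel_prod[symmetric]
    by (subst lborel.nn_integral_fst[symmetric]) (auto simp: case_prod_unfold indicator_def cong: measurable_cong)
  also have "\<dots> = (\<integral>\<^sup>+s. indicator {0..T} s * (Y s * ennreal (\<Lambda> s \<omega>)) \<partial>lborel)"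
  proof (rule nn_integral_cong_AE)
    have inner: "(\<integral>\<^sup>+\<theta>. indicator {0<..T} s * Y s * indicator {\<theta>. 0 \<le> \<theta> \<and> ennreal \<theta> \<le> L s} \<theta> \<partial>lborel) =
       indicator {0..T} s * (Y s * ennreal (\<Lambda> s \<omega>))" if "s \<noteq> 0" for s
    proof (cases "s \<in> {0<..T}")
      case True
      then have pos: "0 \<le> \<Lambda> s \<omega>" using intensity(2)[OF good, of s] \<mu> by simp
      have "{\<theta>. 0 \<le> \<theta> \<and> ennreal \<theta> \<le> L s} = {0..\<Lambda> s \<omega>}"
        using True pos by (auto simp: L_def)
      then show ?thesis using True pos by (simp add: nn_integral_cmult_indicator)
    qed (use that in \<open>auto simp: indicator_def\<close>)
    \<comment> \<open>\<open>region\<close> excludes time 0 while the right-hand side integrates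
      over \<open>{0..T}\<close>.\<close>
    have "AE s in lborel. s \<noteq> (0::real)" by (rule AE_lborel_singleton)
    then show "AE s in lborel. (\<integral>\<^sup>+\<theta>. indicator {0<..T} s * Y s * indicator {\<theta>. 0 \<le> \<theta> \<and> ennreal \<theta> \<le> L s} \<theta> \<partial>lborel) =
       indicator {0..T} s * (Y s * ennreal (\<Lambda> s \<omega>))"
      by eventually_elim (rule inner)
  qed
  finally show ?thesis .
qed

text \<open>An integrand depending on time only can be read off along the height 0, which embeds the
  time interval measurably into the strip.\<close>

lemma bipred_path_borel:
  assumes Y: "(\<lambda>(\<omega>, z). Y \<omega> (fst z)) \<in> borel_measurable bipred" and \<omega>: "\<omega> \<in> space M"
  shows "(\<lambda>u. indicator {0..T} u * Y \<omega> u :: ennreal) \<in> borel_measurable borel"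
proof -
  have "(\<lambda>z. Y \<omega> (fst z)) \<in> borel_measurable \<nu>"
    using measurable_bipred_section[OF Y \<omega>] by simp
  moreover have "(\<lambda>u. (u, 0)) \<in> measurable (restrict_space borel {0..T}) \<nu>"
    unfolding strip_intensity_def
    by (intro measurable_restrict_space2 measurable_restrict_space1) (auto simp: space_restrict_space)
  ultimately have "(\<lambda>u. Y \<omega> (fst (u, 0::real))) \<in> borel_measurable (restrict_space borel {0..T})"
    by (rule measurable_compose[rotated])
  then show ?thesis by (subst (asm) borel_measurable_restrict_space_iff_ennreal) (auto simp: mult.commute)
qed

text \<open>\<open>Z\<close> is the integrand restricted to accepted points. With the measurable
  version of \<Lambda> it is a legitimate integrand for \<open>compensation\<close>, and its two
  integrals, against the noise and against the intensity measure, are the two sides needed for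
  \<open>dH\<close>.\<close>

lemma dH_integral_version:
  assumes Y: "(\<lambda>(\<omega>, z). Y \<omega> (fst z)) \<in> borel_measurable bipred"
  shows "\<exists>Z\<in>borel_measurable bipred. \<forall>\<omega>. good \<omega> \<longrightarrow>
    (\<integral>\<^sup>+u. Y \<omega> u \<partial>dH \<omega>) = (\<integral>\<^sup>+z. Z (\<omega>, z) \<partial>noise \<omega>) \<and>
    (\<integral>\<^sup>+u. indicator {0..T} u * (Y \<omega> u * ennreal (\<Lambda> u \<omega>)) \<partial>lborel) = (\<integral>\<^sup>+z. Z (\<omega>, z) \<partial>\<nu>)"
proof -
  obtain L where L[measurable]: "L \<in> borel_measurable bipred"
    and L_eq: "\<And>\<omega> z. good \<omega> \<Longrightarrow> z \<in> space \<nu> \<Longrightarrow> L (\<omega>, z) = ennreal (\<Lambda> (fst z) \<omega>)"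
    using intensity_version_ex by metis
  define Z where "Z p = (if 0 < fst (snd p) \<and> ennreal (snd (snd p)) \<le> L p then Y (fst p) (fst (snd p)) else 0)" for p
  have [measurable]: "(\<lambda>p. Y (fst p) (fst (snd p))) \<in> borel_measurable bipred"
    using Y by (simp add: case_prod_unfold)
  have Zm: "Z \<in> borel_measurable bipred" unfolding Z_def by measurable
  have Z: "Z (\<omega>, z) = indicator (region \<omega>) z * Y \<omega> (fst z)" if good: "good \<omega>" and z: "z \<in> space \<nu>" for \<omega> z
  proof -
    have z': "fst z \<in> {0..T}" "0 \<le> snd z" using z by (auto simp: space_strip mem_Times_iff)
    have "snd z \<le> \<Lambda> (fst z) \<omega> \<longleftrightarrow> ennreal (snd z) \<le> ennreal (\<Lambda> (fst z) \<omega>)"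
      using intensity(2)[OF good z'(1)] \<mu> z' by (subst ennreal_le_iff) auto
    then show ?thesis by (simp add: Z_def region_def L_eq[OF good z] z indicator_def)
  qed
  have "(\<integral>\<^sup>+u. Y \<omega> u \<partial>dH \<omega>) = (\<integral>\<^sup>+z. Z (\<omega>, z) \<partial>noise \<omega>) \<and>
    (\<integral>\<^sup>+u. indicator {0..T} u * (Y \<omega> u * ennreal (\<Lambda> u \<omega>)) \<partial>lborel) = (\<integral>\<^sup>+z. Z (\<omega>, z) \<partial>\<nu>)"
    if good: "good \<omega>" for \<omega>
  proof
    have Y': "(\<lambda>u. indicator {0..T} u * Y \<omega> u) \<in> borel_measurable borel"
      using good by (intro bipred_path_borel[OF Y]) (simp add: good_def)
    have "(\<integral>\<^sup>+u. Y \<omega> u \<partial>dH \<omega>) = (\<integral>\<^sup>+u. indicator {0..T} u * Y \<omega> u \<partial>dH \<omega>)"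
      by (intro nn_integral_cong_AE) (use AE_dH_range[OF good] in eventually_elim, simp)
    also have "\<dots> = (\<integral>\<^sup>+z. indicator (region \<omega>) z * (indicator {0..T} (fst z) * Y \<omega> (fst z)) \<partial>noise \<omega>)"
      by (rule nn_integral_dH[OF good Y'])
    also have "\<dots> = (\<integral>\<^sup>+z. Z (\<omega>, z) \<partial>noise \<omega>)"
      using good by (intro nn_integral_cong) (auto simp: space_noise good_def Z space_strip)
    finally show "(\<integral>\<^sup>+u. Y \<omega> u \<partial>dH \<omega>) = (\<integral>\<^sup>+z. Z (\<omega>, z) \<partial>noise \<omega>)" .
    have "(\<integral>\<^sup>+z. Z (\<omega>, z) \<partial>\<nu>) = (\<integral>\<^sup>+z. indicator (region \<omega>) z * (indicator {0..T} (fst z) * Y \<omega> (fst z)) \<partial>\<nu>)"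
      using good by (intro nn_integral_cong) (auto simp: Z space_strip)
    also have "\<dots> = (\<integral>\<^sup>+s. indicator {0..T} s * (indicator {0..T} s * Y \<omega> s * ennreal (\<Lambda> s \<omega>)) \<partial>lborel)"
      by (rule nn_integral_strip_below[OF good Y'])
    also have "\<dots> = (\<integral>\<^sup>+u. indicator {0..T} u * (Y \<omega> u * ennreal (\<Lambda> u \<omega>)) \<partial>lborel)"
      by (intro nn_integral_cong) (simp add: indicator_def)
    finally show "(\<integral>\<^sup>+u. indicator {0..T} u * (Y \<omega> u * ennreal (\<Lambda> u \<omega>)) \<partial>lborel) = (\<integral>\<^sup>+z. Z (\<omega>, z) \<partial>\<nu>)" ..
  qed
  with Zm show ?thesis by blast
qed

text \<open>The second claim supplies a measurable representative of the path integral: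
  \<open>dH\<close> is uncontrolled on exceptional paths, and additivity of the expectation later
  requires measurability.\<close>

lemma compensation_dH:
  assumes Y: "(\<lambda>(\<omega>, z). Y \<omega> (fst z)) \<in> borel_measurable bipred"
  shows "(\<integral>\<^sup>+\<omega>. \<integral>\<^sup>+u. Y \<omega> u \<partial>dH \<omega> \<partial>M) =
    (\<integral>\<^sup>+\<omega>. \<integral>\<^sup>+u. indicator {0..T} u * (Y \<omega> u * ennreal (\<Lambda> u \<omega>)) \<partial>lborel \<partial>M)"
    and "\<exists>G\<in>borel_measurable M. AE \<omega> in M. G \<omega> = (\<integral>\<^sup>+u. Y \<omega> u \<partial>dH \<omega>)"
proof -
  from dH_integral_version[OF Y] obtain Z where Z: "Z \<in> borel_measurable bipred"
    and eq: "\<forall>\<omega>. good \<omega> \<longrightarrow>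
    (\<integral>\<^sup>+u. Y \<omega> u \<partial>dH \<omega>) = (\<integral>\<^sup>+z. Z (\<omega>, z) \<partial>noise \<omega>) \<and>
    (\<integral>\<^sup>+u. indicator {0..T} u * (Y \<omega> u * ennreal (\<Lambda> u \<omega>)) \<partial>lborel) = (\<integral>\<^sup>+z. Z (\<omega>, z) \<partial>\<nu>)" ..
  have n: "(\<integral>\<^sup>+u. Y \<omega> u \<partial>dH \<omega>) = (\<integral>\<^sup>+z. Z (\<omega>, z) \<partial>noise \<omega>)" if "good \<omega>" for \<omega>
    using eq that by blast
  have v: "(\<integral>\<^sup>+u. indicator {0..T} u * (Y \<omega> u * ennreal (\<Lambda> u \<omega>)) \<partial>lborel) = (\<integral>\<^sup>+z. Z (\<omega>, z) \<partial>\<nu>)" if "good \<omega>" for \<omega>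
    using eq that by blast
  have "(\<integral>\<^sup>+\<omega>. \<integral>\<^sup>+u. Y \<omega> u \<partial>dH \<omega> \<partial>M) = (\<integral>\<^sup>+\<omega>. \<integral>\<^sup>+z. Z (\<omega>, z) \<partial>noise \<omega> \<partial>M)"
    by (intro nn_integral_cong_AE) (use AE_good in eventually_elim, rule n)
  also have "\<dots> = (\<integral>\<^sup>+\<omega>. \<integral>\<^sup>+z. Z (\<omega>, z) \<partial>\<nu> \<partial>M)"
    using compensation[OF Z] by blast
  also have "\<dots> = (\<integral>\<^sup>+\<omega>. \<integral>\<^sup>+u. indicator {0..T} u * (Y \<omega> u * ennreal (\<Lambda> u \<omega>)) \<partial>lborel \<partial>M)"
    by (intro nn_integral_cong_AE) (use AE_good in eventually_elim, rule v[symmetric])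
  finally show "(\<integral>\<^sup>+\<omega>. \<integral>\<^sup>+u. Y \<omega> u \<partial>dH \<omega> \<partial>M) =
    (\<integral>\<^sup>+\<omega>. \<integral>\<^sup>+u. indicator {0..T} u * (Y \<omega> u * ennreal (\<Lambda> u \<omega>)) \<partial>lborel \<partial>M)" .
  have "AE \<omega> in M. (\<integral>\<^sup>+z. Z (\<omega>, z) \<partial>noise \<omega>) = (\<integral>\<^sup>+u. Y \<omega> u \<partial>dH \<omega>)"
    using AE_good by eventually_elim (rule n[symmetric])
  then show "\<exists>G\<in>borel_measurable M. AE \<omega> in M. G \<omega> = (\<integral>\<^sup>+u. Y \<omega> u \<partial>dH \<omega>)"
    using compensation[OF Z] by (intro bexI[of _ "\<lambda>\<omega>. \<integral>\<^sup>+z. Z (\<omega>, z) \<partial>noise \<omega>"]) auto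
qed

end

section \<open>The recursive lower bound\<close>

context hawkes_model
begin

definition remaining :: "'w \<Rightarrow> real \<Rightarrow> ennreal" where
  "remaining \<omega> u = emeasure (N \<omega>) ({u<..T} \<times> {0..\<mu>})"

definition base :: "'w \<Rightarrow> ennreal" where
  "base \<omega> = emeasure (N \<omega>) ({0..T} \<times> {0..\<mu>})"

lemma measurable_base[measurable]: "base \<in> borel_measurable M"
  unfolding base_def[abs_def] by (intro measurable_N base_sets) auto

text \<open>Approximation from the right by rational times \<open>q\<close>: the count after
  \<open>q\<close> only looks at noise after \<open>q\<close>, so it may be used as a frozen
  variable at all times up to \<open>q\<close>. The -1 lets the half-open strip contain time
  0.\<close>

lemma remaining_SUP:
  assumes \<omega>: "\<omega> \<in> space M" and u: "u \<in> {0..T}"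
  shows "remaining \<omega> u = (SUP q\<in>\<rat> \<inter> {0..}. emeasure (N \<omega>) ({q<..T} \<times> {0..\<mu>}) * indicator {-1<..q} u)"
proof (rule antisym)
  have sets: "{q<..T} \<times> {0..\<mu>} \<in> sets (N \<omega>)" if "0 \<le> q" for q
    using that by (simp only: sets_N[OF \<omega>]) (intro base_sets, auto)
  define V where "V n = {u + 1 / real (Suc n)<..T} \<times> {0..\<mu>}" for n
  have V: "V n \<in> sets (N \<omega>)" for n unfolding V_def using u by (intro sets) simp
  have "incseq V"
  proof (rule incseq_SucI)
    have "1 / real (Suc (Suc n)) \<le> 1 / real (Suc n)" for n by (intro divide_left_mono) auto
    then have "{u + 1 / real (Suc n)<..T} \<subseteq> {u + 1 / real (Suc (Suc n))<..T}" for n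
      by (smt (verit) greaterThanAtMost_iff subsetI)
    then show "V n \<le> V (Suc n)" for n unfolding V_def by blast
  qed
  have "{u<..T} \<times> {0..\<mu>} = (\<Union>n. V n)"
  proof safe
    fix x y assume x: "x \<in> {u<..T}" "y \<in> {0..\<mu>}"
    then obtain n where "1 / real (Suc n) < x - u"
      by (metis diff_gt_0_iff_gt greaterThanAtMost_iff nat_approx_posE)
    with x have "(x, y) \<in> V n" by (simp add: V_def)
    then show "(x, y) \<in> (\<Union>n. V n)" by blast
  next
    fix x y n assume "(x, y) \<in> V n"
    moreover have "0 < 1 / real (Suc n)" by simp
    ultimately show "x \<in> {u<..T}" "y \<in> {0..\<mu>}"
      unfolding V_def mem_Sigma_iff greaterThanAtMost_iff by (linarith, blast)
  qed
  then have "remaining \<omega> u = (SUP n. emeasure (N \<omega>) (V n))"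
    unfolding remaining_def
  proof (simp only:, intro SUP_emeasure_incseq[symmetric])
    show "range V \<subseteq> sets (N \<omega>)" using V by blast
  qed (rule \<open>incseq V\<close>)
  also have "\<dots> \<le> (SUP q\<in>\<rat> \<inter> {0..}. emeasure (N \<omega>) ({q<..T} \<times> {0..\<mu>}) * indicator {-1<..q} u)"
  proof (rule SUP_least)
    fix n
    have "u < u + 1 / real (Suc n)" by simp
    then obtain q where q: "q \<in> \<rat>" "u < q" "q < u + 1 / real (Suc n)"
      using Rats_dense_in_real by blast
    have q': "q \<in> \<rat> \<inter> {0..}" "u \<in> {-1<..q}" using q u by auto
    have "V n \<subseteq> {q<..T} \<times> {0..\<mu>}" using q(3) unfolding V_def by fastforce
    then have "emeasure (N \<omega>) (V n) \<le> emeasure (N \<omega>) ({q<..T} \<times> {0..\<mu>})"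
      using q' by (intro emeasure_mono sets) auto
    also have "\<dots> = emeasure (N \<omega>) ({q<..T} \<times> {0..\<mu>}) * indicator {-1<..q} u"
      using q'(2) by simp
    also have "\<dots> \<le> (SUP q\<in>\<rat> \<inter> {0..}. emeasure (N \<omega>) ({q<..T} \<times> {0..\<mu>}) * indicator {-1<..q} u)"
      using q'(1) by (rule SUP_upper)
    finally show "emeasure (N \<omega>) (V n) \<le> (SUP q\<in>\<rat> \<inter> {0..}. emeasure (N \<omega>) ({q<..T} \<times> {0..\<mu>}) * indicator {-1<..q} u)" .
  qed
  finally show "remaining \<omega> u \<le> (SUP q\<in>\<rat> \<inter> {0..}. emeasure (N \<omega>) ({q<..T} \<times> {0..\<mu>}) * indicator {-1<..q} u)" .
  show "(SUP q\<in>\<rat> \<inter> {0..}. emeasure (N \<omega>) ({q<..T} \<times> {0..\<mu>}) * indicator {-1<..q} u) \<le> remaining \<omega> u"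
  proof (rule SUP_least)
    fix q :: real assume "q \<in> \<rat> \<inter> {0..}"
    show "emeasure (N \<omega>) ({q<..T} \<times> {0..\<mu>}) * indicator {-1<..q} u \<le> remaining \<omega> u"
    proof (cases "u \<le> q")
      case True
      then have "emeasure (N \<omega>) ({q<..T} \<times> {0..\<mu>}) \<le> remaining \<omega> u"
        unfolding remaining_def using u by (intro emeasure_mono sets) auto
      then show ?thesis by (simp add: indicator_def)
    qed simp
  qed
qed

lemma remaining_measurable: "(\<lambda>(\<omega>, z). remaining \<omega> (fst z)) \<in> borel_measurable bipred"
proof -
  have "(\<lambda>(\<omega>, z). emeasure (N \<omega>) ({q<..T} \<times> {0..\<mu>}) * indicator {-1<..q} (fst z)) \<in> borel_measurable bipred"
    if q: "q \<in> \<rat> \<inter> {0..}" for q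
  proof (rule bipred_frozen)
    fix c :: ennreal
    have A: "{q<..T} \<times> {0..\<mu>} \<in> sets \<nu>" using q by (intro base_sets) auto
    have "(\<lambda>\<omega>. emeasure (N \<omega>) ({q<..T} \<times> {0..\<mu>})) -` {c<..} \<inter> space M \<in> noise_in (space \<nu> - {-1<..q} \<times> UNIV)"
    proof (rule noise_in_gen[OF A])
      show "{q<..T} \<times> {0..\<mu>} \<subseteq> space \<nu> - {-1<..q} \<times> UNIV"
        using sets.sets_into_space[OF A] by auto
    qed simp
    then show "{\<omega>\<in>space M. c < emeasure (N \<omega>) ({q<..T} \<times> {0..\<mu>})} \<in> noise_in (space \<nu> - {-1<..q} \<times> UNIV)"
      by (simp add: vimage_def Int_def conj_commute)
  qed
  then have "(\<lambda>p. SUP q\<in>\<rat> \<inter> {0..}. (\<lambda>(\<omega>, z). emeasure (N \<omega>) ({q<..T} \<times> {0..\<mu>}) * indicator {-1<..q} (fst z)) p) \<in> borel_measurable bipred"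
    by (intro borel_measurable_SUP) (auto intro: countable_Int1 countable_rat)
  also have "?this \<longleftrightarrow> ?thesis"
    by (intro measurable_cong) (auto simp: remaining_SUP space_bipred space_strip)
  finally show ?thesis .
qed

text \<open>A point exactly at time \<open>t\<close> is counted neither in H before \<open>t\<close>
  nor in \<open>remaining\<close> after \<open>t\<close>; comparisons at \<open>t\<close> need its
  absence.\<close>

definition quiet :: "'w \<Rightarrow> real \<Rightarrow> bool" where
  "quiet \<omega> t \<longleftrightarrow> emeasure (N \<omega>) ({t} \<times> {0..\<mu>}) = 0"

text \<open>The segment above time 0 has zero area, so its expected count is 0. Time 0 needs its own
  statement because \<open>base\<close> counts it and H does not.\<close>

lemma AE_quiet_0: "AE \<omega> in M. quiet \<omega> 0"
proof -
  have A: "{0} \<times> {0..\<mu>} \<in> sets \<nu>" using T by (intro base_sets) auto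
  have "emeasure lborel ({0::real} \<times> {0..\<mu>}) = emeasure (lborel \<Otimes>\<^sub>M lborel) ({0::real} \<times> {0..\<mu>})"
    by (simp add: lborel_prod)
  also have "\<dots> = 0" by (subst lborel.emeasure_pair_measure_Times) auto
  finally have \<nu>0: "emeasure \<nu> ({0} \<times> {0..\<mu>}) = 0" by (simp add: emeasure_strip[OF A])
  have "(\<integral>\<^sup>+\<omega>. emeasure (N \<omega>) ({0} \<times> {0..\<mu>}) * indicator (space M) \<omega> \<partial>M) = 0"
    using nn_integral_noise_in[OF A _ _ space_noise_in[of "{}"]] \<nu>0 by simp
  then have "AE \<omega> in M. emeasure (N \<omega>) ({0} \<times> {0..\<mu>}) * indicator (space M) \<omega> = 0"
    using A by (subst (asm) nn_integral_0_iff_AE) auto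
  then show ?thesis using AE_space by eventually_elim (simp add: quiet_def)
qed

lemma base_finite: "good \<omega> \<Longrightarrow> base \<omega> < \<top>"
proof -
  assume good: "good \<omega>"
  obtain k where k: "\<mu> \<le> real k" using real_arch_simple by blast
  have "base \<omega> \<le> emeasure (N \<omega>) (slab k)"
    unfolding base_def using k good slab_sets[of k]
    by (intro emeasure_mono) (auto simp: slab_def good_def sets_N)
  also have "\<dots> < \<top>" using good by (simp add: good_def regular_def)
  finally show ?thesis .
qed

text \<open>The points below \<mu>, projected to time, form a finite measure, which has at most
  countably many atoms; countable sets are Lebesgue null.\<close>

lemma AE_quiet:
  assumes good: "good \<omega>"
  shows "AE t in lborel. t \<in> {0..T} \<longrightarrow> quiet \<omega> t"
proof -
  have \<omega>: "\<omega> \<in> space M" using good by (simp add: good_def)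
  define K where "K = distr (density (N \<omega>) (indicator ({0..T} \<times> {0..\<mu>}))) borel fst"
  have base: "{0..T} \<times> {0..\<mu>} \<in> sets \<nu>" by (intro base_sets) auto
  have K: "emeasure K A = emeasure (N \<omega>) ((A \<inter> {0..T}) \<times> {0..\<mu>})" if A: "A \<in> sets borel" for A
  proof -
    have f: "fst \<in> borel_measurable (N \<omega>)"
      using fst_strip by (simp add: measurable_cong_sets[OF sets_N[OF \<omega>] refl])
    have m: "fst -` A \<inter> space (N \<omega>) \<in> sets (N \<omega>)" using f A by (rule measurable_sets)
    have "emeasure K A = emeasure (density (N \<omega>) (indicator ({0..T} \<times> {0..\<mu>}))) (fst -` A \<inter> space (N \<omega>))"
      unfolding K_def using A f by (subst emeasure_distr) auto
    also have "\<dots> = (\<integral>\<^sup>+z. indicator ({0..T} \<times> {0..\<mu>}) z * indicator (fst -` A \<inter> space (N \<omega>)) z \<partial>N \<omega>)"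
      using m base by (subst emeasure_density) (auto simp: sets_N[OF \<omega>] intro!: borel_measurable_indicator)
    also have "\<dots> = (\<integral>\<^sup>+z. indicator ((A \<inter> {0..T}) \<times> {0..\<mu>}) z \<partial>N \<omega>)"
      by (intro nn_integral_cong) (auto simp: indicator_def)
    also have "\<dots> = emeasure (N \<omega>) ((A \<inter> {0..T}) \<times> {0..\<mu>})"
      using A by (intro nn_integral_indicator) (simp only: sets_N[OF \<omega>], intro base_sets, auto)
    finally show ?thesis .
  qed
  interpret finite_measure K
  proof
    have sp: "space K = UNIV" by (simp add: K_def)
    show "emeasure K (space K) \<noteq> \<infinity>"
      using base_finite[OF good] K[of UNIV] unfolding sp by (simp add: base_def)
  qed
  have "countable {x. measure K {x} \<noteq> 0}" by (rule countable_support)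
  then have "{x. measure K {x} \<noteq> 0} \<in> null_sets lborel" by (rule countable_imp_null_set_lborel)
  then have "AE x in lborel. x \<notin> {x. measure K {x} \<noteq> 0}" by (rule AE_not_in)
  then show ?thesis
  proof eventually_elim
    case (elim t)
    show ?case
    proof
      assume "t \<in> {0..T}"
      then have "{t} \<inter> {0..T} = {t}" by auto
      then show "quiet \<omega> t"
        using elim K[of "{t}"] by (simp add: quiet_def emeasure_eq_measure)
    qed
  qed
qed

section \<open>Pathwise comparison of counts\<close>

context
  fixes \<omega> assumes good: "good \<omega>"
begin

lemma N_base_split:
  assumes "A \<in> sets borel" "B \<in> sets borel" "A \<inter> B = {}" "A \<union> B \<subseteq> {0..T}"
  shows "emeasure (N \<omega>) ((A \<union> B) \<times> {0..\<mu>}) = emeasure (N \<omega>) (A \<times> {0..\<mu>}) + emeasure (N \<omega>) (B \<times> {0..\<mu>})"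
proof -
  have "A \<times> {0..\<mu>} \<in> sets \<nu>" "B \<times> {0..\<mu>} \<in> sets \<nu>" using assms by (auto intro: base_sets)
  moreover have "(A \<union> B) \<times> {0..\<mu>} = A \<times> {0..\<mu>} \<union> B \<times> {0..\<mu>}" by auto
  moreover have "A \<times> {0..\<mu>} \<inter> B \<times> {0..\<mu>} = {}" using assms(3) by auto
  ultimately show ?thesis
    using good by (simp only: good_def sets_N) (intro plus_emeasure[symmetric], auto simp: sets_N)
qed

lemma dH_split:
  assumes "A \<in> sets borel" "B \<in> sets borel" "A \<inter> B = {}"
  shows "emeasure (dH \<omega>) (A \<union> B) = emeasure (dH \<omega>) A + emeasure (dH \<omega>) B"
  using assms by (intro plus_emeasure[symmetric]) (simp_all only: sets_dH[OF good])

lemma base_le_dH':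
  "A \<in> sets borel \<Longrightarrow> A \<subseteq> {0<..T} \<Longrightarrow> emeasure (N \<omega>) (A \<times> {0..\<mu>}) \<le> emeasure (dH \<omega>) A"
  using base_le_dH[OF good] good_noise(1)[OF good] by simp

text \<open>Split \<open>{0<..T}\<close> at \<open>u\<close>: the atom contributes at least 1, and
  all points counted by \<open>remaining\<close> are accepted later.\<close>

lemma total_ge:
  assumes u: "u \<in> {0<..T}" and atom: "1 \<le> emeasure (dH \<omega>) {u}"
  shows "lagged 0 \<omega> u + remaining \<omega> u + 1 \<le> of_nat (H T \<omega>)"
proof -
  have "{0<..T} = {0<..<u} \<union> ({u} \<union> {u<..T})" using u by auto
  then have "of_nat (H T \<omega>) = emeasure (dH \<omega>) ({0<..<u} \<union> ({u} \<union> {u<..T}))"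
    using dH_Ioc[OF good, of T] T by simp
  also have "\<dots> = emeasure (dH \<omega>) {0<..<u} + (emeasure (dH \<omega>) {u} + emeasure (dH \<omega>) {u<..T})"
    by (subst dH_split; (subst dH_split)?) auto
  also have "\<dots> \<ge> lagged 0 \<omega> u + (1 + remaining \<omega> u)"
    unfolding remaining_def using u atom
    by (intro add_mono base_le_dH') (auto simp: lagged_eq[OF good])
  finally show ?thesis by (simp add: ac_simps)
qed

text \<open>Moving from \<open>u\<close> to \<open>t\<close> gains the atom at \<open>u\<close>. The
  points below \<mu> strictly between the two times leave \<open>remaining\<close> but enter H, and
  by \<open>quiet\<close> none is lost at \<open>t\<close>.\<close>

lemma later_ge:
  assumes u: "0 < u" "u < t" "t \<le> T" and atom: "1 \<le> emeasure (dH \<omega>) {u}" and quiet: "quiet \<omega> t"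
  shows "lagged 0 \<omega> u + remaining \<omega> u + 1 \<le> lagged 0 \<omega> t + remaining \<omega> t"
proof -
  have "{0<..<t} = {0<..<u} \<union> ({u} \<union> {u<..<t})" using u by auto
  then have "lagged 0 \<omega> t = emeasure (dH \<omega>) ({0<..<u} \<union> ({u} \<union> {u<..<t}))"
    using u by (simp add: lagged_eq[OF good])
  also have "\<dots> = emeasure (dH \<omega>) {0<..<u} + (emeasure (dH \<omega>) {u} + emeasure (dH \<omega>) {u<..<t})"
    by (subst dH_split; (subst dH_split)?) auto
  also have "\<dots> \<ge> lagged 0 \<omega> u + (1 + emeasure (N \<omega>) ({u<..<t} \<times> {0..\<mu>}))"
    using u atom by (intro add_mono base_le_dH') (auto simp: lagged_eq[OF good])
  finally have 1: "lagged 0 \<omega> u + (1 + emeasure (N \<omega>) ({u<..<t} \<times> {0..\<mu>})) \<le> lagged 0 \<omega> t" .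
  have "{u<..T} = {u<..<t} \<union> ({t} \<union> {t<..T})" using u by auto
  then have "remaining \<omega> u = emeasure (N \<omega>) (({u<..<t} \<union> ({t} \<union> {t<..T})) \<times> {0..\<mu>})"
    by (simp add: remaining_def)
  also have "\<dots> = emeasure (N \<omega>) ({u<..<t} \<times> {0..\<mu>}) + (emeasure (N \<omega>) ({t} \<times> {0..\<mu>}) + remaining \<omega> t)"
    unfolding remaining_def using u by (subst N_base_split; (subst N_base_split)?) auto
  finally have "remaining \<omega> u = emeasure (N \<omega>) ({u<..<t} \<times> {0..\<mu>}) + remaining \<omega> t"
    using quiet by (simp add: quiet_def)
  then have "lagged 0 \<omega> u + remaining \<omega> u + 1 = lagged 0 \<omega> u + (1 + emeasure (N \<omega>) ({u<..<t} \<times> {0..\<mu>})) + remaining \<omega> t"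
    by (simp add: ac_simps)
  also have "\<dots> \<le> lagged 0 \<omega> t + remaining \<omega> t" using 1 by (rule add_right_mono)
  finally show ?thesis .
qed

text \<open>Points below \<mu> before \<open>t\<close> have been accepted by H, those after
  \<open>t\<close> are still in \<open>remaining\<close>; the two quiet times are the only ones
  counted in neither.\<close>

lemma base_le:
  assumes t: "t \<in> {0..T}" and quiet: "quiet \<omega> 0" "quiet \<omega> t"
  shows "base \<omega> \<le> lagged 0 \<omega> t + remaining \<omega> t"
proof (cases "t = 0")
  case True
  have "{0..T} = {0} \<union> {0<..T}" using T by auto
  then have "base \<omega> = emeasure (N \<omega>) (({0} \<union> {0<..T}) \<times> {0..\<mu>})" by (simp add: base_def)
  also have "\<dots> = emeasure (N \<omega>) ({0} \<times> {0..\<mu>}) + emeasure (N \<omega>) ({0<..T} \<times> {0..\<mu>})"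
    using T by (intro N_base_split) auto
  finally show ?thesis using quiet True by (simp add: quiet_def remaining_def)
next
  case False
  have "{0..T} = {0} \<union> ({0<..<t} \<union> ({t} \<union> {t<..T}))" using t False by auto
  then have "base \<omega> = emeasure (N \<omega>) (({0} \<union> ({0<..<t} \<union> ({t} \<union> {t<..T}))) \<times> {0..\<mu>})" by (simp add: base_def)
  also have "\<dots> = emeasure (N \<omega>) ({0} \<times> {0..\<mu>}) + (emeasure (N \<omega>) ({0<..<t} \<times> {0..\<mu>}) +
      (emeasure (N \<omega>) ({t} \<times> {0..\<mu>}) + emeasure (N \<omega>) ({t<..T} \<times> {0..\<mu>})))"
    using t False by (subst N_base_split; (subst N_base_split; (subst N_base_split)?)?) auto
  also have "\<dots> = emeasure (N \<omega>) ({0<..<t} \<times> {0..\<mu>}) + remaining \<omega> t"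
    using quiet by (simp add: quiet_def remaining_def)
  also have "\<dots> \<le> lagged 0 \<omega> t + remaining \<omega> t"
    using t by (intro add_right_mono) (auto simp: lagged_eq[OF good] intro!: base_le_dH')
  finally show ?thesis .
qed

end

text \<open>The total weight, under \<open>\<phi>\<close>, of the expected direct descendants of a
  jump at \<open>u\<close>. As an operator it is the adjoint of convolution with \<Phi>.\<close>

definition offspring :: "(real \<Rightarrow> ennreal) \<Rightarrow> real \<Rightarrow> ennreal" where
  "offspring \<phi> u = (\<integral>\<^sup>+t. indicator {u<..T} t * (\<phi> t * ker (t - u)) \<partial>lborel)"

lemma offspring_measurable[measurable]:
  assumes [measurable]: "\<phi> \<in> borel_measurable borel"
  shows "offspring \<phi> \<in> borel_measurable borel"
proof -
  have "(\<lambda>u. \<integral>\<^sup>+t. (if u < t \<and> t \<le> T then 1 else 0) * (\<phi> t * ker (t - u)) \<partial>lborel) \<in> borel_measurable borel"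
    by measurable
  also have "(\<lambda>u. \<integral>\<^sup>+t. (if u < t \<and> t \<le> T then 1 else 0) * (\<phi> t * ker (t - u)) \<partial>lborel) = offspring \<phi>"
    unfolding offspring_def by (intro ext nn_integral_cong) (simp add: indicator_def)
  finally show ?thesis .
qed

lemma kernel_measurable:
  assumes good: "good \<omega>" and G[measurable]: "G \<in> borel_measurable borel"
  shows "(\<lambda>t. \<integral>\<^sup>+u. indicator {0<..<t} u * (ker (t - u) * G u) \<partial>dH \<omega>) \<in> borel_measurable borel"
proof -
  interpret K: finite_borel_measure "dH \<omega>" by (rule finite_borel_dH[OF good])
  note [measurable_cong] = sets_dH[OF good]
  have "(\<lambda>t. \<integral>\<^sup>+u. (if 0 < u \<and> u < t then ker (t - u) * G u else 0) \<partial>dH \<omega>) \<in> borel_measurable borel"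
    by measurable
  also have "(\<lambda>t. \<integral>\<^sup>+u. (if 0 < u \<and> u < t then ker (t - u) * G u else 0) \<partial>dH \<omega>) =
      (\<lambda>t. \<integral>\<^sup>+u. indicator {0<..<t} u * (ker (t - u) * G u) \<partial>dH \<omega>)"
    by (intro ext nn_integral_cong) (simp add: indicator_def)
  finally show ?thesis .
qed

text \<open>Exchanging the order of integration turns the self-exciting part of the intensity,
  integrated in time with weight \<open>\<phi>\<close>, into an integral against \<open>dH\<close>
  with weight \<open>offspring \<phi>\<close>.\<close>

lemma kernel_swap:
  assumes good: "good \<omega>" and G[measurable]: "G \<in> borel_measurable borel" and \<phi>[measurable]: "\<phi> \<in> borel_measurable borel"
  shows "(\<integral>\<^sup>+t. indicator {0..T} t * (\<phi> t * (\<integral>\<^sup>+u. indicator {0<..<t} u * (ker (t - u) * G u) \<partial>dH \<omega>)) \<partial>lborel) =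
    (\<integral>\<^sup>+u. offspring \<phi> u * G u \<partial>dH \<omega>)"
proof -
  interpret K: finite_borel_measure "dH \<omega>" by (rule finite_borel_dH[OF good])
  interpret pair_sigma_finite lborel "dH \<omega>" ..
  note [measurable_cong] = sets_dH[OF good]
  have "(\<integral>\<^sup>+t. indicator {0..T} t * (\<phi> t * (\<integral>\<^sup>+u. indicator {0<..<t} u * (ker (t - u) * G u) \<partial>dH \<omega>)) \<partial>lborel) =
    (\<integral>\<^sup>+t. \<integral>\<^sup>+u. (if 0 < u \<and> u < t \<and> t \<le> T then \<phi> t * ker (t - u) * G u else 0) \<partial>dH \<omega> \<partial>lborel)"
  proof (rule nn_integral_cong)
    fix t :: real
    have "indicator {0..T} t * (\<phi> t * (\<integral>\<^sup>+u. indicator {0<..<t} u * (ker (t - u) * G u) \<partial>dH \<omega>)) =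
      (\<integral>\<^sup>+u. indicator {0..T} t * (\<phi> t * (indicator {0<..<t} u * (ker (t - u) * G u))) \<partial>dH \<omega>)"
      by (simp add: nn_integral_cmult)
    also have "\<dots> = (\<integral>\<^sup>+u. (if 0 < u \<and> u < t \<and> t \<le> T then \<phi> t * ker (t - u) * G u else 0) \<partial>dH \<omega>)"
      by (intro nn_integral_cong) (auto simp: indicator_def ac_simps)
    finally show "indicator {0..T} t * (\<phi> t * (\<integral>\<^sup>+u. indicator {0<..<t} u * (ker (t - u) * G u) \<partial>dH \<omega>)) =
      (\<integral>\<^sup>+u. (if 0 < u \<and> u < t \<and> t \<le> T then \<phi> t * ker (t - u) * G u else 0) \<partial>dH \<omega>)" .
  qed
  also have "\<dots> = (\<integral>\<^sup>+u. \<integral>\<^sup>+t. (if 0 < u \<and> u < t \<and> t \<le> T then \<phi> t * ker (t - u) * G u else 0) \<partial>lborel \<partial>dH \<omega>)"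
    by (rule Fubini'[symmetric]) measurable
  also have "\<dots> = (\<integral>\<^sup>+u. offspring \<phi> u * G u \<partial>dH \<omega>)"
  proof (rule nn_integral_cong_AE, use AE_dH_range[OF good] in eventually_elim)
    case (elim u)
    have "(\<integral>\<^sup>+t. (if 0 < u \<and> u < t \<and> t \<le> T then \<phi> t * ker (t - u) * G u else 0) \<partial>lborel) =
      (\<integral>\<^sup>+t. indicator {u<..T} t * (\<phi> t * ker (t - u)) * G u \<partial>lborel)"
      using elim by (intro nn_integral_cong) (auto simp: indicator_def)
    also have "\<dots> = offspring \<phi> u * G u"
      unfolding offspring_def by (simp add: nn_integral_multc)
    finally show ?case .
  qed
  finally show ?thesis .
qed

text \<open>The offset \<open>Suc n\<close> is one for the jump at \<open>u\<close> and
  \<open>n\<close> for the jumps gained in previous steps of the recursion.\<close>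

definition bound_integrand :: "(ennreal \<Rightarrow> ennreal) \<Rightarrow> (real \<Rightarrow> ennreal) \<Rightarrow> nat \<Rightarrow> 'w \<Rightarrow> real \<Rightarrow> ennreal" where
  "bound_integrand \<alpha> \<phi> n \<omega> u = \<phi> u * \<alpha> (lagged 0 \<omega> u + remaining \<omega> u + of_nat (Suc n))"

lemma bound_integrand_measurable:
  assumes [measurable]: "\<alpha> \<in> borel_measurable borel" "\<phi> \<in> borel_measurable borel"
  shows "(\<lambda>(\<omega>, z). bound_integrand \<alpha> \<phi> n \<omega> (fst z)) \<in> borel_measurable bipred"
proof -
  have [measurable]: "(\<lambda>p. lagged 0 (fst p) (fst (snd p))) \<in> borel_measurable bipred"
    "(\<lambda>p. remaining (fst p) (fst (snd p))) \<in> borel_measurable bipred"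
    using lagged_measurable[of 0] remaining_measurable by (simp_all add: case_prod_unfold)
  show ?thesis unfolding bound_integrand_def case_prod_unfold by measurable
qed

text \<open>The right-hand side is split along the intensity equation. In the part with \<mu>, the
  time-dependent count is lowered to \<open>base\<close>, which does not depend on \<open>t\<close>,
  so the time integral factors out. In the self-exciting part, \<open>later_ge\<close> trades the
  count at \<open>t\<close> for the count at the parent jump \<open>u\<close> plus one.\<close>

lemma step_pathwise:
  assumes good: "good \<omega>" and quiet: "quiet \<omega> 0"
    and \<alpha>: "mono \<alpha>" and \<alpha>_meas[measurable]: "\<alpha> \<in> borel_measurable borel"
    and \<phi>[measurable]: "\<phi> \<in> borel_measurable borel"
  shows "ennreal \<mu> * (\<integral>\<^sup>+t. indicator {0..T} t * \<phi> t \<partial>lborel) * \<alpha> (base \<omega> + of_nat (Suc n)) +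
      (\<integral>\<^sup>+u. bound_integrand \<alpha> (offspring \<phi>) (Suc n) \<omega> u \<partial>dH \<omega>)
    \<le> (\<integral>\<^sup>+t. indicator {0..T} t * (bound_integrand \<alpha> \<phi> n \<omega> t * ennreal (\<Lambda> t \<omega>)) \<partial>lborel)"
proof -
  interpret K: finite_borel_measure "dH \<omega>" by (rule finite_borel_dH[OF good])
  note [measurable_cong] = sets_dH[OF good]
  have \<omega>: "\<omega> \<in> space M" using good by (simp add: good_def)
  \<comment> \<open>The cut-off to \<open>{0..T}\<close> makes the path Borel on the whole line and
    changes nothing under \<open>dH\<close>.\<close>
  define G where "G u = indicator {0..T} u * \<alpha> (lagged 0 \<omega> u + remaining \<omega> u + of_nat (Suc (Suc n)))" for u
  have G[measurable]: "G \<in> borel_measurable borel"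
    using bipred_path_borel[OF bound_integrand_measurable[OF \<alpha>_meas, of "\<lambda>_. 1" "Suc n"] \<omega>]
    by (simp add: bound_integrand_def G_def[abs_def])
  have "(\<integral>\<^sup>+u. bound_integrand \<alpha> (offspring \<phi>) (Suc n) \<omega> u \<partial>dH \<omega>) = (\<integral>\<^sup>+u. offspring \<phi> u * G u \<partial>dH \<omega>)"
    by (intro nn_integral_cong_AE)
      (use AE_dH_range[OF good] in eventually_elim, simp add: bound_integrand_def G_def)
  also have "\<dots> = (\<integral>\<^sup>+t. indicator {0..T} t * (\<phi> t * (\<integral>\<^sup>+u. indicator {0<..<t} u * (ker (t - u) * G u) \<partial>dH \<omega>)) \<partial>lborel)"
    by (rule kernel_swap[OF good G \<phi>, symmetric])
  finally have swap: "(\<integral>\<^sup>+u. bound_integrand \<alpha> (offspring \<phi>) (Suc n) \<omega> u \<partial>dH \<omega>) =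
      (\<integral>\<^sup>+t. indicator {0..T} t * (\<phi> t * (\<integral>\<^sup>+u. indicator {0<..<t} u * (ker (t - u) * G u) \<partial>dH \<omega>)) \<partial>lborel)" .
  note [measurable] = kernel_measurable[OF good G]
  have meas: "(\<lambda>t. indicator {0..T} t * (\<phi> t * (\<integral>\<^sup>+u. indicator {0<..<t} u * (ker (t - u) * G u) \<partial>dH \<omega>))) \<in> borel_measurable borel"
    by measurable
  have "ennreal \<mu> * (\<integral>\<^sup>+t. indicator {0..T} t * \<phi> t \<partial>lborel) * \<alpha> (base \<omega> + of_nat (Suc n)) +
      (\<integral>\<^sup>+u. bound_integrand \<alpha> (offspring \<phi>) (Suc n) \<omega> u \<partial>dH \<omega>) =
    (\<integral>\<^sup>+t. ennreal \<mu> * (indicator {0..T} t * \<phi> t) * \<alpha> (base \<omega> + of_nat (Suc n)) +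
      indicator {0..T} t * (\<phi> t * (\<integral>\<^sup>+u. indicator {0<..<t} u * (ker (t - u) * G u) \<partial>dH \<omega>)) \<partial>lborel)"
    unfolding swap using meas by (simp add: nn_integral_add nn_integral_cmult nn_integral_multc)
  also have "\<dots> \<le> (\<integral>\<^sup>+t. indicator {0..T} t * (bound_integrand \<alpha> \<phi> n \<omega> t * ennreal (\<Lambda> t \<omega>)) \<partial>lborel)"
  proof (rule nn_integral_mono_AE, use AE_quiet[OF good] in eventually_elim)
    case (elim t)
    show ?case
    proof (cases "t \<in> {0..T}")
      case True
      with elim have qt: "quiet \<omega> t" by simp
      let ?a = "\<alpha> (lagged 0 \<omega> t + remaining \<omega> t + of_nat (Suc n))"
      have 1: "\<alpha> (base \<omega> + of_nat (Suc n)) \<le> ?a"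
        by (intro monoD[OF \<alpha>] add_right_mono base_le[OF good True quiet qt])
      have 2: "(\<integral>\<^sup>+u. indicator {0<..<t} u * (ker (t - u) * G u) \<partial>dH \<omega>) \<le>
          (\<integral>\<^sup>+u. ?a * (indicator {0<..<t} u * ker (t - u)) \<partial>dH \<omega>)"
      \<comment> \<open>The gain of one point is available only where \<open>dH\<close> has an atom
        of mass at least 1, which is almost everywhere for \<open>dH\<close>.\<close>
      proof (rule nn_integral_mono_AE, use AE_dH_atom[OF good] in eventually_elim)
        case (elim u)
        show ?case
        proof (cases "u \<in> {0<..<t}")
          case u: True
          have "lagged 0 \<omega> u + remaining \<omega> u + 1 \<le> lagged 0 \<omega> t + remaining \<omega> t"
            using u True elim qt by (intro later_ge[OF good]) auto
          then have "lagged 0 \<omega> u + remaining \<omega> u + 1 + of_nat (Suc n) \<le> lagged 0 \<omega> t + remaining \<omega> t + of_nat (Suc n)"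
            by (rule add_right_mono)
          then have "lagged 0 \<omega> u + remaining \<omega> u + of_nat (Suc (Suc n)) \<le> lagged 0 \<omega> t + remaining \<omega> t + of_nat (Suc n)"
            by (simp add: add.assoc)
          then have "G u \<le> ?a"
            using u True by (auto simp: G_def intro: monoD[OF \<alpha>])
          then have "ker (t - u) * G u \<le> ker (t - u) * ?a" by (rule mult_left_mono) simp
          then show ?thesis using u by (simp add: mult.commute)
        qed simp
      qed
      also have "\<dots> = ?a * (\<integral>\<^sup>+u. indicator {0<..<t} u * ker (t - u) \<partial>dH \<omega>)"
        by (intro nn_integral_cmult) measurable
      finally have "ennreal \<mu> * \<phi> t * \<alpha> (base \<omega> + of_nat (Suc n)) + \<phi> t * (\<integral>\<^sup>+u. indicator {0<..<t} u * (ker (t - u) * G u) \<partial>dH \<omega>)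
        \<le> ennreal \<mu> * \<phi> t * ?a + \<phi> t * (?a * (\<integral>\<^sup>+u. indicator {0<..<t} u * ker (t - u) \<partial>dH \<omega>))"
        using 1 by (intro add_mono mult_left_mono) auto
      also have "\<dots> = \<phi> t * ?a * (ennreal \<mu> + (\<integral>\<^sup>+u. indicator {0<..<t} u * ker (t - u) \<partial>dH \<omega>))"
        by (simp only: distrib_left mult.assoc mult.left_commute mult.commute)
      also have "\<dots> = bound_integrand \<alpha> \<phi> n \<omega> t * ennreal (\<Lambda> t \<omega>)"
        using intensity(1)[OF good True] by (simp only: bound_integrand_def)
      finally show ?thesis using True by simp
    qed simp
  qed
  finally show ?thesis .
qed

text \<open>Expectation of \<open>step_pathwise\<close>: compensation first replaces
  \<open>dH\<close> by the intensity, and the self-exciting part comes back as an integral against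
  \<open>dH\<close>, so the estimate can be applied again.\<close>

lemma step:
  assumes \<alpha>: "mono \<alpha>" and \<alpha>_meas[measurable]: "\<alpha> \<in> borel_measurable borel"
    and \<phi>[measurable]: "\<phi> \<in> borel_measurable borel"
  shows "ennreal \<mu> * (\<integral>\<^sup>+t. indicator {0..T} t * \<phi> t \<partial>lborel) * (\<integral>\<^sup>+\<omega>. \<alpha> (base \<omega> + of_nat (Suc n)) \<partial>M) +
      (\<integral>\<^sup>+\<omega>. \<integral>\<^sup>+u. bound_integrand \<alpha> (offspring \<phi>) (Suc n) \<omega> u \<partial>dH \<omega> \<partial>M)
    \<le> (\<integral>\<^sup>+\<omega>. \<integral>\<^sup>+u. bound_integrand \<alpha> \<phi> n \<omega> u \<partial>dH \<omega> \<partial>M)"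
proof -
  obtain G where G[measurable]: "G \<in> borel_measurable M"
    and G_eq: "AE \<omega> in M. G \<omega> = (\<integral>\<^sup>+u. bound_integrand \<alpha> (offspring \<phi>) (Suc n) \<omega> u \<partial>dH \<omega>)"
    using compensation_dH(2)[OF bound_integrand_measurable[OF \<alpha>_meas offspring_measurable[OF \<phi>]]] by blast
  let ?c = "ennreal \<mu> * (\<integral>\<^sup>+t. indicator {0..T} t * \<phi> t \<partial>lborel)"
  have "?c * (\<integral>\<^sup>+\<omega>. \<alpha> (base \<omega> + of_nat (Suc n)) \<partial>M) + (\<integral>\<^sup>+\<omega>. \<integral>\<^sup>+u. bound_integrand \<alpha> (offspring \<phi>) (Suc n) \<omega> u \<partial>dH \<omega> \<partial>M) =
      ?c * (\<integral>\<^sup>+\<omega>. \<alpha> (base \<omega> + of_nat (Suc n)) \<partial>M) + (\<integral>\<^sup>+\<omega>. G \<omega> \<partial>M)"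
    by (intro arg_cong2[where f="(+)"] refl nn_integral_cong_AE) (use G_eq in eventually_elim, simp)
  also have "\<dots> = (\<integral>\<^sup>+\<omega>. ?c * \<alpha> (base \<omega> + of_nat (Suc n)) + G \<omega> \<partial>M)"
    by (simp add: nn_integral_add nn_integral_cmult)
  also have "\<dots> \<le> (\<integral>\<^sup>+\<omega>. \<integral>\<^sup>+t. indicator {0..T} t * (bound_integrand \<alpha> \<phi> n \<omega> t * ennreal (\<Lambda> t \<omega>)) \<partial>lborel \<partial>M)"
  proof (rule nn_integral_mono_AE, use AE_good AE_quiet_0 G_eq in eventually_elim)
    case (elim \<omega>)
    show ?case
      using step_pathwise[OF elim(1,2) \<alpha> \<alpha>_meas \<phi>, of n] unfolding elim(3) .
  qed
  also have "\<dots> = (\<integral>\<^sup>+\<omega>. \<integral>\<^sup>+u. bound_integrand \<alpha> \<phi> n \<omega> u \<partial>dH \<omega> \<partial>M)"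
    by (rule compensation_dH(1)[OF bound_integrand_measurable[OF \<alpha>_meas \<phi>], symmetric])
  finally show ?thesis .
qed

section \<open>Iteration of the one-step bound\<close>

fun generation :: "nat \<Rightarrow> real \<Rightarrow> ennreal" where
  "generation 0 = (\<lambda>_. 1)"
| "generation (Suc n) = offspring (generation n)"

lemma generation_measurable[measurable]: "generation n \<in> borel_measurable borel"
  by (induction n) auto

text \<open>This is the simplex integral with \<open>n + 1\<close> time variables, see
  \<open>m_Phi_eq\<close>.\<close>

definition mass :: "nat \<Rightarrow> ennreal" where
  "mass n = (\<integral>\<^sup>+t. indicator {0..T} t * generation n t \<partial>lborel)"

lemma measurable_H_T[measurable]: "H T \<in> measurable M (count_space UNIV)"
proof (rule measurable_count_space_eq2_countable[THEN iffD2])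
  have "{\<omega>\<in>space M. H T \<omega> = k} \<in> events" for k
    using H_noise_in[of T "\<lambda>j. j = k"] T noise_in_events by auto
  then show "H T \<in> space M \<rightarrow> UNIV \<and> (\<forall>k\<in>UNIV. H T -` {k} \<inter> space M \<in> events)"
    by (simp add: vimage_def Int_def conj_commute)
qed

text \<open>Iterating \<open>step\<close> peels off one term of the series each time; the remainder
  \<open>?D k\<close> is nonnegative and is discarded. The starting value \<open>?D 0\<close> is
  compared with H_T by \<open>total_ge\<close> at the atoms of \<open>dH\<close>.\<close>

theorem lower_bound:
  assumes \<alpha>: "mono \<alpha>" and \<alpha>_meas[measurable]: "\<alpha> \<in> borel_measurable borel"
  shows "(\<Sum>n. ennreal \<mu> * mass n * (\<integral>\<^sup>+\<omega>. \<alpha> (base \<omega> + of_nat (Suc n)) \<partial>M))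
    \<le> (\<integral>\<^sup>+\<omega>. of_nat (H T \<omega>) * \<alpha> (of_nat (H T \<omega>)) \<partial>M)"
proof -
  let ?s = "\<lambda>n. ennreal \<mu> * mass n * (\<integral>\<^sup>+\<omega>. \<alpha> (base \<omega> + of_nat (Suc n)) \<partial>M)"
  let ?D = "\<lambda>n. (\<integral>\<^sup>+\<omega>. \<integral>\<^sup>+u. bound_integrand \<alpha> (generation n) n \<omega> u \<partial>dH \<omega> \<partial>M)"
  have main: "(\<Sum>n<k. ?s n) + ?D k \<le> ?D 0" for k
  proof (induction k)
    case (Suc k)
    have "(\<Sum>n<Suc k. ?s n) + ?D (Suc k) = (\<Sum>n<k. ?s n) + (?s k + ?D (Suc k))"
      by (simp add: add.assoc)
    also have "\<dots> \<le> (\<Sum>n<k. ?s n) + ?D k"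
      using step[OF \<alpha> \<alpha>_meas generation_measurable, of k k]
      by (intro add_left_mono) (simp add: mass_def)
    also note Suc
    finally show ?case .
  qed simp
  have "(\<Sum>n<k. ?s n) \<le> ?D 0" for k
    by (rule order_trans[OF _ main[of k]]) simp
  then have "(\<Sum>n. ?s n) \<le> ?D 0" by (intro suminf_le_const) auto
  also have "\<dots> \<le> (\<integral>\<^sup>+\<omega>. of_nat (H T \<omega>) * \<alpha> (of_nat (H T \<omega>)) \<partial>M)"
  proof (rule nn_integral_mono_AE, use AE_good in eventually_elim)
    case (elim \<omega>)
    have "(\<integral>\<^sup>+u. bound_integrand \<alpha> (generation 0) 0 \<omega> u \<partial>dH \<omega>) \<le> (\<integral>\<^sup>+u. \<alpha> (of_nat (H T \<omega>)) \<partial>dH \<omega>)"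
    proof (rule nn_integral_mono_AE, use AE_dH_atom[OF elim] AE_dH_range[OF elim] in eventually_elim)
      case (elim u)
      then show ?case
        using total_ge[OF \<open>good \<omega>\<close> elim(2,1)] by (auto simp: bound_integrand_def intro: monoD[OF \<alpha>])
    qed
    also have "\<dots> = of_nat (H T \<omega>) * \<alpha> (of_nat (H T \<omega>))"
      by (simp add: dH_UNIV[OF elim] space_dH[OF elim] mult.commute)
    finally show ?case .
  qed
  finally show ?thesis .
qed

subsection \<open>Finiteness of the mean\<close>

definition ker_norm :: real where "ker_norm = (LBINT s:{0..T}. \<Phi> s)"

lemma ker_integral: "(\<integral>\<^sup>+t. ker t \<partial>lborel) = ennreal ker_norm" and ker_norm_nonneg: "0 \<le> ker_norm"
proof -
  obtain B where B: "\<And>t. t \<in> {0..T} \<Longrightarrow> \<Phi> t \<le> B" using ker_bounded by blast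
  have nn: "0 \<le> indicator {0..T} t * \<Phi> t" for t using \<Phi>_nonneg by (auto simp: indicator_def)
  have "integrable lborel (\<lambda>t. indicator {0..T} t *\<^sub>R (\<lambda>t. indicator {0..T} t * \<Phi> t) t)"
  proof (rule integrableI_bounded_set_indicator[where B=B])
    show "(\<lambda>t. indicator {0..T} t * \<Phi> t) \<in> borel_measurable lborel" using ker_real_meas by simp
    show "AE x in lborel. x \<in> {0..T} \<longrightarrow> norm (indicator {0..T} x * \<Phi> x) \<le> B"
      using \<Phi>_nonneg B by auto
  qed (use T in auto)
  then have int: "integrable lborel (\<lambda>t. indicator {0..T} t * \<Phi> t)"
    by (rule Bochner_Integration.integrable_cong[THEN iffD1, rotated 2]) (auto simp: indicator_def)
  show "(\<integral>\<^sup>+t. ker t \<partial>lborel) = ennreal ker_norm"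
    unfolding ker_def ker_norm_def set_lebesgue_integral_def real_scaleR_def
    using nn by (intro nn_integral_eq_integral int) auto
  show "0 \<le> ker_norm"
    unfolding ker_norm_def set_lebesgue_integral_def real_scaleR_def
    by (rule integral_nonneg_AE) (use nn in auto)
qed

lemma ker_norm_less_1: "ker_norm < 1"
  using \<Phi>_subcritical by (simp add: ker_norm_def)

lemma offspring_one_le: "offspring (\<lambda>_. 1) u \<le> ennreal ker_norm"
proof -
  have "offspring (\<lambda>_. 1) u \<le> (\<integral>\<^sup>+t. ker (t - u) \<partial>lborel)"
    unfolding offspring_def by (intro nn_integral_mono) (simp add: indicator_def)
  also have "\<dots> = (\<integral>\<^sup>+t. ker t \<partial>lborel)"
    using nn_integral_real_affine[of ker 1 "-u"] by simp
  finally show ?thesis by (simp add: ker_integral)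
qed

text \<open>The mean satisfies m \<le> T \<mu> + \<open>ker_norm\<close> m, which bounds m only if
  it is already known to be finite. Keeping only jumps preceded by at most \<open>k\<close> others
  preserves the inequality, since every ancestor of a kept jump is kept, and makes the mean finite.
  The resulting bound is uniform in \<open>k\<close>.\<close>

lemma truncated_mean:
  fixes k :: nat
  defines "Y \<equiv> \<lambda>\<omega> u. indicator {..of_nat k} (lagged 0 \<omega> u) :: ennreal"
  shows "(\<integral>\<^sup>+\<omega>. \<integral>\<^sup>+u. Y \<omega> u \<partial>dH \<omega> \<partial>M) \<le> ennreal (T * \<mu> / (1 - ker_norm))"
proof -
  let ?x = "\<integral>\<^sup>+\<omega>. \<integral>\<^sup>+u. Y \<omega> u \<partial>dH \<omega> \<partial>M"
  from ker_bounded obtain B where "0 \<le> B \<and> (\<forall>t. ker t \<le> ennreal B) \<and> (\<forall>t\<in>{0..T}. \<Phi> t \<le> B)" ..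
  then have B: "0 \<le> B" "\<And>t. ker t \<le> ennreal B" by auto
  have Ym: "(\<lambda>(\<omega>, z). Y \<omega> (fst z)) \<in> borel_measurable bipred"
  proof -
    have [measurable]: "(\<lambda>p. lagged 0 (fst p) (fst (snd p))) \<in> borel_measurable bipred"
      using lagged_measurable[of 0] by (simp add: case_prod_unfold)
    show ?thesis unfolding Y_def case_prod_unfold by measurable
  qed
  have lag_mono: "lagged 0 \<omega> u \<le> lagged 0 \<omega> t" if "good \<omega>" "0 < u" "u < t" "t \<le> T" for \<omega> u t
    using that by (auto simp: lagged_eq intro!: emeasure_mono)
  have Y_path: "(\<lambda>u. indicator {0..T} u * Y \<omega> u) \<in> borel_measurable borel" if "good \<omega>" for \<omega>
    using that by (intro bipred_path_borel[OF Ym]) (simp add: good_def)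
  have comp: "?x = (\<integral>\<^sup>+\<omega>. \<integral>\<^sup>+t. indicator {0..T} t * (Y \<omega> t * ennreal (\<Lambda> t \<omega>)) \<partial>lborel \<partial>M)"
    by (rule compensation_dH(1)[OF Ym])
  have Tm: "(\<integral>\<^sup>+t. indicator {0..T} t * c \<partial>lborel) = ennreal T * c" for c
    using T by (simp add: nn_integral_multc)
  have conv_le: "(\<integral>\<^sup>+u. indicator {0<..<t} u * ker (t - u) \<partial>dH \<omega>) \<le> ennreal B * lagged 0 \<omega> t"
    if "good \<omega>" "t \<in> {0..T}" for \<omega> t
  proof -
    have "(\<integral>\<^sup>+u. indicator {0<..<t} u * ker (t - u) \<partial>dH \<omega>) \<le> (\<integral>\<^sup>+u. ennreal B * indicator {0<..<t} u \<partial>dH \<omega>)"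
      using B by (intro nn_integral_mono) (simp add: indicator_def)
    also have "\<dots> = ennreal B * lagged 0 \<omega> t"
      using that by (subst nn_integral_cmult_indicator) (auto simp: lagged_eq)
    finally show ?thesis .
  qed
  \<comment> \<open>A crude bound that serves only for finiteness: with at most \<open>k\<close>
    earlier jumps the intensity is at most \<mu> + B k.\<close>
  have "?x \<le> (\<integral>\<^sup>+\<omega>. \<integral>\<^sup>+t. indicator {0..T} t * (ennreal \<mu> + ennreal B * of_nat k) \<partial>lborel \<partial>M)"
    unfolding comp
  proof (rule nn_integral_mono_AE, use AE_good in eventually_elim)
    case (elim \<omega>)
    show ?case
    proof (rule nn_integral_mono)
      fix t :: real
      show "indicator {0..T} t * (Y \<omega> t * ennreal (\<Lambda> t \<omega>)) \<le> indicator {0..T} t * (ennreal \<mu> + ennreal B * of_nat k)"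
      proof (cases "t \<in> {0..T} \<and> lagged 0 \<omega> t \<le> of_nat k")
        case True
        have "(\<integral>\<^sup>+u. indicator {0<..<t} u * ker (t - u) \<partial>dH \<omega>) \<le> ennreal B * of_nat k"
          using True by (intro order_trans[OF conv_le[OF elim]] mult_left_mono) auto
        then show ?thesis
          using True intensity(1)[OF elim, of t] by (simp add: Y_def)
      qed (auto simp: Y_def)
    qed
  qed
  also have "\<dots> = ennreal T * (ennreal \<mu> + ennreal B * of_nat k)"
    unfolding Tm by (simp add: emeasure_space_1)
  also have "\<dots> < \<top>" by (simp add: ennreal_mult_less_top of_nat_less_top)
  finally have fin: "?x < \<top>" .
  obtain G where G[measurable]: "G \<in> borel_measurable M" and G_eq: "AE \<omega> in M. G \<omega> = (\<integral>\<^sup>+u. Y \<omega> u \<partial>dH \<omega>)"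
    using compensation_dH(2)[OF Ym] by blast
  \<comment> \<open>The sharp estimate: the truncated mean is bounded by itself times
    \<open>ker_norm\<close>, plus the immigrants.\<close>
  have "?x \<le> (\<integral>\<^sup>+\<omega>. ennreal T * ennreal \<mu> + ennreal ker_norm * G \<omega> \<partial>M)"
    unfolding comp
  proof (rule nn_integral_mono_AE, use AE_good G_eq in eventually_elim)
    case (elim \<omega>)
    note good = elim(1)
    interpret K: finite_borel_measure "dH \<omega>" by (rule finite_borel_dH[OF good])
    note [measurable_cong] = sets_dH[OF good]
    define Y' where "Y' u = indicator {0..T} u * Y \<omega> u" for u
    have Y'[measurable]: "Y' \<in> borel_measurable borel" unfolding Y'_def by (rule Y_path[OF good])
    note [measurable] = kernel_measurable[OF good Y']
    have "(\<integral>\<^sup>+t. indicator {0..T} t * (Y \<omega> t * ennreal (\<Lambda> t \<omega>)) \<partial>lborel) \<le>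
      (\<integral>\<^sup>+t. indicator {0..T} t * ennreal \<mu> +
        indicator {0..T} t * (1 * (\<integral>\<^sup>+u. indicator {0<..<t} u * (ker (t - u) * Y' u) \<partial>dH \<omega>)) \<partial>lborel)"
    proof (rule nn_integral_mono)
      fix t :: real
      show "indicator {0..T} t * (Y \<omega> t * ennreal (\<Lambda> t \<omega>)) \<le> indicator {0..T} t * ennreal \<mu> +
        indicator {0..T} t * (1 * (\<integral>\<^sup>+u. indicator {0<..<t} u * (ker (t - u) * Y' u) \<partial>dH \<omega>))"
      proof (cases "t \<in> {0..T} \<and> lagged 0 \<omega> t \<le> of_nat k")
        case True
        have "(\<integral>\<^sup>+u. indicator {0<..<t} u * ker (t - u) \<partial>dH \<omega>) = (\<integral>\<^sup>+u. indicator {0<..<t} u * (ker (t - u) * Y' u) \<partial>dH \<omega>)"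
        proof (rule nn_integral_cong)
          fix u
          show "indicator {0<..<t} u * ker (t - u) = indicator {0<..<t} u * (ker (t - u) * Y' u)"
          proof (cases "u \<in> {0<..<t}")
            case u: True
            then have "lagged 0 \<omega> u \<le> of_nat k"
              using lag_mono[OF good, of u t] True by auto
            then show ?thesis using u True by (simp add: Y'_def Y_def)
          qed simp
        qed
        then show ?thesis
          using True intensity(1)[OF good, of t] by (simp add: Y_def)
      qed (auto simp: Y_def)
    qed
    also have "\<dots> = ennreal T * ennreal \<mu> +
        (\<integral>\<^sup>+t. indicator {0..T} t * (1 * (\<integral>\<^sup>+u. indicator {0<..<t} u * (ker (t - u) * Y' u) \<partial>dH \<omega>)) \<partial>lborel)"
      by (subst nn_integral_add) (auto simp only: Tm, measurable)
    also have "(\<integral>\<^sup>+t. indicator {0..T} t * (1 * (\<integral>\<^sup>+u. indicator {0<..<t} u * (ker (t - u) * Y' u) \<partial>dH \<omega>)) \<partial>lborel) =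
        (\<integral>\<^sup>+u. offspring (\<lambda>_. 1) u * Y' u \<partial>dH \<omega>)"
      by (rule kernel_swap[OF good]) measurable
    also have "\<dots> \<le> (\<integral>\<^sup>+u. ennreal ker_norm * Y' u \<partial>dH \<omega>)"
      by (intro nn_integral_mono mult_right_mono offspring_one_le) simp
    also have "\<dots> = ennreal ker_norm * (\<integral>\<^sup>+u. Y' u \<partial>dH \<omega>)"
      by (rule nn_integral_cmult) measurable
    also have "(\<integral>\<^sup>+u. Y' u \<partial>dH \<omega>) = (\<integral>\<^sup>+u. Y \<omega> u \<partial>dH \<omega>)"
      by (intro nn_integral_cong_AE) (use AE_dH_range[OF good] in eventually_elim, simp add: Y'_def)
    finally show ?case by (simp only: elim(2) add_left_mono)
  qed
  also have "\<dots> = ennreal T * ennreal \<mu> + ennreal ker_norm * (\<integral>\<^sup>+\<omega>. G \<omega> \<partial>M)"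
    by (simp add: nn_integral_add nn_integral_cmult emeasure_space_1)
  also have "(\<integral>\<^sup>+\<omega>. G \<omega> \<partial>M) = ?x"
    using G_eq by (rule nn_integral_cong_AE)
  finally have le: "?x \<le> ennreal T * ennreal \<mu> + ennreal ker_norm * ?x" .
  define r where "r = enn2real ?x"
  have r: "?x = ennreal r" "0 \<le> r" using fin by (simp_all add: r_def)
  have "ennreal r \<le> ennreal (T * \<mu> + ker_norm * r)"
    using le T \<mu> r(2) ker_norm_nonneg by (simp add: r(1) ennreal_mult ennreal_plus)
  then have "r \<le> T * \<mu> + ker_norm * r"
    using T \<mu> r(2) ker_norm_nonneg by (subst (asm) ennreal_le_iff) auto
  then have "r * (1 - ker_norm) \<le> T * \<mu>" by (simp add: algebra_simps)
  then have "r \<le> T * \<mu> / (1 - ker_norm)" using ker_norm_less_1 by (simp add: pos_le_divide_eq)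
  then show ?thesis unfolding r(1) by (rule ennreal_leI)
qed

text \<open>On paths with at most \<open>k\<close> jumps the truncation removes nothing, so the
  uniform bound passes to the limit.\<close>

theorem mean_finite: "(\<integral>\<^sup>+\<omega>. of_nat (H T \<omega>) \<partial>M) < \<top>"
proof -
  let ?C = "ennreal (T * \<mu> / (1 - ker_norm))"
  have le: "(\<integral>\<^sup>+\<omega>. of_nat (H T \<omega>) * indicator {\<omega>. H T \<omega> \<le> k} \<omega> \<partial>M) \<le> ?C" for k
  proof -
    have "(\<integral>\<^sup>+\<omega>. of_nat (H T \<omega>) * indicator {\<omega>. H T \<omega> \<le> k} \<omega> \<partial>M) \<le>
      (\<integral>\<^sup>+\<omega>. \<integral>\<^sup>+u. indicator {..of_nat k} (lagged 0 \<omega> u) \<partial>dH \<omega> \<partial>M)"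
    proof (rule nn_integral_mono_AE, use AE_good in eventually_elim)
      case (elim \<omega>)
      show ?case
      proof (cases "H T \<omega> \<le> k")
        case True
        have "(\<integral>\<^sup>+u. 1 \<partial>dH \<omega>) \<le> (\<integral>\<^sup>+u. indicator {..of_nat k} (lagged 0 \<omega> u) \<partial>dH \<omega>)"
        proof (rule nn_integral_mono_AE, use AE_dH_range[OF elim] in eventually_elim)
          case (elim u)
          have "lagged 0 \<omega> u \<le> of_nat (H T \<omega>)"
            using elim \<open>good \<omega>\<close> by (simp add: lagged_eq dH_le)
          also have "\<dots> \<le> of_nat k" using True by simp
          finally show ?case by simp
        qed
        then show ?thesis using True by (simp add: dH_UNIV[OF elim] space_dH[OF elim])
      qed simp
    qed
    also have "\<dots> \<le> ?C" by (rule truncated_mean)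
    finally show ?thesis .
  qed
  have "(\<integral>\<^sup>+\<omega>. of_nat (H T \<omega>) \<partial>M) = (\<integral>\<^sup>+\<omega>. (SUP k. of_nat (H T \<omega>) * indicator {\<omega>. H T \<omega> \<le> k} \<omega>) \<partial>M)"
  proof (rule nn_integral_cong)
    fix \<omega>
    show "of_nat (H T \<omega>) = (SUP k. of_nat (H T \<omega>) * indicator {\<omega>. H T \<omega> \<le> k} \<omega> :: ennreal)"
    proof (rule antisym)
      show "of_nat (H T \<omega>) \<le> (SUP k. of_nat (H T \<omega>) * indicator {\<omega>. H T \<omega> \<le> k} \<omega> :: ennreal)"
        by (rule SUP_upper2[of "H T \<omega>"]) simp_all
    qed (auto intro!: SUP_least simp: indicator_def)
  qed
  also have "\<dots> = (SUP k. \<integral>\<^sup>+\<omega>. of_nat (H T \<omega>) * indicator {\<omega>. H T \<omega> \<le> k} \<omega> \<partial>M)"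
  proof (rule nn_integral_monotone_convergence_SUP)
    show "incseq (\<lambda>k \<omega>. of_nat (H T \<omega>) * indicator {\<omega>. H T \<omega> \<le> k} \<omega> :: ennreal)"
      by (auto simp: incseq_def le_fun_def indicator_def)
    fix k
    have "(\<lambda>\<omega>. (\<lambda>j. of_nat j * indicator {..k} j :: ennreal) (H T \<omega>)) \<in> borel_measurable M"
      by (rule measurable_compose[OF measurable_H_T]) simp
    then show "(\<lambda>\<omega>. of_nat (H T \<omega>) * indicator {\<omega>. H T \<omega> \<le> k} \<omega> :: ennreal) \<in> borel_measurable M"
      by (simp add: indicator_def)
  qed
  also have "\<dots> \<le> ?C" by (rule SUP_least) (rule le)
  also have "\<dots> < \<top>" by simp
  finally show ?thesis .
qed

end

subsection \<open>The simplex integrals\<close>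

lemma simplex_integral_cmult:
  "simplex_integral n b (\<lambda>vs. c * F vs) = c * simplex_integral n b F"
proof (induction n arbitrary: b F)
  case (Suc n)
  show ?case by (simp add: Suc)
qed simp

context hawkes_model
begin

text \<open>The simplex integrals are nested with the smallest time innermost and hence built by
  this convolution, whereas the recursion produces powers of its adjoint
  \<open>offspring\<close>.\<close>

definition inherited :: "(real \<Rightarrow> ennreal) \<Rightarrow> real \<Rightarrow> ennreal" where
  "inherited \<psi> t = (\<integral>\<^sup>+u. indicator {0..t} u * (ker (t - u) * \<psi> u) \<partial>lborel)"

lemma inherited_measurable[measurable]:
  assumes [measurable]: "\<psi> \<in> borel_measurable borel"
  shows "inherited \<psi> \<in> borel_measurable borel"
proof -
  have "(\<lambda>t. \<integral>\<^sup>+u. (if 0 \<le> u \<and> u \<le> t then 1 else 0) * (ker (t - u) * \<psi> u) \<partial>lborel) \<in> borel_measurable borel"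
    by measurable
  also have "(\<lambda>t. \<integral>\<^sup>+u. (if 0 \<le> u \<and> u \<le> t then 1 else 0) * (ker (t - u) * \<psi> u) \<partial>lborel) = inherited \<psi>"
    unfolding inherited_def by (intro ext nn_integral_cong) (simp add: indicator_def)
  finally show ?thesis .
qed

lemma offspring_inherited:
  assumes [measurable]: "\<phi> \<in> borel_measurable borel" "\<psi> \<in> borel_measurable borel"
  shows "(\<integral>\<^sup>+u. indicator {0..T} u * (offspring \<phi> u * \<psi> u) \<partial>lborel) =
    (\<integral>\<^sup>+t. indicator {0..T} t * (\<phi> t * inherited \<psi> t) \<partial>lborel)"
proof -
  have "(\<integral>\<^sup>+u. indicator {0..T} u * (offspring \<phi> u * \<psi> u) \<partial>lborel) =
     (\<integral>\<^sup>+u. \<integral>\<^sup>+t. (if 0 \<le> u \<and> u < t \<and> t \<le> T then \<phi> t * ker (t - u) * \<psi> u else 0) \<partial>lborel \<partial>lborel)"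
  proof (rule nn_integral_cong)
    fix u :: real
    have "indicator {0..T} u * (offspring \<phi> u * \<psi> u) =
        (\<integral>\<^sup>+t. indicator {0..T} u * (indicator {u<..T} t * (\<phi> t * ker (t - u)) * \<psi> u) \<partial>lborel)"
      unfolding offspring_def by (simp add: nn_integral_cmult nn_integral_multc)
    also have "\<dots> = (\<integral>\<^sup>+t. (if 0 \<le> u \<and> u < t \<and> t \<le> T then \<phi> t * ker (t - u) * \<psi> u else 0) \<partial>lborel)"
      by (intro nn_integral_cong) (auto simp: indicator_def)
    finally show "indicator {0..T} u * (offspring \<phi> u * \<psi> u) =
        (\<integral>\<^sup>+t. (if 0 \<le> u \<and> u < t \<and> t \<le> T then \<phi> t * ker (t - u) * \<psi> u else 0) \<partial>lborel)" .
  qed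
  also have "\<dots> = (\<integral>\<^sup>+t. \<integral>\<^sup>+u. (if 0 \<le> u \<and> u < t \<and> t \<le> T then \<phi> t * ker (t - u) * \<psi> u else 0) \<partial>lborel \<partial>lborel)"
    by (rule lborel_pair.Fubini') measurable
  also have "\<dots> = (\<integral>\<^sup>+t. indicator {0..T} t * (\<phi> t * inherited \<psi> t) \<partial>lborel)"
  proof (rule nn_integral_cong)
    fix t :: real
    have "(\<integral>\<^sup>+u. (if 0 \<le> u \<and> u < t \<and> t \<le> T then \<phi> t * ker (t - u) * \<psi> u else 0) \<partial>lborel) =
        (\<integral>\<^sup>+u. indicator {0..T} t * (\<phi> t * (indicator {0..t} u * (ker (t - u) * \<psi> u))) \<partial>lborel)"
      \<comment> \<open>\<open>offspring\<close> uses \<open>u < t\<close> and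
        \<open>inherited\<close> uses \<open>u \<le> t\<close>; the diagonal is a null set.\<close>
      by (intro nn_integral_cong_AE)
        (use AE_lborel_singleton[of t] in eventually_elim, auto simp: indicator_def ac_simps)
    also have "\<dots> = indicator {0..T} t * (\<phi> t * inherited \<psi> t)"
      unfolding inherited_def by (simp add: nn_integral_cmult)
    finally show "(\<integral>\<^sup>+u. (if 0 \<le> u \<and> u < t \<and> t \<le> T then \<phi> t * ker (t - u) * \<psi> u else 0) \<partial>lborel) =
        indicator {0..T} t * (\<phi> t * inherited \<psi> t)" .
  qed
  finally show ?thesis .
qed

fun ancestry :: "nat \<Rightarrow> real \<Rightarrow> ennreal" where
  "ancestry 0 = (\<lambda>_. 1)"
| "ancestry (Suc n) = inherited (ancestry n)"

lemma ancestry_measurable[measurable]: "ancestry n \<in> borel_measurable borel"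
  by (induction n) auto

text \<open>By adjointness the integral of \<open>generation k\<close> times
  \<open>ancestry n\<close> depends only on \<open>k + n\<close>: operators are moved one at a time
  from one factor to the other.\<close>

lemma mass_ancestry: "mass n = (\<integral>\<^sup>+t. indicator {0..T} t * ancestry n t \<partial>lborel)"
proof -
  have "(\<integral>\<^sup>+t. indicator {0..T} t * (generation k t * ancestry n t) \<partial>lborel) = mass (k + n)" for k
  proof (induction n arbitrary: k)
    case 0
    show ?case by (simp add: mass_def)
  next
    case (Suc n)
    show ?case
      using offspring_inherited[of "generation k" "ancestry n"] Suc[of "Suc k"] by simp
  qed
  from this[of 0] show ?thesis by simp
qed

text \<open>Convolution with a kernel of integral below 1 preserves the bound 1. Finiteness is what
  allows passing to real values.\<close>

lemma ancestry_le_1: "ancestry n t \<le> 1"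
proof (induction n arbitrary: t)
  case (Suc n)
  have "ancestry (Suc n) t \<le> (\<integral>\<^sup>+u. ker (t - u) \<partial>lborel)"
  proof -
    have "indicator {0..t} u * (ker (t - u) * ancestry n u) \<le> 1 * (ker (t - u) * 1)" for u
      by (intro mult_mono Suc) (auto simp: indicator_def)
    then show ?thesis by (simp add: inherited_def nn_integral_mono)
  qed
  also have "\<dots> = (\<integral>\<^sup>+u. ker u \<partial>lborel)"
    using nn_integral_real_affine[of ker "-1" t] by simp
  also have "\<dots> \<le> 1" using ker_norm_less_1 by (simp add: ker_integral)
  finally show ?case .
qed simp

text \<open>Putting the outer bound \<open>v\<close> in front of the list makes all factors
  differences of neighbours. The first factor is then constant in the inner variables and leaves one
  convolution step.\<close>

lemma simplex_integral_ancestry: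
  assumes "v \<in> {0..T}"
  shows "simplex_integral n v (\<lambda>vs. \<Prod>i<n. \<Phi> ((v # vs) ! i - (v # vs) ! Suc i)) = enn2real (ancestry n v)"
  using assms
proof (induction n arbitrary: v)
  case (Suc n)
  let ?k = "\<lambda>t. indicator {0..T} t * \<Phi> t"
  have [measurable]: "?k \<in> borel_measurable borel" by (rule ker_real_meas)
  have k: "0 \<le> ?k t" "ker t = ennreal (?k t)" for t
    using \<Phi>_nonneg by (auto simp: indicator_def ker_def)
  have anc: "ennreal (enn2real (ancestry n w)) = ancestry n w" for w
    using le_less_trans[OF ancestry_le_1[of n w]] by simp
  have "simplex_integral (Suc n) v (\<lambda>vs. \<Prod>i<Suc n. \<Phi> ((v # vs) ! i - (v # vs) ! Suc i)) =
      (LBINT w:{0..v}. simplex_integral n w (\<lambda>vs. \<Phi> (v - w) * (\<Prod>i<n. \<Phi> ((w # vs) ! i - (w # vs) ! Suc i))))"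
    by (simp only: simplex_integral.simps prod.lessThan_Suc_shift nth_Cons_0 nth_Cons_Suc)
  also have "\<dots> = (\<integral>w. indicator {0..v} w * (?k (v - w) * enn2real (ancestry n w)) \<partial>lborel)"
    unfolding set_lebesgue_integral_def simplex_integral_cmult
  proof (intro Bochner_Integration.integral_cong refl)
    fix w :: real
    show "indicator {0..v} w *\<^sub>R (\<Phi> (v - w) * simplex_integral n w (\<lambda>vs. \<Prod>i<n. \<Phi> ((w # vs) ! i - (w # vs) ! Suc i))) =
        indicator {0..v} w * (?k (v - w) * enn2real (ancestry n w))"
    proof (cases "w \<in> {0..v}")
      case True
      then have "w \<in> {0..T}" "v - w \<in> {0..T}" using Suc.prems by auto
      then show ?thesis using True Suc.IH by simp
    qed simp
  qed
  also have "\<dots> = enn2real (\<integral>\<^sup>+w. ennreal (indicator {0..v} w * (?k (v - w) * enn2real (ancestry n w))) \<partial>lborel)"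
    by (rule integral_eq_nn_integral) (use k in auto)
  also have "(\<integral>\<^sup>+w. ennreal (indicator {0..v} w * (?k (v - w) * enn2real (ancestry n w))) \<partial>lborel) = ancestry (Suc n) v"
    unfolding ancestry.simps inherited_def
  proof (rule nn_integral_cong)
    fix w
    have "ennreal (?k (v - w) * enn2real (ancestry n w)) = ennreal (?k (v - w)) * ennreal (enn2real (ancestry n w))"
      by (rule ennreal_mult[OF k(1) enn2real_nonneg])
    also have "\<dots> = ker (v - w) * ancestry n w" by (simp only: k(2) anc)
    finally show "ennreal (indicator {0..v} w * (?k (v - w) * enn2real (ancestry n w))) = indicator {0..v} w * (ker (v - w) * ancestry n w)"
      by (cases "w \<in> {0..v}") simp_all
  qed
  finally show ?case .
qed simp

lemma mass_finite: "mass n < \<top>"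
proof -
  have "mass n \<le> (\<integral>\<^sup>+t. indicator {0..T} t * 1 \<partial>lborel)"
    unfolding mass_ancestry by (intro nn_integral_mono mult_left_mono ancestry_le_1) simp
  also have "\<dots> < \<top>" using T by simp
  finally show ?thesis .
qed

text \<open>The index shifts by one because generation \<open>n\<close> involves \<open>n\<close>
  kernels and \<open>n + 1\<close> times. For \<open>n = 0\<close> it is the special value
  \<open>T\<close> of the definition; otherwise the outermost variable plays the role of
  \<open>v\<close> in \<open>simplex_integral_ancestry\<close>.\<close>

lemma m_Phi_eq: "m_Phi \<Phi> T (Suc n) = enn2real (mass n)"
proof -
  have mass: "enn2real (mass n) = (\<integral>v. indicator {0..T} v * enn2real (ancestry n v) \<partial>lborel)"
  proof -
    have "ennreal (indicator {0..T} v * enn2real (ancestry n v)) = indicator {0..T} v * ancestry n v" for v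
      using le_less_trans[OF ancestry_le_1[of n v]] by (simp add: indicator_def)
    then show ?thesis
      unfolding mass_ancestry by (subst integral_eq_nn_integral) auto
  qed
  show ?thesis
  proof (cases "n = 0")
    case True
    have "enn2real (mass n) = T" unfolding mass unfolding True using T by simp
    then show ?thesis using True by (simp add: m_Phi_def)
  next
    case False
    have prod: "(\<Prod>i=2..Suc n. \<Phi> ((v # vs) ! (i - 2) - (v # vs) ! (i - 1))) = (\<Prod>i<n. \<Phi> ((v # vs) ! i - (v # vs) ! Suc i))" for v vs
      by (rule prod.reindex_bij_witness[of _ "\<lambda>i. i + 2" "\<lambda>i. i - 2"]) (auto simp: Suc_diff_Suc numeral_2_eq_2)
    have "m_Phi \<Phi> T (Suc n) = (LBINT v:{0..T}. simplex_integral n v (\<lambda>vs. \<Prod>i<n. \<Phi> ((v # vs) ! i - (v # vs) ! Suc i)))"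
      using False by (simp only: m_Phi_def simplex_integral.simps prod) simp
    also have "\<dots> = (\<integral>v. indicator {0..T} v * enn2real (ancestry n v) \<partial>lborel)"
      unfolding set_lebesgue_integral_def
    proof (intro Bochner_Integration.integral_cong refl)
      fix v :: real
      show "indicator {0..T} v *\<^sub>R simplex_integral n v (\<lambda>vs. \<Prod>i<n. \<Phi> ((v # vs) ! i - (v # vs) ! Suc i)) =
          indicator {0..T} v * enn2real (ancestry n v)"
        by (cases "v \<in> {0..T}") (simp_all only: simplex_integral_ancestry indicator_simps real_scaleR_def mult_zero_left simp_thms)
    qed
    finally show ?thesis by (simp add: mass)
  qed
qed

text \<open>The rectangle below \<mu> has area T \<mu>, which gives the Poisson weights of the final
  bound.\<close>

lemma base_law:
  "(\<integral>\<^sup>+\<omega>. F (base \<omega>) \<partial>M) = (\<Sum>p. F (of_nat p) * ennreal (exp (- T * \<mu>) * (T * \<mu>) ^ p / fact p))"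
proof -
  have A: "{0..T} \<times> {0..\<mu>} \<in> sets \<nu>" by (intro base_sets) auto
  have "emeasure lborel ({0..T} \<times> {0..\<mu>}) = emeasure (lborel \<Otimes>\<^sub>M lborel) ({0..T} \<times> {0..\<mu>})"
    by (simp add: lborel_prod)
  also have "\<dots> = ennreal T * ennreal \<mu>"
    using T \<mu> by (subst lborel.emeasure_pair_measure_Times) auto
  finally have e: "emeasure \<nu> ({0..T} \<times> {0..\<mu>}) = ennreal (T * \<mu>)"
    using T \<mu> by (simp add: emeasure_strip[OF A] ennreal_mult)
  have fin: "emeasure \<nu> ({0..T} \<times> {0..\<mu>}) < \<infinity>" by (simp add: e)
  have m: "measure \<nu> ({0..T} \<times> {0..\<mu>}) = T * \<mu>" using T \<mu> by (simp add: measure_def e)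
  have "(\<integral>\<^sup>+\<omega>. F (base \<omega>) \<partial>M) = (\<integral>\<^sup>+\<omega>. F (base \<omega>) * indicator (space M) \<omega> \<partial>M)"
    by (intro nn_integral_cong) simp
  also have "\<dots> = (\<Sum>p. F (of_nat p) * emeasure M (space M \<inter> {\<omega>\<in>space M. base \<omega> = of_nat p}))"
    unfolding base_def by (rule nn_integral_nat_valued[OF measurable_N[OF A] AE_N_nat[OF A fin]]) simp
  also have "\<dots> = (\<Sum>p. F (of_nat p) * ennreal (exp (- T * \<mu>) * (T * \<mu>) ^ p / fact p))"
  proof (intro suminf_cong arg_cong2[where f="(*)"] refl)
    fix p
    have eq: "space M \<inter> {\<omega>\<in>space M. base \<omega> = of_nat p} = {\<omega>\<in>space M. emeasure (N \<omega>) ({0..T} \<times> {0..\<mu>}) = of_nat p}"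
      by (auto simp: base_def)
    show "emeasure M (space M \<inter> {\<omega>\<in>space M. base \<omega> = of_nat p}) = ennreal (exp (- T * \<mu>) * (T * \<mu>) ^ p / fact p)"
      unfolding eq using prob_N[OF A fin, of p] by (simp add: emeasure_eq_measure m)
  qed
  finally show ?thesis .
qed

end

section \<open>Rewards of independent claims\<close>

text \<open>The index set is left abstract so that the two claim sequences can be merged into one
  independent family; \<open>c\<close> extracts the component on which the sum and the conditioning
  depend.\<close>

locale iid_rewards = prob_space M for M :: "'w measure" +
  fixes Z :: "'i \<Rightarrow> 'w \<Rightarrow> 'e" and I :: "'i set" and E D :: "'e measure"
    and c :: "'e \<Rightarrow> real" and f h :: "real \<Rightarrow> real" and g :: "'e \<Rightarrow> real" and Bg Bh :: real
  assumes indep_Z: "indep_vars (\<lambda>_. E) Z I" and law: "\<And>i. i \<in> I \<Longrightarrow> distr M E (Z i) = D"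
    and c_meas[measurable]: "c \<in> borel_measurable E" and f_meas[measurable]: "f \<in> borel_measurable borel"
    and g_meas[measurable]: "g \<in> borel_measurable E" and h_meas[measurable]: "h \<in> borel_measurable borel"
    and f_nonneg: "\<And>x. 0 \<le> f x"
    and g_nonneg: "\<And>z. 0 \<le> g z" and g_le: "\<And>z. g z \<le> Bg"
    and h_nonneg: "\<And>x. 0 \<le> h x" and h_le: "\<And>x. h x \<le> Bh" and h_mono: "mono h"
begin

lemma Z_meas[measurable]: "i \<in> I \<Longrightarrow> Z i \<in> measurable M E"
  using indep_Z by (simp add: indep_vars_def2)

lemma component_meas: "k \<in> K \<Longrightarrow> (\<lambda>w. f (c (w k))) \<in> borel_measurable (\<Pi>\<^sub>M k\<in>K. E)"
proof -
  assume "k \<in> K"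
  then have [measurable]: "(\<lambda>w. w k) \<in> measurable (\<Pi>\<^sub>M k\<in>K. E) E" by (rule measurable_component_singleton)
  show ?thesis by measurable
qed

text \<open>Independence and the common law make the law of any enumeration of \<open>m\<close>
  distinct claims the same product measure. This is the exchangeability used throughout.\<close>

lemma joint_law:
  assumes \<pi>: "inj_on \<pi> {..<m}" "\<pi> ` {..<m} \<subseteq> I" and m: "0 < m"
  shows "distr M (\<Pi>\<^sub>M k\<in>{..<m}. E) (\<lambda>\<omega>. \<lambda>k\<in>{..<m}. Z (\<pi> k) \<omega>) = (\<Pi>\<^sub>M k\<in>{..<m}. D)"
proof -
  let ?J = "\<pi> ` {..<m}"
  have J: "?J \<noteq> {}" using m by auto
  have "indep_vars (\<lambda>_. E) Z ?J" using indep_Z \<pi>(2) by (rule indep_vars_subset)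
  then have "distr M (\<Pi>\<^sub>M j\<in>?J. E) (\<lambda>\<omega>. \<lambda>j\<in>?J. Z j \<omega>) = (\<Pi>\<^sub>M j\<in>?J. distr M E (Z j))"
    using J \<pi>(2) by (subst (asm) indep_vars_iff_distr_eq_PiM') auto
  also have "\<dots> = (\<Pi>\<^sub>M j\<in>?J. D)" using \<pi>(2) law by (intro PiM_cong) auto
  finally have *: "distr M (\<Pi>\<^sub>M j\<in>?J. E) (\<lambda>\<omega>. \<lambda>j\<in>?J. Z j \<omega>) = (\<Pi>\<^sub>M j\<in>?J. D)" .
  have \<pi>0: "\<pi> 0 \<in> I" using \<pi>(2) m by blast
  have D: "prob_space D" "sets D = sets E"
    unfolding law[OF \<pi>0, symmetric] using prob_space_distr[OF Z_meas[OF \<pi>0]] by simp_all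
  have sets: "sets (\<Pi>\<^sub>M k\<in>{..<m}. D) = sets (\<Pi>\<^sub>M k\<in>{..<m}. E)" by (intro sets_PiM_cong) (auto simp: D)
  have Zm: "(\<lambda>\<omega>. \<lambda>j\<in>?J. Z j \<omega>) \<in> measurable M (\<Pi>\<^sub>M j\<in>?J. E)"
    using \<pi>(2) by (intro measurable_restrict) auto
  have re: "(\<lambda>w. \<lambda>k\<in>{..<m}. w (\<pi> k)) \<in> measurable (\<Pi>\<^sub>M j\<in>?J. E) (\<Pi>\<^sub>M k\<in>{..<m}. E)"
    by (intro measurable_restrict measurable_component_singleton) auto
  have "(\<Pi>\<^sub>M k\<in>{..<m}. D) = distr (\<Pi>\<^sub>M j\<in>?J. D) (\<Pi>\<^sub>M k\<in>{..<m}. D) (\<lambda>w. \<lambda>k\<in>{..<m}. w (\<pi> k))"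
    using D \<pi>(1) by (intro distr_PiM_reindex[symmetric]) auto
  also have "\<dots> = distr (\<Pi>\<^sub>M j\<in>?J. D) (\<Pi>\<^sub>M k\<in>{..<m}. E) (\<lambda>w. \<lambda>k\<in>{..<m}. w (\<pi> k))"
    using sets by (intro distr_cong) auto
  also have "\<dots> = distr M (\<Pi>\<^sub>M k\<in>{..<m}. E) ((\<lambda>w. \<lambda>k\<in>{..<m}. w (\<pi> k)) \<circ> (\<lambda>\<omega>. \<lambda>j\<in>?J. Z j \<omega>))"
    unfolding *[symmetric] using re Zm by (rule distr_distr)
  also have "\<dots> = distr M (\<Pi>\<^sub>M k\<in>{..<m}. E) (\<lambda>\<omega>. \<lambda>k\<in>{..<m}. Z (\<pi> k) \<omega>)"
    by (intro distr_cong) (auto simp: fun_eq_iff)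
  finally show ?thesis ..
qed

text \<open>The number a(m) of the overview, computed on the product space. For \<open>m = 0\<close>
  the coordinate \<open>w 0\<close> is \<open>undefined\<close>, so only \<open>m \<ge> 1\<close> is
  meaningful.\<close>

definition reward :: "nat \<Rightarrow> real" where
  "reward m = (\<integral>w. g (w 0) * h (\<Sum>k<m. f (c (w k))) \<partial>(\<Pi>\<^sub>M k\<in>{..<m}. D))"

text \<open>By exchangeability neither the choice of the claims nor that of the distinguished one
  matters, only their number.\<close>

lemma reward_eq:
  assumes J: "finite J" "J \<subseteq> I" "i \<in> J"
  shows "expectation (\<lambda>\<omega>. g (Z i \<omega>) * h (\<Sum>j\<in>J. f (c (Z j \<omega>)))) = reward (card J)"
proof -
  let ?m = "card J"
  have m: "0 < ?m" using J by (auto simp: card_gt_0_iff)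
  obtain \<pi>0 where \<pi>0: "bij_betw \<pi>0 {..<?m} J"
    using ex_bij_betw_nat_finite[OF J(1)] by (auto simp: atLeast0LessThan)
  then have "i \<in> \<pi>0 ` {..<?m}" using J(3) by (simp add: bij_betw_def)
  then obtain k where k: "k < ?m" "\<pi>0 k = i" by blast
  \<comment> \<open>In \<open>reward\<close> the function \<open>g\<close> sits at position 0; the
    transposition moves the distinguished claim there.\<close>
  define \<pi> where "\<pi> = \<pi>0 \<circ> Transposition.transpose 0 k"
  have "bij_betw (Transposition.transpose 0 k) {..<?m} {..<?m}"
    using m k by (intro bij_betw_byWitness[where f'="Transposition.transpose 0 k"]) (auto simp: Transposition.transpose_def)
  then have \<pi>: "bij_betw \<pi> {..<?m} J" unfolding \<pi>_def by (rule bij_betw_trans) (rule \<pi>0)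
  have \<pi>_0: "\<pi> 0 = i" using k by (simp add: \<pi>_def)
  have inj: "inj_on \<pi> {..<?m}" "\<pi> ` {..<?m} \<subseteq> I" using \<pi> J by (auto simp: bij_betw_def)
  have Zm: "(\<lambda>\<omega>. \<lambda>k\<in>{..<?m}. Z (\<pi> k) \<omega>) \<in> measurable M (\<Pi>\<^sub>M k\<in>{..<?m}. E)"
    using inj(2) by (intro measurable_restrict Z_meas) auto
  have F: "(\<lambda>w. g (w 0) * h (\<Sum>k<?m. f (c (w k)))) \<in> borel_measurable (\<Pi>\<^sub>M k\<in>{..<?m}. E)"
  proof -
    have [measurable]: "(\<lambda>w. w 0) \<in> measurable (\<Pi>\<^sub>M k\<in>{..<?m}. E) E"
      using m by (intro measurable_component_singleton) auto
    have "(\<lambda>w. g (w 0)) \<in> borel_measurable (\<Pi>\<^sub>M k\<in>{..<?m}. E)" by measurable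
    then show ?thesis
      by (intro borel_measurable_times measurable_compose[OF _ h_meas] borel_measurable_sum component_meas)
  qed
  have "reward ?m = (\<integral>w. g (w 0) * h (\<Sum>k<?m. f (c (w k))) \<partial>distr M (\<Pi>\<^sub>M k\<in>{..<?m}. E) (\<lambda>\<omega>. \<lambda>k\<in>{..<?m}. Z (\<pi> k) \<omega>))"
    unfolding reward_def joint_law[OF inj m] ..
  also have "\<dots> = expectation (\<lambda>\<omega>. g (Z (\<pi> 0) \<omega>) * h (\<Sum>k<?m. f (c (Z (\<pi> k) \<omega>))))"
    using Zm F m by (subst integral_distr) (auto intro!: Bochner_Integration.integral_cong)
  also have "\<dots> = expectation (\<lambda>\<omega>. g (Z i \<omega>) * h (\<Sum>j\<in>J. f (c (Z j \<omega>))))"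
    unfolding \<pi>_0 using \<pi> by (subst sum.reindex_bij_betw[OF \<pi>]) simp
  finally show ?thesis ..
qed

lemma sum_meas[measurable]: "J \<subseteq> I \<Longrightarrow> (\<lambda>\<omega>. \<Sum>j\<in>J. f (c (Z j \<omega>))) \<in> borel_measurable M"
  by (intro borel_measurable_sum measurable_compose[OF measurable_compose[OF Z_meas c_meas] f_meas]) auto

lemma bounds: "0 \<le> Bg" "0 \<le> Bh"
  using g_nonneg g_le h_nonneg h_le order_trans by blast+

lemma integrable_reward:
  assumes J: "J \<subseteq> I" and i: "i \<in> I"
  shows "integrable M (\<lambda>\<omega>. g (Z i \<omega>) * h (\<Sum>j\<in>J. f (c (Z j \<omega>))))"
proof (rule integrable_const_bound[where B="Bg * Bh"])
  have "\<bar>g z * h x\<bar> \<le> Bg * Bh" for z x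
    using g_nonneg[of z] h_nonneg[of x] g_le[of z] h_le[of x] bounds by (simp add: mult_mono)
  then show "AE \<omega> in M. norm (g (Z i \<omega>) * h (\<Sum>j\<in>J. f (c (Z j \<omega>)))) \<le> Bg * Bh" by simp
  have [measurable]: "Z i \<in> measurable M E" using i by (rule Z_meas)
  note sum_meas[OF J, measurable]
  show "(\<lambda>\<omega>. g (Z i \<omega>) * h (\<Sum>j\<in>J. f (c (Z j \<omega>)))) \<in> borel_measurable M" by measurable
qed

lemma reward_nonneg: "0 \<le> reward m"
  unfolding reward_def by (rule integral_nonneg_AE) (use g_nonneg h_nonneg in auto)

text \<open>With infinitely many claims both numbers can be realised on nested finite sets of claims
  with the same distinguished one; more nonnegative summands increase the argument of
  \<open>h\<close>.\<close>

lemma reward_mono: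
  assumes "infinite I" "1 \<le> m" "m \<le> n"
  shows "reward m \<le> reward n"
proof -
  obtain J' where J': "J' \<subseteq> I" "finite J'" "card J' = n"
    using infinite_arbitrarily_large[OF assms(1)] by blast
  obtain J where J: "J \<subseteq> J'" "card J = m"
    using obtain_subset_with_card_n[of m J'] J' assms(3) by blast
  obtain i where i: "i \<in> J" using J(2) assms(2) by fastforce
  have fin: "finite J" using J J' finite_subset by blast
  have "reward m = expectation (\<lambda>\<omega>. g (Z i \<omega>) * h (\<Sum>j\<in>J. f (c (Z j \<omega>))))"
    using reward_eq[OF fin _ i] J J' by auto
  also have "\<dots> \<le> expectation (\<lambda>\<omega>. g (Z i \<omega>) * h (\<Sum>j\<in>J'. f (c (Z j \<omega>))))"
  proof (rule integral_mono)
    fix \<omega>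
    have "(\<Sum>j\<in>J. f (c (Z j \<omega>))) \<le> (\<Sum>j\<in>J'. f (c (Z j \<omega>)))"
      using J J' f_nonneg by (intro sum_mono2) auto
    then show "g (Z i \<omega>) * h (\<Sum>j\<in>J. f (c (Z j \<omega>))) \<le> g (Z i \<omega>) * h (\<Sum>j\<in>J'. f (c (Z j \<omega>)))"
      using g_nonneg h_mono by (intro mult_left_mono) (auto dest: monoD)
  qed (use i J J' in \<open>auto intro!: integrable_reward\<close>)
  also have "\<dots> = reward n"
    using reward_eq[OF J'(2,1), of i] i J J' by auto
  finally show ?thesis .
qed

text \<open>Each of the claims contributes the same amount, which is the origin of the factor H_T in
  the expectation of H_T a(H_T).\<close>

lemma total_reward:
  assumes J: "finite J" "J \<subseteq> I"
  shows "expectation (\<lambda>\<omega>. (\<Sum>i\<in>J. g (Z i \<omega>)) * h (\<Sum>j\<in>J. f (c (Z j \<omega>)))) = real (card J) * reward (card J)"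
proof -
  have "expectation (\<lambda>\<omega>. (\<Sum>i\<in>J. g (Z i \<omega>)) * h (\<Sum>j\<in>J. f (c (Z j \<omega>)))) =
      expectation (\<lambda>\<omega>. \<Sum>i\<in>J. g (Z i \<omega>) * h (\<Sum>j\<in>J. f (c (Z j \<omega>))))"
    by (simp only: sum_distrib_right)
  also have "\<dots> = (\<Sum>i\<in>J. expectation (\<lambda>\<omega>. g (Z i \<omega>) * h (\<Sum>j\<in>J. f (c (Z j \<omega>)))))"
    using J by (intro Bochner_Integration.integral_sum integrable_reward) auto
  also have "\<dots> = (\<Sum>i\<in>J. reward (card J))"
    using J by (intro sum.cong refl reward_eq) auto
  finally show ?thesis by simp
qed

text \<open>Given \<open>c (Z i)\<close>, the sum depends on the remaining independent claims only, so that the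
  conditional expectation may be replaced by its argument although \<open>g (Z i)\<close> is not a function of
  \<open>c (Z i)\<close>.\<close>

lemma conditional_reward:
  assumes J: "finite J" "J \<subseteq> I" "i \<in> J"
  shows "expectation (\<lambda>\<omega>. g (Z i \<omega>) * real_cond_exp M (vimage_algebra (space M) (\<lambda>\<omega>. c (Z i \<omega>)) borel)
    (\<lambda>\<omega>. h (\<Sum>j\<in>J. f (c (Z j \<omega>)))) \<omega>) = reward (card J)"
proof -
  define R where "R \<omega> = (\<Sum>j\<in>J - {i}. f (c (Z j \<omega>)))" for \<omega>
  have i: "i \<in> I" using J by auto
  have [measurable]: "Z i \<in> measurable M E" using i by (rule Z_meas)
  have [measurable]: "R \<in> borel_measurable M"
    unfolding R_def[abs_def] using J by (intro sum_meas) auto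
  have sum_R: "(\<Sum>j\<in>J. f (c (Z j \<omega>))) = f (c (Z i \<omega>)) + R \<omega>" for \<omega>
    unfolding R_def using J by (simp add: sum.remove)
  define P where "P = distr M E (Z i)"
  define Q where "Q = distr M borel R"
  interpret P: prob_space P unfolding P_def by (rule prob_space_distr) measurable
  interpret Q: prob_space Q unfolding Q_def by (rule prob_space_distr) measurable
  interpret PQ: pair_prob_space P Q ..
  have [measurable_cong]: "sets P = sets E" "sets Q = sets borel" by (simp_all add: P_def Q_def)
  \<comment> \<open>The distinguished claim and the sum over the others are functions of disjoint
    blocks of an independent family.\<close>
  have product: "P \<Otimes>\<^sub>M Q = distr M (E \<Otimes>\<^sub>M borel) (\<lambda>\<omega>. (Z i \<omega>, R \<omega>))"
  proof -
    let ?A = "Pi\<^sub>M {i} (\<lambda>_. E)" and ?B = "Pi\<^sub>M (J - {i}) (\<lambda>_. E)"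
    let ?X = "\<lambda>\<omega>. \<lambda>j\<in>{i}. Z j \<omega>" and ?Y = "\<lambda>\<omega>. \<lambda>j\<in>J - {i}. Z j \<omega>"
    let ?S = "\<lambda>w. \<Sum>j\<in>J - {i}. f (c (w j))"
    have X[measurable]: "?X \<in> measurable M ?A" using i by (intro measurable_restrict Z_meas) auto
    have Y[measurable]: "?Y \<in> measurable M ?B" using J by (intro measurable_restrict Z_meas) auto
    have e[measurable]: "(\<lambda>w. w i) \<in> measurable ?A E" by (rule measurable_component_singleton) simp
    have S[measurable]: "?S \<in> borel_measurable ?B"
      by (intro borel_measurable_sum component_meas)
    have P: "P = distr (distr M ?A ?X) E (\<lambda>w. w i)"
      unfolding P_def by (subst distr_distr) (auto simp: comp_def intro!: distr_cong)
    have Q: "Q = distr (distr M ?B ?Y) borel ?S"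
      unfolding Q_def by (subst distr_distr) (auto simp: comp_def R_def intro!: distr_cong)
    have "indep_var ?A ?X ?B ?Y"
      using J by (intro indep_var_restrict[OF indep_Z]) auto
    then have prod: "distr M ?A ?X \<Otimes>\<^sub>M distr M ?B ?Y = distr M (?A \<Otimes>\<^sub>M ?B) (\<lambda>\<omega>. (?X \<omega>, ?Y \<omega>))"
      unfolding indep_var_distribution_eq by blast
    have "P \<Otimes>\<^sub>M Q = distr (distr M ?A ?X \<Otimes>\<^sub>M distr M ?B ?Y) (E \<Otimes>\<^sub>M borel) (\<lambda>(w, w'). (w i, ?S w'))"
      using Q.sigma_finite_measure_axioms unfolding P Q by (intro pair_measure_distr) auto
    also have "\<dots> = distr M (E \<Otimes>\<^sub>M borel) ((\<lambda>(w, w'). (w i, ?S w')) \<circ> (\<lambda>\<omega>. (?X \<omega>, ?Y \<omega>)))"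
      unfolding prod by (rule distr_distr) measurable
    also have "\<dots> = distr M (E \<Otimes>\<^sub>M borel) (\<lambda>\<omega>. (Z i \<omega>, R \<omega>))"
      by (intro distr_cong) (auto simp: R_def)
    finally show ?thesis .
  qed
  have joint: "expectation (\<lambda>\<omega>. F (Z i \<omega>) (R \<omega>)) = (\<integral>z. \<integral>r. F z r \<partial>Q \<partial>P)"
    if F: "(\<lambda>(z, r). F z r) \<in> borel_measurable (E \<Otimes>\<^sub>M borel)" and B: "\<And>z r. \<bar>F z r\<bar> \<le> B" for F and B :: real
  proof -
    have F': "(\<lambda>(z, r). F z r) \<in> borel_measurable (P \<Otimes>\<^sub>M Q)" using F by measurable
    have "(\<integral>z. \<integral>r. F z r \<partial>Q \<partial>P) = (\<integral>p. (\<lambda>(z, r). F z r) p \<partial>(P \<Otimes>\<^sub>M Q))"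
      using F' B by (intro PQ.integral_fst) (auto intro!: PQ.integrable_const_bound[where B=B])
    also have "\<dots> = expectation (\<lambda>\<omega>. F (Z i \<omega>) (R \<omega>))"
      unfolding product using F by (subst integral_distr) auto
    finally show ?thesis ..
  qed
  \<comment> \<open>The candidate for the conditional expectation: freeze the conditioned value and
    average over the independent rest.\<close>
  define \<rho> where "\<rho> x = (\<integral>r. h (f x + r) \<partial>Q)" for x
  have [measurable]: "\<rho> \<in> borel_measurable borel"
    unfolding \<rho>_def by (rule Q.borel_measurable_lebesgue_integral) measurable
  have h_abs: "\<bar>h x\<bar> \<le> Bh" for x using h_nonneg h_le by simp
  have \<rho>_abs: "\<bar>\<rho> x\<bar> \<le> Bh" for x
  proof -
    have int: "integrable Q (\<lambda>r. h (f x + r))"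
      using h_abs by (intro Q.integrable_const_bound[where B=Bh]) auto
    have "\<rho> x \<le> (\<integral>r. Bh \<partial>Q)" unfolding \<rho>_def using h_le int by (intro integral_mono) auto
    moreover have "0 \<le> \<rho> x" unfolding \<rho>_def by (rule integral_nonneg_AE) (use h_nonneg in auto)
    ultimately show ?thesis by (simp add: Q.prob_space)
  qed
  let ?F = "vimage_algebra (space M) (\<lambda>\<omega>. c (Z i \<omega>)) borel"
  have cZ[measurable]: "(\<lambda>\<omega>. c (Z i \<omega>)) \<in> borel_measurable M" by measurable
  have sets_F: "sets ?F = {(\<lambda>\<omega>. c (Z i \<omega>)) -` A \<inter> space M | A. A \<in> sets borel}"
    by (rule sets_vimage_algebra2) auto
  have sub: "subalgebra M ?F"
    unfolding subalgebra_def using measurable_sets[OF cZ] by (auto simp: sets_F)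
  interpret F: sigma_finite_subalgebra M ?F
  proof (rule finite_measure_subalgebra_is_sigma_finite)
    show "finite_measure_subalgebra M ?F"
      by (intro finite_measure_subalgebra.intro finite_measure_subalgebra_axioms.intro sub finite_measure_axioms)
  qed
  have ce: "AE \<omega> in M. real_cond_exp M ?F (\<lambda>\<omega>. h (f (c (Z i \<omega>)) + R \<omega>)) \<omega> = \<rho> (c (Z i \<omega>))"
  proof (rule F.real_cond_exp_charact)
    fix A assume "A \<in> sets ?F"
    then obtain B where A: "A = (\<lambda>\<omega>. c (Z i \<omega>)) -` B \<inter> space M" and [measurable]: "B \<in> sets borel"
      unfolding sets_F by auto
    have "(LINT \<omega>:A|M. h (f (c (Z i \<omega>)) + R \<omega>)) = expectation (\<lambda>\<omega>. indicator B (c (Z i \<omega>)) * h (f (c (Z i \<omega>)) + R \<omega>))"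
      unfolding set_lebesgue_integral_def by (intro Bochner_Integration.integral_cong) (auto simp: A indicator_def)
    also have "\<dots> = (\<integral>z. \<integral>r. indicator B (c z) * h (f (c z) + r) \<partial>Q \<partial>P)"
    proof (rule joint)
      show "\<bar>indicator B (c z) * h (f (c z) + r)\<bar> \<le> Bh" for z r
        using h_abs bounds by (auto simp: indicator_def)
    qed measurable
    also have "\<dots> = (\<integral>z. \<integral>r. indicator B (c z) * \<rho> (c z) \<partial>Q \<partial>P)"
      by (simp add: \<rho>_def Q.prob_space)
    also have "\<dots> = expectation (\<lambda>\<omega>. indicator B (c (Z i \<omega>)) * \<rho> (c (Z i \<omega>)))"
    proof (rule joint[symmetric])
      show "\<bar>indicator B (c z) * \<rho> (c z)\<bar> \<le> Bh" for z
        using \<rho>_abs bounds by (auto simp: indicator_def)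
    qed measurable
    also have "\<dots> = (LINT \<omega>:A|M. \<rho> (c (Z i \<omega>)))"
      unfolding set_lebesgue_integral_def by (intro Bochner_Integration.integral_cong) (auto simp: A indicator_def)
    finally show "(LINT \<omega>:A|M. h (f (c (Z i \<omega>)) + R \<omega>)) = (LINT \<omega>:A|M. \<rho> (c (Z i \<omega>)))" .
  next
    show "integrable M (\<lambda>\<omega>. h (f (c (Z i \<omega>)) + R \<omega>))"
      using h_abs by (intro integrable_const_bound[where B=Bh]) auto
    show "integrable M (\<lambda>\<omega>. \<rho> (c (Z i \<omega>)))"
      using \<rho>_abs by (intro integrable_const_bound[where B=Bh]) auto
    have "(\<lambda>\<omega>. c (Z i \<omega>)) \<in> measurable ?F borel"
      by (rule measurable_vimage_algebra1) auto
    then show "(\<lambda>\<omega>. \<rho> (c (Z i \<omega>))) \<in> borel_measurable ?F" by measurable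
  qed
  have gh: "\<bar>g z * h x\<bar> \<le> Bg * Bh" "\<bar>g z * \<rho> x\<bar> \<le> Bg * Bh" for z x
    using g_nonneg[of z] g_le[of z] h_abs[of x] \<rho>_abs[of x] bounds by (auto simp: abs_mult intro!: mult_mono)
  have "expectation (\<lambda>\<omega>. g (Z i \<omega>) * real_cond_exp M ?F (\<lambda>\<omega>. h (\<Sum>j\<in>J. f (c (Z j \<omega>)))) \<omega>) =
    expectation (\<lambda>\<omega>. g (Z i \<omega>) * \<rho> (c (Z i \<omega>)))"
    unfolding sum_R
  proof (rule integral_cong_AE)
    show "(\<lambda>\<omega>. g (Z i \<omega>) * real_cond_exp M ?F (\<lambda>\<omega>. h (f (c (Z i \<omega>)) + R \<omega>)) \<omega>) \<in> borel_measurable M"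
      by measurable
    show "AE \<omega> in M. g (Z i \<omega>) * real_cond_exp M ?F (\<lambda>\<omega>. h (f (c (Z i \<omega>)) + R \<omega>)) \<omega> = g (Z i \<omega>) * \<rho> (c (Z i \<omega>))"
      using ce by eventually_elim simp
  qed measurable
  also have "\<dots> = (\<integral>z. \<integral>r. g z * \<rho> (c z) \<partial>Q \<partial>P)"
    using gh(2) by (rule joint[rotated]) measurable
  also have "\<dots> = (\<integral>z. \<integral>r. g z * h (f (c z) + r) \<partial>Q \<partial>P)"
    by (simp add: \<rho>_def Q.prob_space)
  also have "\<dots> = expectation (\<lambda>\<omega>. g (Z i \<omega>) * h (f (c (Z i \<omega>)) + R \<omega>))"
    using gh(1) by (rule joint[rotated, symmetric]) measurable
  also have "\<dots> = reward (card J)"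
    using reward_eq[OF J] by (simp only: sum_R)
  finally show ?thesis .
qed

end

section \<open>Claims driven by the Hawkes process\<close>

text \<open>Claims of both sequences are indexed by their source, so that they form a single family;
  the value at \<open>Noise\<close> is a dummy.\<close>

fun claim_vector ::
  "(nat \<Rightarrow> 'w \<Rightarrow> real) \<Rightarrow> (nat \<Rightarrow> 'w \<Rightarrow> real) \<Rightarrow> (nat \<Rightarrow> 'w \<Rightarrow> real) \<Rightarrow> (nat \<Rightarrow> 'w \<Rightarrow> real) \<Rightarrow>
   source \<Rightarrow> 'w \<Rightarrow> real \<times> real" where
  "claim_vector \<eta> \<theta> \<eta>' \<theta>' Noise = (\<lambda>\<omega>. (0, 0))"
| "claim_vector \<eta> \<theta> \<eta>' \<theta>' (Claim i) = (\<lambda>\<omega>. (\<eta> i \<omega>, \<theta> i \<omega>))"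
| "claim_vector \<eta> \<theta> \<eta>' \<theta>' (Claim_bar i) = (\<lambda>\<omega>. (\<eta>' i \<omega>, \<theta>' i \<omega>))"

abbreviation claim_sources :: "source set" where
  "claim_sources \<equiv> Claim ` {1..} \<union> Claim_bar ` {1..}"

locale hawkes_claims = hawkes_model M T N \<mu> \<Phi> H \<Lambda>
  for M :: "'w measure" and T :: real and N :: "'w \<Rightarrow> (real \<times> real) measure"
    and \<mu> :: real and \<Phi> :: "real \<Rightarrow> real" and H :: "real \<Rightarrow> 'w \<Rightarrow> nat" and \<Lambda> :: "real \<Rightarrow> 'w \<Rightarrow> real" +
  fixes \<eta> \<theta> \<eta>' \<theta>' :: "nat \<Rightarrow> 'w \<Rightarrow> real" and f h :: "real \<Rightarrow> real" and g :: "real \<times> real \<Rightarrow> real"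
    and Bg Bh :: real
  assumes claims: "claim_sequences M N T \<eta> \<theta> \<eta>' \<theta>'"
    and f_on: "f \<in> borel_measurable (restrict_space borel {0..})"
    and f_pos: "\<And>x. 0 \<le> x \<Longrightarrow> 0 \<le> f x"
    and g_on: "g \<in> borel_measurable (restrict_space borel ({0..} \<times> {0..}))"
    and g_pos: "\<And>x y. 0 \<le> x \<Longrightarrow> 0 \<le> y \<Longrightarrow> 0 \<le> g (x, y)"
    and g_bd: "\<And>x y. 0 \<le> x \<Longrightarrow> 0 \<le> y \<Longrightarrow> g (x, y) \<le> Bg"
    and h_on: "h \<in> borel_measurable (restrict_space borel {0..})"
    and h_pos: "\<And>x. 0 \<le> x \<Longrightarrow> 0 \<le> h x" and h_bd: "\<And>x. 0 \<le> x \<Longrightarrow> h x \<le> Bh"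
    and h_incr: "mono_on {0..} h"
begin

abbreviation Z :: "source \<Rightarrow> 'w \<Rightarrow> real \<times> real" where "Z \<equiv> claim_vector \<eta> \<theta> \<eta>' \<theta>'"

abbreviation events_of :: "source \<Rightarrow> 'w set set" where
  "events_of \<equiv> source_events M N T \<eta> \<theta> \<eta>' \<theta>'"

text \<open>The data functions are only given on nonnegative arguments.\<close>

definition f0 :: "real \<Rightarrow> real" where "f0 x = f (max 0 x)"
definition h0 :: "real \<Rightarrow> real" where "h0 x = h (max 0 x)"
definition g0 :: "real \<times> real \<Rightarrow> real" where "g0 z = g (max 0 (fst z), max 0 (snd z))"

lemma claim_source_events:
  "s \<in> claim_sources \<Longrightarrow> events_of s = {Z s -` A \<inter> space M | A. A \<in> sets borel}"
  by (elim UnE imageE) (simp_all add: sets_vimage_algebra2)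

lemma indep_sources:
  "indep_sets (events_of) ({Noise} \<union> claim_sources)"
  using claims by (simp add: claim_sequences_def Un_assoc)

lemma Z_random: "s \<in> claim_sources \<Longrightarrow> Z s \<in> borel_measurable M"
proof -
  have "\<eta> i \<in> borel_measurable M" "\<theta> i \<in> borel_measurable M" "\<eta>' i \<in> borel_measurable M" "\<theta>' i \<in> borel_measurable M"
    if "1 \<le> i" for i
    using claims that by (simp_all add: claim_sequences_def)
  then have "(\<lambda>\<omega>. (\<eta> i \<omega>, \<theta> i \<omega>)) \<in> borel_measurable M" "(\<lambda>\<omega>. (\<eta>' i \<omega>, \<theta>' i \<omega>)) \<in> borel_measurable M"
    if "1 \<le> i" for i
    using that by measurable
  then show "Z s \<in> borel_measurable M" if "s \<in> claim_sources" using that by auto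
qed

lemma Z_nonneg: "s \<in> claim_sources \<Longrightarrow> \<omega> \<in> space M \<Longrightarrow> 0 \<le> fst (Z s \<omega>) \<and> 0 \<le> snd (Z s \<omega>)"
  using claims by (auto simp: claim_sequences_def)

lemma f0_Z: "s \<in> claim_sources \<Longrightarrow> \<omega> \<in> space M \<Longrightarrow> f0 (fst (Z s \<omega>)) = f (fst (Z s \<omega>))"
  using Z_nonneg[of s \<omega>] by (simp add: f0_def max_absorb2)

lemma g0_Z: "s \<in> claim_sources \<Longrightarrow> \<omega> \<in> space M \<Longrightarrow> g0 (Z s \<omega>) = g (Z s \<omega>)"
  using Z_nonneg[of s \<omega>] by (simp add: g0_def max_absorb2)

lemma h0_sum: "(\<And>i. i \<in> J \<Longrightarrow> 0 \<le> x i) \<Longrightarrow> h0 (sum x J) = h (sum x J)"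
  by (simp add: h0_def max_absorb2 sum_nonneg)

lemma max_0_measurable: "max (0::real) \<in> measurable borel (restrict_space borel {0..})"
  by (intro measurable_restrict_space2) auto

sublocale iid_rewards M Z claim_sources borel "distr M borel (Z (Claim 1))" fst f0 h0 g0 Bg Bh
proof
  show "indep_vars (\<lambda>_. borel) Z claim_sources"
    unfolding indep_vars_def2
  proof
    show "\<forall>s\<in>claim_sources. Z s \<in> borel_measurable M" using Z_random by blast
    show "indep_sets (\<lambda>s. {Z s -` A \<inter> space M | A. A \<in> sets borel}) claim_sources"
      using indep_sources by (rule indep_sets_mono) (auto simp: claim_source_events)
  qed
  show "distr M borel (Z s) = distr M borel (Z (Claim 1))" if s: "s \<in> claim_sources" for s
  proof -
    have "\<forall>i\<ge>1. distr M borel (Z (Claim i)) = distr M borel (Z (Claim 1)) \<and>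
        distr M borel (Z (Claim_bar i)) = distr M borel (Z (Claim 1))"
      using claims unfolding claim_sequences_def claim_vector.simps by (elim conjE)
    moreover obtain i where "s = Claim i \<or> s = Claim_bar i" "i \<in> {1..}" using s by blast
    ultimately show ?thesis by (metis atLeast_iff)
  qed
  show "f0 \<in> borel_measurable borel"
    unfolding f0_def[abs_def] by (rule measurable_compose[OF max_0_measurable f_on])
  show "h0 \<in> borel_measurable borel"
    unfolding h0_def[abs_def] by (rule measurable_compose[OF max_0_measurable h_on])
  have "(\<lambda>z :: real \<times> real. (max 0 (fst z), max 0 (snd z))) \<in> measurable borel (restrict_space borel ({0..} \<times> {0..}))"
    by (intro measurable_restrict_space2 borel_measurable_continuous_onI continuous_intros) auto
  then show "g0 \<in> borel_measurable borel"
    unfolding g0_def[abs_def] by (rule measurable_compose[OF _ g_on])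
  show "mono h0"
    unfolding h0_def by (intro monoI mono_onD[OF h_incr]) auto
  show "fst \<in> borel_measurable (borel :: (real \<times> real) measure)"
    by (intro borel_measurable_continuous_onI continuous_intros)
qed (auto simp: f0_def g0_def h0_def f_pos g_pos g_bd h_pos h_bd)

text \<open>The variable K_T h(L_T) with the number of claims frozen at \<open>m\<close>; for fixed
  \<open>m\<close> it is independent of the noise.\<close>

definition portfolio :: "nat \<Rightarrow> 'w \<Rightarrow> real" where
  "portfolio m \<omega> = (\<Sum>i\<in>Claim ` {1..m}. g0 (Z i \<omega>)) * h0 (\<Sum>j\<in>Claim ` {1..m}. f0 (fst (Z j \<omega>)))"

lemma portfolio_eq:
  assumes "\<omega> \<in> space M"
  shows "portfolio m \<omega> = (\<Sum>i=1..m. g (\<eta> i \<omega>, \<theta> i \<omega>)) * h (\<Sum>i=1..m. f (\<eta> i \<omega>))"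
proof -
  have inj: "inj_on Claim {1..m}" by (simp add: inj_on_def)
  have nn: "0 \<le> \<eta> i \<omega>" if "i \<in> {1..m}" for i
    using claims assms that by (simp add: claim_sequences_def)
  have "(\<Sum>i\<in>Claim ` {1..m}. g0 (Z i \<omega>)) = (\<Sum>i=1..m. g (\<eta> i \<omega>, \<theta> i \<omega>))"
    unfolding sum.reindex[OF inj] using g0_Z[OF _ assms, of "Claim i" for i] by (intro sum.cong) auto
  moreover have "(\<Sum>j\<in>Claim ` {1..m}. f0 (fst (Z j \<omega>))) = (\<Sum>i=1..m. f (\<eta> i \<omega>))"
    unfolding sum.reindex[OF inj] using f0_Z[OF _ assms, of "Claim i" for i] by (intro sum.cong) auto
  moreover have "h0 (\<Sum>i=1..m. f (\<eta> i \<omega>)) = h (\<Sum>i=1..m. f (\<eta> i \<omega>))"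
    using nn by (intro h0_sum f_pos) auto
  ultimately show ?thesis by (simp add: portfolio_def)
qed

lemma portfolio_nonneg: "0 \<le> portfolio m \<omega>"
  unfolding portfolio_def by (intro mult_nonneg_nonneg sum_nonneg) (auto simp: g0_def h0_def intro!: g_pos h_pos)

lemma portfolio_le: "portfolio m \<omega> \<le> real m * (Bg * Bh)"
proof -
  have "portfolio m \<omega> \<le> (\<Sum>i\<in>Claim ` {1..m}. Bg) * Bh"
    unfolding portfolio_def using bounds
    by (intro mult_mono sum_mono sum_nonneg) (auto simp: g0_def h0_def intro!: g_pos h_pos g_bd h_bd)
  also have "\<dots> = real m * (Bg * Bh)" by (simp add: card_image inj_on_def)
  finally show ?thesis .
qed

section \<open>Independence of the claims and the noise\<close>

definition claim_algebra :: "'w measure" where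
  "claim_algebra = sigma (space M) (\<Union>s\<in>claim_sources. events_of s)"

lemma claim_events_Pow: "(\<Union>s\<in>claim_sources. events_of s) \<subseteq> Pow (space M)"
proof (intro UN_least)
  fix s assume "s \<in> claim_sources"
  from claim_source_events[OF this] show "events_of s \<subseteq> Pow (space M)" by auto
qed

lemma sets_claim_algebra:
  "sets claim_algebra = sigma_sets (space M) (\<Union>s\<in>claim_sources. events_of s)"
  unfolding claim_algebra_def using claim_events_Pow by (rule sets_measure_of)

lemma space_claim_algebra: "space claim_algebra = space M"
  unfolding claim_algebra_def using claim_events_Pow by (rule space_measure_of)

lemma Z_claim_algebra: "s \<in> claim_sources \<Longrightarrow> Z s \<in> borel_measurable claim_algebra"
proof (rule measurableI)
  fix A :: "(real \<times> real) set" assume s: "s \<in> claim_sources" and "A \<in> sets borel"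
  then have "Z s -` A \<inter> space M \<in> events_of s"
    unfolding claim_source_events[OF s] by blast
  then show "Z s -` A \<inter> space claim_algebra \<in> sets claim_algebra"
    unfolding sets_claim_algebra space_claim_algebra using s by (intro sigma_sets.Basic) blast
qed simp

lemma portfolio_claim_algebra: "portfolio m \<in> borel_measurable claim_algebra"
proof -
  have Z: "Z s \<in> borel_measurable claim_algebra" if "s \<in> Claim ` {1..m}" for s
    using that by (intro Z_claim_algebra) auto
  show ?thesis
    unfolding portfolio_def[abs_def]
    by (intro borel_measurable_times measurable_compose[OF _ h_meas] borel_measurable_sum
        measurable_compose[OF Z g_meas] measurable_compose[OF measurable_compose[OF Z c_meas] f_meas])
qed

text \<open>Grouping of independent sigma-algebras: the sources are split into the noise alone and
  all claims together.\<close>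

lemma indep_noise_claims: "indep_set (sets (noise_filtration M N T)) (sets claim_algebra)"
proof -
  let ?I = "\<lambda>b. if b then {Noise} else claim_sources"
  have "indep_sets (\<lambda>b. sigma_sets (space M) (\<Union>s\<in>?I b. events_of s)) UNIV"
  proof (rule indep_sets_collect_sigma)
    show "indep_sets events_of (\<Union>b. ?I b)"
      using indep_sources by (rule indep_sets_mono_index[rotated]) (auto split: if_splits)
    show "Int_stable (events_of s)" if "s \<in> ?I b" for b s
    proof -
      have "\<exists>K. events_of s = sets K" by (cases s) auto
      then show ?thesis by (auto simp: Int_stable_def)
    qed
    show "disjoint_family_on ?I UNIV" by (auto simp: disjoint_family_on_def)
  qed
  also have "(\<lambda>b. sigma_sets (space M) (\<Union>s\<in>?I b. events_of s)) =
      case_bool (sets (noise_filtration M N T)) (sets claim_algebra)"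
  proof
    fix b
    have "sigma_sets (space M) (sets (noise_filtration M N T)) = sets (noise_filtration M N T)"
      using sets.sigma_sets_eq[of "noise_filtration M N T"] by (simp add: noise_filtration_def space_measure_of_conv)
    then show "sigma_sets (space M) (\<Union>s\<in>?I b. events_of s) =
        case_bool (sets (noise_filtration M N T)) (sets claim_algebra) b"
      by (cases b) (simp_all add: sets_claim_algebra)
  qed
  finally show ?thesis unfolding indep_set_def .
qed

lemma portfolio_meas[measurable]: "portfolio m \<in> borel_measurable M"
proof (rule measurableI)
  fix A :: "real set" assume "A \<in> sets borel"
  then have "portfolio m -` A \<inter> space M \<in> sets claim_algebra"
    using measurable_sets[OF portfolio_claim_algebra] by (simp add: space_claim_algebra)
  then show "portfolio m -` A \<inter> space M \<in> events"
    using indep_noise_claims unfolding indep_set_def indep_sets_def by (auto simp: UNIV_bool)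
qed simp

lemma expectation_noise_portfolio:
  assumes X: "X \<in> sets (noise_filtration M N T)"
  shows "expectation (\<lambda>\<omega>. indicator X \<omega> * portfolio m \<omega>) = prob X * (real m * reward m)"
proof -
  have Xe: "X \<in> events"
    using indep_noise_claims X unfolding indep_set_def indep_sets_def by (auto simp: UNIV_bool)
  have sp: "space (noise_filtration M N T) = space M"
    by (simp add: noise_filtration_def space_measure_of_conv)
  have sub: "sigma_sets (space M) {V -` A \<inter> space M | A. A \<in> sets borel} \<subseteq> sets K"
    if "V \<in> borel_measurable K" "space K = space M" for V :: "'w \<Rightarrow> real" and K
    using measurable_sets[OF that(1)] unfolding that(2)[symmetric]
    by (intro sets.sigma_sets_subset) auto
  have "indep_var borel (indicator X) borel (portfolio m)"
    unfolding indep_var_eq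
  proof (intro conjI)
    have "indep_sets (case_bool (sigma_sets (space M) {indicator X -` A \<inter> space M | A. A \<in> sets (borel :: real measure)})
        (sigma_sets (space M) {portfolio m -` A \<inter> space M | A. A \<in> sets borel})) UNIV"
      using indep_noise_claims unfolding indep_set_def
    proof (rule indep_sets_mono_sets)
      fix b
      show "case_bool (sigma_sets (space M) {indicator X -` A \<inter> space M | A. A \<in> sets (borel :: real measure)})
          (sigma_sets (space M) {portfolio m -` A \<inter> space M | A. A \<in> sets borel}) b \<subseteq>
        case_bool (sets (noise_filtration M N T)) (sets claim_algebra) b"
        using sub[OF borel_measurable_indicator[OF X] sp] sub[OF portfolio_claim_algebra space_claim_algebra]
        by (cases b) simp_all
    qed
    then show "indep_set (sigma_sets (space M) {indicator X -` A \<inter> space M | A. A \<in> sets (borel :: real measure)})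
        (sigma_sets (space M) {portfolio m -` A \<inter> space M | A. A \<in> sets borel})"
      unfolding indep_set_def .
  qed (use Xe in auto)
  moreover have "integrable M (portfolio m)"
    using portfolio_nonneg portfolio_le
    by (intro integrable_const_bound[where B="real m * (Bg * Bh)"]) auto
  moreover have "integrable M (indicator X :: 'w \<Rightarrow> real)"
    using Xe by (intro integrable_const_bound[where B=1]) (auto simp: indicator_def)
  ultimately have "expectation (\<lambda>\<omega>. indicator X \<omega> * portfolio m \<omega>) = expectation (indicator X) * expectation (portfolio m)"
    by (intro indep_var_lebesgue_integral)
  also have "expectation (portfolio m) = real m * reward m"
    using total_reward[of "Claim ` {1..m}"] by (simp add: portfolio_def[abs_def] card_image inj_on_def image_subset_iff)
  finally show ?thesis using Xe by simp
qed

text \<open>\<open>lower_bound\<close> needs a monotone Borel function of \<open>ennreal\<close>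
  counts. The supremum over \<open>m \<ge> 1\<close> below the argument extends
  \<open>reward\<close> in this way and avoids the meaningless \<open>reward 0\<close>.\<close>

definition reward_ext :: "ennreal \<Rightarrow> ennreal" where
  "reward_ext x = (SUP m\<in>{1..}. ennreal (reward m) * indicator {of_nat m..} x)"

lemma reward_ext_mono: "mono reward_ext"
  unfolding reward_ext_def by (intro monoI SUP_mono) (auto simp: indicator_def intro: order_trans)

lemma reward_ext_meas: "reward_ext \<in> borel_measurable borel"
  unfolding reward_ext_def by measurable

lemma infinite_claim_sources: "infinite claim_sources"
proof -
  have "infinite (Claim ` {1::nat..})"
    by (subst finite_image_iff) (auto simp: inj_on_def infinite_Ici)
  then show ?thesis by simp
qed

text \<open>\<open>reward\<close> is nondecreasing from 1 on, so the supremum is attained at the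
  largest admissible index.\<close>

lemma reward_ext_of_nat: "1 \<le> k \<Longrightarrow> reward_ext (of_nat k) = ennreal (reward k)"
proof (rule antisym)
  assume k: "1 \<le> k"
  show "reward_ext (of_nat k) \<le> ennreal (reward k)"
    unfolding reward_ext_def
  proof (rule SUP_least)
    fix m :: nat assume m: "m \<in> {1..}"
    show "ennreal (reward m) * indicator {of_nat m..} (of_nat k :: ennreal) \<le> ennreal (reward k)"
    proof (cases "m \<le> k")
      case True
      have "ennreal (reward m) * indicator {of_nat m..} (of_nat k :: ennreal) \<le> ennreal (reward m) * 1"
        by (intro mult_left_mono) (auto simp: indicator_def)
      also have "\<dots> \<le> ennreal (reward k)"
        using reward_mono[OF infinite_claim_sources _ True] m by (simp add: ennreal_leI)
      finally show ?thesis .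
    qed simp
  qed
  show "ennreal (reward k) \<le> reward_ext (of_nat k)"
    unfolding reward_ext_def using k by (intro SUP_upper2[of k]) auto
qed

lemma portfolio_at_H_meas[measurable]: "(\<lambda>\<omega>. portfolio (H T \<omega>) \<omega>) \<in> borel_measurable M"
  by (rule measurable_compose_countable[OF portfolio_meas measurable_H_T])

lemma nn_expectation_portfolio:
  "(\<integral>\<^sup>+\<omega>. ennreal (portfolio (H T \<omega>) \<omega>) \<partial>M) = (\<integral>\<^sup>+\<omega>. of_nat (H T \<omega>) * reward_ext (of_nat (H T \<omega>)) \<partial>M)"
proof -
  let ?X = "\<lambda>m. {\<omega>\<in>space M. H T \<omega> = m}"
  have Xn: "?X m \<in> sets (noise_filtration M N T)" for m
  proof -
    have "H T \<in> measurable (noise_filtration M N T) (count_space UNIV)"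
      using hawkes T by (simp add: hawkes_process_def)
    from measurable_sets[OF this, of "{m}"] show ?thesis
      by (simp add: noise_filtration_def space_measure_of_conv vimage_def Int_def conj_commute)
  qed
  have Xe: "?X m \<in> events" for m by measurable
  have "(\<integral>\<^sup>+\<omega>. ennreal (portfolio (H T \<omega>) \<omega>) \<partial>M) = (\<integral>\<^sup>+\<omega>. (\<Sum>m. ennreal (indicator (?X m) \<omega> * portfolio m \<omega>)) \<partial>M)"
  proof (rule nn_integral_cong)
    fix \<omega> assume \<omega>: "\<omega> \<in> space M"
    have "(\<Sum>m. ennreal (indicator (?X m) \<omega> * portfolio m \<omega>)) = (\<Sum>m\<in>{H T \<omega>}. ennreal (indicator (?X m) \<omega> * portfolio m \<omega>))"
      by (rule suminf_finite) auto
    then show "ennreal (portfolio (H T \<omega>) \<omega>) = (\<Sum>m. ennreal (indicator (?X m) \<omega> * portfolio m \<omega>))"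
      using \<omega> by simp
  qed
  also have "\<dots> = (\<Sum>m. \<integral>\<^sup>+\<omega>. ennreal (indicator (?X m) \<omega> * portfolio m \<omega>) \<partial>M)"
    by (rule nn_integral_suminf) measurable
  also have "\<dots> = (\<Sum>m. of_nat m * reward_ext (of_nat m) * emeasure M (space M \<inter> ?X m))"
  proof (rule suminf_cong)
    fix m
    have "integrable M (\<lambda>\<omega>. indicator (?X m) \<omega> * portfolio m \<omega>)"
    proof (rule integrable_const_bound[where B="real m * (Bg * Bh)"])
      have "0 \<le> real m * (Bg * Bh)" using portfolio_nonneg portfolio_le order_trans by blast
      then show "AE \<omega> in M. norm (indicator (?X m) \<omega> * portfolio m \<omega>) \<le> real m * (Bg * Bh)"
        using portfolio_nonneg portfolio_le by (auto simp: indicator_def)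
    qed measurable
    then have "(\<integral>\<^sup>+\<omega>. ennreal (indicator (?X m) \<omega> * portfolio m \<omega>) \<partial>M) = ennreal (prob (?X m) * (real m * reward m))"
      using portfolio_nonneg
      by (subst nn_integral_eq_integral) (auto simp: expectation_noise_portfolio[OF Xn] simp del: mem_Collect_eq)
    also have "\<dots> = of_nat m * ennreal (reward m) * emeasure M (space M \<inter> ?X m)"
    proof -
      have eq: "space M \<inter> ?X m = ?X m" by auto
      have "ennreal (prob (?X m) * (real m * reward m)) = ennreal (prob (?X m)) * (ennreal (real m) * ennreal (reward m))"
        using reward_nonneg by (simp only: ennreal_mult measure_nonneg of_nat_0_le_iff mult_nonneg_nonneg)
      then show ?thesis
        unfolding eq by (simp only: emeasure_eq_measure ennreal_of_nat_eq_real_of_nat ac_simps)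
    qed
    also have "of_nat m * ennreal (reward m) = of_nat m * reward_ext (of_nat m)"
      \<comment> \<open>For \<open>m = 0\<close> the two rewards may differ, but the factor
        \<open>of_nat m\<close> annihilates both.\<close>
      using reward_ext_of_nat[of m] by (cases "m = 0") auto
    finally show "(\<integral>\<^sup>+\<omega>. ennreal (indicator (?X m) \<omega> * portfolio m \<omega>) \<partial>M) =
        of_nat m * reward_ext (of_nat m) * emeasure M (space M \<inter> ?X m)" .
  qed
  also have "\<dots> = (\<integral>\<^sup>+\<omega>. of_nat (H T \<omega>) * reward_ext (of_nat (H T \<omega>)) * indicator (space M) \<omega> \<partial>M)"
  proof -
    have "(\<lambda>\<omega>. of_nat (H T \<omega>) :: ennreal) \<in> borel_measurable M"
      by (rule measurable_compose[OF measurable_H_T]) simp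
    from nn_integral_nat_valued[OF this, of "space M" "\<lambda>x. x * reward_ext x"] show ?thesis
      by simp
  qed
  also have "\<dots> = (\<integral>\<^sup>+\<omega>. of_nat (H T \<omega>) * reward_ext (of_nat (H T \<omega>)) \<partial>M)"
    by (intro nn_integral_cong) simp
  finally show ?thesis .
qed

text \<open>The \<open>n + 1\<close> barred and the \<open>p\<close> unbarred claims are distinct
  members of one family, so \<open>conditional_reward\<close> applies with \<open>p + Suc n\<close>
  claims. The given functions and their extensions agree on the nonnegative values taken by the
  claims.\<close>

lemma conditional_term:
  "expectation (\<lambda>\<omega>. g (\<eta>' 1 \<omega>, \<theta>' 1 \<omega>) *
    real_cond_exp M (vimage_algebra (space M) (\<eta>' 1) borel)
      (\<lambda>\<omega>. h ((\<Sum>k=1..Suc n. f (\<eta>' k \<omega>)) + (\<Sum>i=1..p. f (\<eta> i \<omega>)))) \<omega>) = reward (p + Suc n)"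
proof -
  define J where "J = Claim_bar ` {1..Suc n} \<union> Claim ` {1..p}"
  have inj: "inj_on Claim A" "inj_on Claim_bar A" for A by (auto simp: inj_on_def)
  have J: "finite J" "J \<subseteq> claim_sources" "Claim_bar 1 \<in> J" by (auto simp: J_def)
  have disj: "Claim_bar ` {1..Suc n} \<inter> Claim ` {1..p} = {}" by auto
  have card: "card J = p + Suc n"
    unfolding J_def using disj by (subst card_Un_disjoint) (auto simp: card_image inj)
  have sum: "(\<Sum>j\<in>J. f0 (fst (Z j \<omega>))) = (\<Sum>k=1..Suc n. f (\<eta>' k \<omega>)) + (\<Sum>i=1..p. f (\<eta> i \<omega>))"
    if \<omega>: "\<omega> \<in> space M" for \<omega>
  proof -
    have "(\<Sum>j\<in>J. f0 (fst (Z j \<omega>))) = (\<Sum>j\<in>J. f (fst (Z j \<omega>)))"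
      using J(2) f0_Z[OF _ \<omega>] by (intro sum.cong) auto
    also have "\<dots> = (\<Sum>j\<in>Claim_bar ` {1..Suc n}. f (fst (Z j \<omega>))) + (\<Sum>j\<in>Claim ` {1..p}. f (fst (Z j \<omega>)))"
      unfolding J_def using disj by (intro sum.union_disjoint) auto
    finally show ?thesis by (simp add: sum.reindex inj)
  qed
  have h0: "h0 (\<Sum>j\<in>J. f0 (fst (Z j \<omega>))) = h ((\<Sum>k=1..Suc n. f (\<eta>' k \<omega>)) + (\<Sum>i=1..p. f (\<eta> i \<omega>)))"
    if \<omega>: "\<omega> \<in> space M" for \<omega>
  proof -
    have "0 \<le> (\<Sum>j\<in>J. f0 (fst (Z j \<omega>)))" by (intro sum_nonneg f_nonneg)
    then show ?thesis unfolding sum[OF \<omega>, symmetric] by (simp add: h0_def max_absorb2)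
  qed
  let ?F = "vimage_algebra (space M) (\<eta>' 1) borel"
  have meas: "(\<lambda>\<omega>. h0 (\<Sum>j\<in>J. f0 (fst (Z j \<omega>)))) \<in> borel_measurable M"
    by (rule measurable_compose[OF sum_meas[OF J(2)] h_meas])
  have \<eta>': "\<eta>' 1 \<in> borel_measurable M" using claims by (simp add: claim_sequences_def)
  interpret F: sigma_finite_subalgebra M ?F
  proof (rule finite_measure_subalgebra_is_sigma_finite)
    have "sets ?F = {\<eta>' 1 -` A \<inter> space M | A. A \<in> sets borel}"
      by (rule sets_vimage_algebra2) auto
    then have "subalgebra M ?F"
      unfolding subalgebra_def using measurable_sets[OF \<eta>'] by auto
    then show "finite_measure_subalgebra M ?F"
      by (intro finite_measure_subalgebra.intro finite_measure_subalgebra_axioms.intro finite_measure_axioms)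
  qed
  have "AE \<omega> in M. real_cond_exp M ?F (\<lambda>\<omega>. h0 (\<Sum>j\<in>J. f0 (fst (Z j \<omega>)))) \<omega> =
    real_cond_exp M ?F (\<lambda>\<omega>. h ((\<Sum>k=1..Suc n. f (\<eta>' k \<omega>)) + (\<Sum>i=1..p. f (\<eta> i \<omega>)))) \<omega>"
  proof (rule F.real_cond_exp_cong[OF _ meas])
    show "AE \<omega> in M. h0 (\<Sum>j\<in>J. f0 (fst (Z j \<omega>))) = h ((\<Sum>k=1..Suc n. f (\<eta>' k \<omega>)) + (\<Sum>i=1..p. f (\<eta> i \<omega>)))"
      using h0 by (intro AE_I2)
    show "(\<lambda>\<omega>. h ((\<Sum>k=1..Suc n. f (\<eta>' k \<omega>)) + (\<Sum>i=1..p. f (\<eta> i \<omega>)))) \<in> borel_measurable M"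
      using meas by (subst measurable_cong[OF h0[symmetric]])
  qed
  then have "AE \<omega> in M. g (\<eta>' 1 \<omega>, \<theta>' 1 \<omega>) * real_cond_exp M ?F (\<lambda>\<omega>. h ((\<Sum>k=1..Suc n. f (\<eta>' k \<omega>)) + (\<Sum>i=1..p. f (\<eta> i \<omega>)))) \<omega> =
    g0 (Z (Claim_bar 1) \<omega>) * real_cond_exp M ?F (\<lambda>\<omega>. h0 (\<Sum>j\<in>J. f0 (fst (Z j \<omega>)))) \<omega>"
    using AE_space by eventually_elim (use g0_Z[of "Claim_bar 1"] in simp)
  moreover have g_m: "(\<lambda>\<omega>. g0 (Z (Claim_bar 1) \<omega>)) \<in> borel_measurable M"
    by (rule measurable_compose[OF Z_random g_meas]) simp
  moreover have "(\<lambda>\<omega>. g (\<eta>' 1 \<omega>, \<theta>' 1 \<omega>)) \<in> borel_measurable M"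
    using g_m by (subst measurable_cong[where g="\<lambda>\<omega>. g0 (Z (Claim_bar 1) \<omega>)"]) (use g0_Z[of "Claim_bar 1"] in auto)
  ultimately have "expectation (\<lambda>\<omega>. g (\<eta>' 1 \<omega>, \<theta>' 1 \<omega>) *
      real_cond_exp M ?F (\<lambda>\<omega>. h ((\<Sum>k=1..Suc n. f (\<eta>' k \<omega>)) + (\<Sum>i=1..p. f (\<eta> i \<omega>)))) \<omega>) =
    expectation (\<lambda>\<omega>. g0 (Z (Claim_bar 1) \<omega>) * real_cond_exp M ?F (\<lambda>\<omega>. h0 (\<Sum>j\<in>J. f0 (fst (Z j \<omega>)))) \<omega>)"
    by (intro integral_cong_AE) auto
  also have "\<dots> = reward (card J)"
    using conditional_reward[OF J] by simp
  finally show ?thesis unfolding card .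
qed

text \<open>Transfers \<open>lower_bound\<close> to real numbers. A real infinite sum is only
  meaningful if it is summable, so the inner series is dominated by the Poisson weights and the
  outer one is controlled through its partial sums.\<close>

theorem portfolio_bound:
  "\<mu> * (\<Sum>n. m_Phi \<Phi> T (Suc n) * (\<Sum>p. exp (- T * \<mu>) * (T * \<mu>) ^ p / fact p * reward (p + Suc n)))
    \<le> expectation (\<lambda>\<omega>. portfolio (H T \<omega>) \<omega>)"
proof -
  define q where "q p = exp (- T * \<mu>) * (T * \<mu>) ^ p / fact p" for p
  have q: "0 \<le> q p" "summable q" for p
    using T \<mu> poisson_sums[of "T * \<mu>"] by (auto simp: q_def[abs_def] sums_iff)
  define inner where "inner n = (\<Sum>p. q p * reward (p + Suc n))" for n
  have r_le: "reward m \<le> Bg * Bh" if "1 \<le> m" for m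
  proof -
    have "reward m = expectation (\<lambda>\<omega>. g0 (Z (Claim 1) \<omega>) * h0 (\<Sum>j\<in>Claim ` {1..m}. f0 (fst (Z j \<omega>))))"
      using reward_eq[of "Claim ` {1..m}" "Claim 1"] that by (simp add: card_image inj_on_def image_subset_iff)
    also have "\<dots> \<le> expectation (\<lambda>\<omega>. Bg * Bh)"
      using bounds g_nonneg g_le h_nonneg h_le
      by (intro integral_mono integrable_reward mult_mono) auto
    finally show ?thesis by (simp add: prob_space)
  qed
  have inner_sum: "summable (\<lambda>p. q p * reward (p + Suc n))" for n
  proof (rule summable_comparison_test')
    show "summable (\<lambda>p. q p * (Bg * Bh))" using q(2) by (rule summable_mult2)
    show "norm (q p * reward (p + Suc n)) \<le> q p * (Bg * Bh)" if "0 \<le> p" for p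
      using q(1) r_le[of "p + Suc n"] reward_nonneg[of "p + Suc n"] by (simp add: mult_left_mono)
  qed
  have inner_nonneg: "0 \<le> inner n" for n
    unfolding inner_def using q reward_nonneg by (intro suminf_nonneg inner_sum) auto
  have inner: "ennreal (inner n) = (\<integral>\<^sup>+\<omega>. reward_ext (base \<omega> + of_nat (Suc n)) \<partial>M)" for n
  proof -
    have "(\<integral>\<^sup>+\<omega>. reward_ext (base \<omega> + of_nat (Suc n)) \<partial>M) = (\<Sum>p. reward_ext (of_nat p + of_nat (Suc n)) * ennreal (q p))"
      unfolding q_def by (rule base_law)
    also have "\<dots> = (\<Sum>p. ennreal (q p * reward (p + Suc n)))"
    proof (rule suminf_cong)
      fix p
      have "reward_ext (of_nat p + of_nat (Suc n)) = ennreal (reward (p + Suc n))"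
        unfolding of_nat_add[symmetric] by (rule reward_ext_of_nat) simp
      then show "reward_ext (of_nat p + of_nat (Suc n)) * ennreal (q p) = ennreal (q p * reward (p + Suc n))"
        using q(1) reward_nonneg by (simp add: ennreal_mult mult.commute)
    qed
    also have "\<dots> = ennreal (inner n)"
      unfolding inner_def using q reward_nonneg by (intro suminf_ennreal2 inner_sum) auto
    finally show ?thesis ..
  qed
  define L where "L = expectation (\<lambda>\<omega>. portfolio (H T \<omega>) \<omega>)"
  \<comment> \<open>The portfolio grows at most linearly in the number of claims, so
    \<open>mean_finite\<close> suffices.\<close>
  have int: "integrable M (\<lambda>\<omega>. portfolio (H T \<omega>) \<omega>)"
  proof (rule integrableI_bounded)
    have "(\<integral>\<^sup>+\<omega>. ennreal (norm (portfolio (H T \<omega>) \<omega>)) \<partial>M) \<le> (\<integral>\<^sup>+\<omega>. ennreal (Bg * Bh) * of_nat (H T \<omega>) \<partial>M)"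
    proof (rule nn_integral_mono)
      fix \<omega>
      have "ennreal (norm (portfolio (H T \<omega>) \<omega>)) \<le> ennreal (real (H T \<omega>) * (Bg * Bh))"
        using portfolio_nonneg portfolio_le by (intro ennreal_leI) simp
      also have "\<dots> = ennreal (Bg * Bh) * of_nat (H T \<omega>)"
        using bounds by (simp add: ennreal_mult ennreal_of_nat_eq_real_of_nat ac_simps)
      finally show "ennreal (norm (portfolio (H T \<omega>) \<omega>)) \<le> ennreal (Bg * Bh) * of_nat (H T \<omega>)" .
    qed
    also have "\<dots> = ennreal (Bg * Bh) * (\<integral>\<^sup>+\<omega>. of_nat (H T \<omega>) \<partial>M)"
      by (intro nn_integral_cmult measurable_compose[OF measurable_H_T]) simp
    also have "\<dots> < \<infinity>" using mean_finite by (simp add: ennreal_mult_less_top)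
    finally show "(\<integral>\<^sup>+\<omega>. ennreal (norm (portfolio (H T \<omega>) \<omega>)) \<partial>M) < \<infinity>" .
  qed measurable
  have L: "ennreal L = (\<integral>\<^sup>+\<omega>. of_nat (H T \<omega>) * reward_ext (of_nat (H T \<omega>)) \<partial>M)"
    unfolding L_def nn_expectation_portfolio[symmetric]
    using int portfolio_nonneg by (intro nn_integral_eq_integral[symmetric]) auto
  have L_nonneg: "0 \<le> L"
    unfolding L_def by (rule integral_nonneg_AE) (use portfolio_nonneg in auto)
  let ?t = "\<lambda>n. m_Phi \<Phi> T (Suc n) * inner n"
  have t: "0 \<le> ?t n" for n using inner_nonneg by (simp add: m_Phi_eq)
  have summand: "ennreal \<mu> * mass n * (\<integral>\<^sup>+\<omega>. reward_ext (base \<omega> + of_nat (Suc n)) \<partial>M) = ennreal (\<mu> * ?t n)" for n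
    unfolding inner[symmetric]
    using \<mu> inner_nonneg mass_finite[of n] by (simp add: m_Phi_eq ennreal_mult mult.assoc)
  \<comment> \<open>This bound on all partial sums yields both the summability of the outer series
    and the final inequality.\<close>
  have part: "(\<Sum>n<k. ?t n) \<le> L / \<mu>" for k
  proof -
    have "ennreal (\<Sum>n<k. \<mu> * ?t n) = (\<Sum>n<k. ennreal (\<mu> * ?t n))"
      using \<mu> t by (intro sum_ennreal[symmetric]) simp
    also have "\<dots> \<le> (\<Sum>n. ennreal (\<mu> * ?t n))" by (rule sum_le_suminf) auto
    also have "\<dots> \<le> ennreal L"
      using lower_bound[OF reward_ext_mono reward_ext_meas] unfolding summand L .
    finally have "(\<Sum>n<k. \<mu> * ?t n) \<le> L" using L_nonneg by (simp add: ennreal_le_iff)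
    then show ?thesis using \<mu> by (simp add: pos_le_divide_eq sum_distrib_left mult.commute)
  qed
  have "summable ?t" using t part by (rule summableI_nonneg_bounded)
  then have "(\<Sum>n. ?t n) \<le> L / \<mu>" using part by (intro suminf_le_const)
  then have "\<mu> * (\<Sum>n. ?t n) \<le> L" using \<mu> by (simp add: pos_le_divide_eq mult.commute)
  then show ?thesis unfolding inner_def q_def L_def .
qed

end

theorem corollary4p7:
  fixes M :: "'w measure" and N :: "'w \<Rightarrow> (real \<times> real) measure"
    and T \<mu> :: real and \<Phi> :: "real \<Rightarrow> real"
    and H :: "real \<Rightarrow> 'w \<Rightarrow> nat" and \<Lambda> :: "real \<Rightarrow> 'w \<Rightarrow> real"
    and \<eta> \<theta> \<eta>' \<theta>' :: "nat \<Rightarrow> 'w \<Rightarrow> real"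
    and f h :: "real \<Rightarrow> real" and g :: "real \<times> real \<Rightarrow> real"
  assumes "prob_space M"
    and "T > 0" and "\<mu> > 0"
    and "\<Phi> \<in> borel_measurable (restrict_space borel {0..T})"
    and "\<And>t. t \<in> {0..T} \<Longrightarrow> \<Phi> t \<ge> 0" and "bounded (\<Phi> ` {0..T})"
    and "(LBINT s:{0..T}. \<Phi> s) < 1"
    and "poisson_random_measure M (strip_intensity T) N"
    and "hawkes_process M N T \<mu> \<Phi> H \<Lambda>"
    and "claim_sequences M N T \<eta> \<theta> \<eta>' \<theta>'"
    and "f \<in> borel_measurable (restrict_space borel {0..})"
    and "\<And>x. x \<ge> 0 \<Longrightarrow> f x \<ge> 0" and "bounded (f ` {0..})"
    and "g \<in> borel_measurable (restrict_space borel ({0..} \<times> {0..}))"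
    and "\<And>x y. x \<ge> 0 \<Longrightarrow> y \<ge> 0 \<Longrightarrow> g (x, y) \<ge> 0" and "bounded (g ` ({0..} \<times> {0..}))"
    and "h \<in> borel_measurable (restrict_space borel {0..})"
    and "\<And>x. x \<ge> 0 \<Longrightarrow> h x \<ge> 0" and "bounded (h ` {0..})"
    and "mono_on {0..} h"
  defines "L \<equiv> \<lambda>\<omega>. \<Sum>i=1..H T \<omega>. f (\<eta> i \<omega>)"
    and "K \<equiv> \<lambda>\<omega>. \<Sum>i=1..H T \<omega>. g (\<eta> i \<omega>, \<theta> i \<omega>)"
  shows "(LINT \<omega>|M. K \<omega> * h (L \<omega>)) \<ge>
    \<mu> * (\<Sum>n. m_Phi \<Phi> T (Suc n) *
      (\<Sum>p. exp (- T * \<mu>) * (T * \<mu>) ^ p / fact p *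
        (LINT \<omega>|M. g (\<eta>' 1 \<omega>, \<theta>' 1 \<omega>) *
          real_cond_exp M (vimage_algebra (space M) (\<eta>' 1) borel)
            (\<lambda>\<omega>. h ((\<Sum>k=1..Suc n. f (\<eta>' k \<omega>)) + (\<Sum>i=1..p. f (\<eta> i \<omega>)))) \<omega>)))"
proof -
  from assms(16) obtain Bg where Bg: "\<And>z. z \<in> {0..} \<times> {0..} \<Longrightarrow> norm (g z) \<le> Bg"
    unfolding bounded_iff by (metis imageI)
  from assms(19) obtain Bh where Bh: "\<And>x. x \<in> {0..} \<Longrightarrow> norm (h x) \<le> Bh"
    unfolding bounded_iff by (metis imageI)
  have Bg': "g (x, y) \<le> Bg" if "0 \<le> x" "0 \<le> y" for x y using Bg[of "(x, y)"] that by simp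
  have Bh': "h x \<le> Bh" if "0 \<le> x" for x using Bh[of x] that by simp
  interpret hawkes_claims M T N \<mu> \<Phi> H \<Lambda> \<eta> \<theta> \<eta>' \<theta>' f h g Bg Bh
    by (intro hawkes_claims.intro hawkes_model.intro strip_noise.intro poisson_noise.intro
        poisson_noise_axioms.intro hawkes_model_axioms.intro hawkes_claims_axioms.intro)
      (fact assms Bg' Bh')+
  have "(LINT \<omega>|M. K \<omega> * h (L \<omega>)) = expectation (\<lambda>\<omega>. portfolio (H T \<omega>) \<omega>)"
    unfolding K_def L_def by (intro Bochner_Integration.integral_cong refl portfolio_eq[symmetric])
  then show ?thesis
    using portfolio_bound unfolding conditional_term by simp
qed

end
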